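(* Let $p=1$ or $p=\infty$, and let $r,\alpha,\varepsilon>0$. Then there is a positive constant $C(r,\alpha,\varepsilon)$ such that the following hold. **I.** If for $f\in L_p$ the series $\sum_{\nu=1}^\infty\nu^{r-1}\omega_{r+\alpha+\varepsilon}\left(f,\frac1\nu\right)_p$ converges, then there exists $\widetilde f^{(r)}\in L_p$ and, for all $n\in\mathbf{N}$, $$\omega_\alpha\left(\widetilde f^{(r)},\tfrac1n\right)_p\le C(r,\alpha,\varepsilon)\Bigl(n^{-\alpha}\sum_{\nu=1}^n\nu^{r+\alpha-1}\omega_{r+\alpha+\varepsilon}\left(f,\tfrac1\nu\right)_p+\sum_{\nu=n+1}^\infty\nu^{r-1}\omega_{r+\alpha+\varepsilon}\left(f,\tfrac1\nu\right)_p\Bigr).$$ **II.** If for $f\in L_p$ there exists $\widetilde f^{(r)}\in L_p$, then for all $n\in\mathbf{N}$, $$\omega_{r+\alpha+\varepsilon}\left(f,\tfrac1n\right)_p\le\frac{C(r,\alpha,\varepsilon)}{n^r}\,\omega_\alpha\left(\widetilde f^{(r)},\tfrac1n\right)_p.$$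
   Context: $L_1=L_1[0,2\pi]$ is the space of $2\pi$-periodic functions integrable over a period, with the usual norm; $L_\infty$ denotes the space $C[0,2\pi]$ of $2\pi$-periodic continuous functions with the maximum norm. Fractional modulus of smoothness of order $\gamma>0$: $\omega_\gamma(f,\delta)_p=\sup_{|h|\le\delta}\|\triangle_h^\gamma f\|_p$, where $\triangle_h^\gamma f(x)=\sum_{\nu=0}^\infty(-1)^\nu\binom{\gamma}{\nu}f(x+(\gamma-\nu)h)$ and $\binom{\gamma}{\nu}=\frac{\gamma(\gamma-1)\cdots(\gamma-\nu+1)}{\nu!}$, $\binom{\gamma}{0}=1$. $\widetilde f^{(r)}$ is the Weyl derivative of order $r$ of the function conjugate to $f$: if $f$ has Fourier series $\frac{a_0}{2}+\sum_{\nu\ge1}(a_\nu\cos\nu x+b_\nu\sin\nu x)$, then, up to sign, $\widetilde f^{(r)}$ is the function with Fourier series $\sum_{\nu\ge1}\nu^r\left[a_\nu\cos\left(\nu x+\frac{\pi(r+1)}2\right)+b_\nu\sin\left(\nu x+\frac{\pi(r+1)}2\right)\right]$; "$\widetilde f^{(r)}\in L_p$ exists" means that this series is the Fourier series of a function in $L_p$. *)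

theory Defs
  imports "HOL-Analysis.Analysis"
begin

text \<open>Elements of \<open>L\<^sub>p\<close> are represented by everywhere defined \<open>2\<pi>\<close>-periodic functions. For
  \<open>p = \<infinity>\<close> the space consists of the \<^emph>\<open>continuous\<close> periodic functions. Two functions of the space
  for \<open>p = 1\<close> that agree almost everywhere have the same norm, Fourier coefficients and moduli.\<close>

definition Lp :: "ennreal \<Rightarrow> (real \<Rightarrow> real) set" where
  "Lp p = {f. (\<forall>x. f (x + 2 * pi) = f x) \<and>
     (if p = \<infinity> then continuous_on UNIV f
      else f \<in> borel_measurable lebesgue \<and>
        set_integrable lebesgue {0..2*pi} (\<lambda>x. \<bar>f x\<bar> powr enn2real p))}"

definition Lp_norm :: "ennreal \<Rightarrow> (real \<Rightarrow> real) \<Rightarrow> real" where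
  "Lp_norm p f =
     (if p = \<infinity> then (SUP x\<in>{0..2*pi}. \<bar>f x\<bar>)
      else (LINT x:{0..2*pi}|lebesgue. \<bar>f x\<bar> powr enn2real p) powr (1 / enn2real p))"

text \<open>For \<open>\<gamma> > 0\<close> the binomial coefficients are absolutely summable, so the series below
  converges for every \<open>x\<close> if \<open>f\<close> is continuous and periodic, and for almost every \<open>x\<close>
  (as well as in the norm) if \<open>f\<close> is in \<open>L\<^sub>1\<close>.\<close>

definition frac_diff :: "real \<Rightarrow> real \<Rightarrow> (real \<Rightarrow> real) \<Rightarrow> real \<Rightarrow> real" where
  "frac_diff \<gamma> h f x = (\<Sum>\<nu>. (- 1) ^ \<nu> * (\<gamma> gchoose \<nu>) * f (x + (\<gamma> - real \<nu>) * h))"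

definition modulus :: "ennreal \<Rightarrow> real \<Rightarrow> (real \<Rightarrow> real) \<Rightarrow> real \<Rightarrow> real" where
  "modulus p \<gamma> f \<delta> = (SUP h\<in>{h. \<bar>h\<bar> \<le> \<delta>}. Lp_norm p (frac_diff \<gamma> h f))"

definition fourier_cos :: "(real \<Rightarrow> real) \<Rightarrow> nat \<Rightarrow> real" where
  "fourier_cos f \<nu> = (1 / pi) * (LINT x:{0..2*pi}|lebesgue. f x * cos (real \<nu> * x))"

definition fourier_sin :: "(real \<Rightarrow> real) \<Rightarrow> nat \<Rightarrow> real" where
  "fourier_sin f \<nu> = (1 / pi) * (LINT x:{0..2*pi}|lebesgue. f x * sin (real \<nu> * x))"

text \<open>\<open>g\<close> is the Weyl derivative of order \<open>r\<close> of the function conjugate to \<open>f\<close> (up to sign): the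
  Fourier series of \<open>g\<close> has no constant term, and its \<open>\<nu>\<close>-th term, as a function of \<open>x\<close>, is the
  \<open>\<nu>\<close>-th term of \<open>f\<close> shifted in phase by \<open>\<pi> (r + 1) / 2\<close> and multiplied by \<open>\<nu>\<^sup>r\<close>.
  A relation is used because \<open>g\<close> need not exist, and is determined only almost
  everywhere for \<open>p = 1\<close>.\<close>

definition conj_weyl_deriv ::
    "ennreal \<Rightarrow> real \<Rightarrow> (real \<Rightarrow> real) \<Rightarrow> (real \<Rightarrow> real) \<Rightarrow> bool" where
  "conj_weyl_deriv p r f g \<longleftrightarrow> g \<in> Lp p \<and> fourier_cos g 0 = 0 \<and>
     (\<forall>\<nu>\<ge>1. \<forall>x. fourier_cos g \<nu> * cos (real \<nu> * x) + fourier_sin g \<nu> * sin (real \<nu> * x) =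
        real \<nu> powr r * (fourier_cos f \<nu> * cos (real \<nu> * x + pi * (r + 1) / 2) +
                         fourier_sin f \<nu> * sin (real \<nu> * x + pi * (r + 1) / 2)))"

lemma Lp_1_iff:
  "f \<in> Lp 1 \<longleftrightarrow> (\<forall>x. f (x + 2 * pi) = f x) \<and> f \<in> borel_measurable lebesgue \<and>
     f absolutely_integrable_on {0..2*pi}"
proof -
  have "set_integrable lebesgue {0..2*pi} (\<lambda>x. \<bar>f x\<bar>) \<longleftrightarrow> f absolutely_integrable_on {0..2*pi}"
    if "f \<in> borel_measurable lebesgue"
  proof
    assume "set_integrable lebesgue {0..2*pi} (\<lambda>x. \<bar>f x\<bar>)"
    then show "f absolutely_integrable_on {0..2*pi}"
      unfolding set_integrable_def
    proof (rule Bochner_Integration.integrable_bound)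
      show "(\<lambda>x. indicat_real {0..2*pi} x *\<^sub>R f x) \<in> borel_measurable lebesgue"
        using that by (intro borel_measurable_scaleR borel_measurable_indicator) auto
    qed (auto simp: indicator_def)
  next
    assume "f absolutely_integrable_on {0..2*pi}"
    then show "set_integrable lebesgue {0..2*pi} (\<lambda>x. \<bar>f x\<bar>)"
      by (rule set_integrable_abs)
  qed
  then show ?thesis
    by (auto simp: Lp_def)
qed

lemma Lp_norm_1: "Lp_norm 1 f = (LINT x:{0..2*pi}|lebesgue. \<bar>f x\<bar>)"
proof -
  have "0 \<le> (LINT x:{0..2*pi}|lebesgue. \<bar>f x\<bar>)"
    by (auto simp: set_lebesgue_integral_def)
  then show ?thesis
    by (simp add: Lp_norm_def)
qed

end

theory Submission
  imports Defs
begin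

text \<open>On the Fourier side \<open>frac_diff \<gamma> h\<close> multiplies the \<open>k\<close>-th coefficient by
  \<open>e\<^sup>i\<^sup>\<gamma>\<^sup>\<theta> (1 - e\<^sup>-\<^sup>i\<^sup>\<theta>)\<^sup>\<gamma>\<close> with \<open>\<theta> = k h\<close>. For \<open>0 < \<theta> < 2 \<pi>\<close> this is the real amplitude
  \<open>(2 sin (\<theta> / 2))\<^sup>\<gamma>\<close> times a phase that is affine in \<open>\<theta>\<close>, and an affine phase is a translation
  together with a constant phase. A dyadic partition of unity cuts all functions into pieces with
  frequencies \<open>k \<approx> 2\<^sup>j\<close>; on such a piece, dividing by or multiplying with amplitudes of this kind and
  with \<open>k\<^sup>r\<close> is a multiplier whose kernel has an \<open>L\<^sub>1\<close> norm bounded uniformly in \<open>j\<close>, also when it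
  carries a constant phase. Hence, with \<open>\<gamma> = r + \<alpha> + \<epsilon>\<close>, the \<open>j\<close>-th piece of the derivative \<open>g\<close> has
  norm at most \<open>C 2\<^sup>j\<^sup>r \<omega>\<^sub>\<gamma>(f, 2\<^sup>-\<^sup>j)\<close>, and differencing it gains the factor \<open>min (1, (2\<^sup>j |h|)\<^sup>\<alpha>)\<close>; summing
  over \<open>j\<close> gives part I. Conversely the \<open>j\<close>-th piece of \<open>\<triangle>\<^sub>h\<^sup>\<gamma> f\<close> is at most \<open>C |h|\<^sup>r\<close> times the norm of
  \<open>\<triangle>\<^sub>h\<^sup>\<alpha> g\<close>, with the extra factor \<open>(2\<^sup>j |h|)\<^sup>\<epsilon>\<close> for \<open>2\<^sup>j |h| \<le> 1\<close> and \<open>(2\<^sup>j |h|)\<^sup>-\<^sup>r\<close> otherwise, and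
  these sum to part II. The positive \<open>\<epsilon>\<close> is what makes the low frequencies summable.\<close>

subsection \<open>Periodic functions and Fourier coefficients\<close>

text \<open>For p = 1 and p = \<infinity> conjugation is not a bounded operator, so the constant
  phases of the symbols cannot be removed from a whole function. On a dyadic piece they are
  harmless: its frequencies stay away from the jump at 0, and a kernel built from
  \<open>cos (k x + c)\<close> obeys the same estimate for every c. The second obstacle is that the
  symbol vanishes at all multiples of 2 \<pi> and is not smooth there in general, so it can be
  neither divided out nor used as a smooth amplitude globally. Division is therefore only by the
  difference of step 2^-j, for which \<theta> = k / 2^j lies in [1/2, 2], and the amplitude of step
  h is used only when 2^j |h| <= 1. For larger |h| the difference is estimated as an operator, by
  the absolute sum of its binomial coefficients. Relations between functions are checked on Fourier
  coefficients alone: uniqueness turns them into equality of norms, and the only series summed are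
  those converging absolutely in norm, never the Fourier series.\<close>

abbreviation circ :: "real measure" where "circ \<equiv> lebesgue_on {0..2*pi}"

text \<open>This is a_k - i b_k, twice the usual complex coefficient. The functions are real, so
  indices k >= 0 carry all information, and phase shifts and translations become multiplication by
  \<open>cis\<close>.\<close>

definition fourier_coeff :: "(real \<Rightarrow> real) \<Rightarrow> nat \<Rightarrow> complex" where
  "fourier_coeff f k = Complex (fourier_cos f k) (- fourier_sin f k)"

text \<open>The half-open period differs from the closed one by a null set, and its translates by 2
  \<pi> tile the line, which the translation argument needs.\<close>

lemma circ_integrable_iff:
  fixes f :: "real \<Rightarrow> 'a::euclidean_space"
  shows "integrable circ f \<longleftrightarrow> integrable lebesgue (\<lambda>x. indicator {0..<2*pi} x *\<^sub>R f x)"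
proof -
  have "integrable circ f \<longleftrightarrow> integrable lebesgue (\<lambda>x. indicator {0..2*pi} x *\<^sub>R f x)"
    by (subst integrable_restrict_space) auto
  also have "\<dots> \<longleftrightarrow> integrable lebesgue (\<lambda>x. indicator {0..<2*pi} x *\<^sub>R f x)"
  proof -
    have *: "integrable lebesgue (\<lambda>x. indicator {0..<2*pi} x *\<^sub>R f x)"
      if "integrable lebesgue (\<lambda>x. indicator {0..2*pi} x *\<^sub>R f x)"
    proof -
      have "integrable lebesgue (\<lambda>x. indicator {0..<2*pi} x *\<^sub>R indicator {0..2*pi} x *\<^sub>R f x)"
        by (rule integrable_mult_indicator) (use that in auto)
      then show ?thesis
        by (rule back_subst[where P="integrable lebesgue"]) (auto simp: indicator_def)
    qed
    have **: "integrable lebesgue (\<lambda>x. indicator {0..2*pi} x *\<^sub>R f x)"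
      if "integrable lebesgue (\<lambda>x. indicator {0..<2*pi} x *\<^sub>R f x)"
    proof -
      have "integrable lebesgue (\<lambda>x. indicator {2*pi} x *\<^sub>R f (2*pi))"
        by (intro integrable_scaleR_left integrable_real_indicator) auto
      from Bochner_Integration.integrable_add[OF that this] show ?thesis
        by (rule back_subst[where P="integrable lebesgue"]) (auto simp: indicator_def fun_eq_iff)
    qed
    show ?thesis using * ** by blast
  qed
  finally show ?thesis .
qed

lemma circ_integral_eq:
  fixes f :: "real \<Rightarrow> 'a::euclidean_space"
  assumes "integrable circ f"
  shows "integral\<^sup>L circ f = (LINT x|lebesgue. indicator {0..<2*pi} x *\<^sub>R f x)"
proof -
  have ae: "AE x in lebesgue. x \<noteq> 2*pi"
    by (rule AE_I'[of "{2*pi}"]) auto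
  have m: "(\<lambda>x. indicator {0..2*pi} x *\<^sub>R f x) \<in> borel_measurable lebesgue"
    using assms by (subst (asm) integrable_restrict_space) auto
  have "integral\<^sup>L circ f = (LINT x|lebesgue. indicator {0..2*pi} x *\<^sub>R f x)"
    by (subst integral_restrict_space) auto
  also have "\<dots> = (LINT x|lebesgue. indicator {0..<2*pi} x *\<^sub>R f x)"
  proof (rule integral_cong_AE[OF m borel_measurable_integrable[OF assms[unfolded circ_integrable_iff]]])
    show "AE x in lebesgue. indicator {0..2*pi} x *\<^sub>R f x = indicator {0..<2*pi} x *\<^sub>R f x"
      using ae by eventually_elim (auto simp: indicator_def)
  qed
  finally show ?thesis .
qed

lemma periodic_int:
  assumes "\<And>x::real. f (x + 2*pi) = f x"
  shows "f (x + 2*pi* of_int m) = f x"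
proof -
  have *: "f (x + 2*pi*real n) = f x" for n x
  proof (induction n arbitrary: x)
    case (Suc n)
    have "f (x + 2*pi*real (Suc n)) = f ((x + 2*pi*real n) + 2*pi)" by (simp add: algebra_simps)
    then show ?case using assms Suc by metis
  qed simp
  show ?thesis
  proof (cases "m \<ge> 0")
    case True then show ?thesis using *[of x "nat m"] by simp
  next
    case False
    have "f (x + 2*pi* of_int m + 2*pi*real (nat (-m))) = f (x + 2*pi* of_int m)" using * by blast
    then show ?thesis using False by simp
  qed
qed

text \<open>By periodicity the shift may be taken as b in [0, 2 \<pi>); the period is then cut at b
  and the two pieces change places.\<close>

lemma circ_shift:
  fixes f :: "real \<Rightarrow> 'a::euclidean_space"
  assumes per: "\<And>x. f (x + 2*pi) = f x" and int: "integrable circ f"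
  shows "integrable circ (\<lambda>x. f (x + a))"
    and "integral\<^sup>L circ (\<lambda>x. f (x + a)) = integral\<^sup>L circ f"
proof -
  define m where "m = \<lfloor>a / (2*pi)\<rfloor>"
  define b where "b = a - 2*pi* of_int m"
  have b: "0 \<le> b" "b < 2*pi"
    using floor_divide_lower[of "2*pi" a] floor_divide_upper[of "2*pi" a]
    by (auto simp: b_def m_def algebra_simps)
  have fa: "f (x + a) = f (x + b)" for x
    using periodic_int[of f "x+b" m, OF per] by (simp add: b_def algebra_simps)
  let ?G1 = "\<lambda>x. indicator {0..<b} x *\<^sub>R f x"
  let ?G2 = "\<lambda>x. indicator {b..<2*pi} x *\<^sub>R f x"
  let ?F = "\<lambda>x. indicator {0..<2*pi} x *\<^sub>R f x"
  have F: "integrable lebesgue ?F" using int by (simp add: circ_integrable_iff)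
  have "integrable lebesgue (\<lambda>x. indicator {0..<b} x *\<^sub>R ?F x)"
    by (rule integrable_mult_indicator) (use F in auto)
  then have G1: "integrable lebesgue ?G1"
    by (rule back_subst[where P="integrable lebesgue"]) (use b in \<open>auto simp: indicator_def\<close>)
  have "integrable lebesgue (\<lambda>x. indicator {b..<2*pi} x *\<^sub>R ?F x)"
    by (rule integrable_mult_indicator) (use F in auto)
  then have G2: "integrable lebesgue ?G2"
    by (rule back_subst[where P="integrable lebesgue"]) (use b in \<open>auto simp: indicator_def\<close>)
  have eq: "?F = (\<lambda>x. ?G1 x + ?G2 x)" using b by (auto simp: indicator_def)
  \<comment> \<open>For x < 2 \<pi> - b the translate reads the piece on [b, 2 \<pi>), afterwards
    the piece on [0, b). The factor \<open>1 * x\<close> gives the shape of the affine substitution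
    rules.\<close>
  have eq2: "indicator {0..<2*pi} x *\<^sub>R f (x + a) = ?G2 (b + 1 * x) + ?G1 ((b - 2*pi) + 1 * x)" for x
  proof (cases "0 \<le> x \<and> x < 2*pi - b")
    case True
    then show ?thesis using b fa[of x] by (auto simp: indicator_def add.commute[of b x])
  next
    case False
    have "f (x + b) = f (x + b - 2*pi)" using per[of "x + b - 2*pi"] by simp
    then show ?thesis using b fa[of x] False by (auto simp: indicator_def algebra_simps)
  qed
  have G1s: "integrable lebesgue (\<lambda>x. ?G1 ((b - 2*pi) + 1 * x))"
    by (subst lebesgue_integrable_real_affine_iff[of 1 ?G1 "b - 2*pi"]) (use G1 in auto)
  have G2s: "integrable lebesgue (\<lambda>x. ?G2 (b + 1 * x))"
    by (subst lebesgue_integrable_real_affine_iff[of 1 ?G2 b]) (use G2 in auto)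
  show 1: "integrable circ (\<lambda>x. f (x + a))"
    unfolding circ_integrable_iff eq2 by (intro Bochner_Integration.integrable_add G1s G2s)
  show "integral\<^sup>L circ (\<lambda>x. f (x + a)) = integral\<^sup>L circ f"
    unfolding circ_integral_eq[OF 1] circ_integral_eq[OF int] eq2
    unfolding Bochner_Integration.integral_add[OF G2s G1s] 
    using lebesgue_integral_real_affine[of 1 ?G1 "b - 2*pi"] lebesgue_integral_real_affine[of 1 ?G2 b]
    unfolding eq Bochner_Integration.integral_add[OF G1 G2] by simp
qed

lemma finite_measure_circ: "finite_measure circ"
  by (rule finite_measure_lebesgue_on) auto

lemma measurable_circ: "f \<in> borel_measurable lebesgue \<Longrightarrow> f \<in> borel_measurable circ"
  by (rule measurable_restrict_space1)

lemma continuous_circ_integrable: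
  fixes f :: "real \<Rightarrow> 'a::euclidean_space"
  assumes "continuous_on UNIV f"
  shows "integrable circ f"
  by (rule continuous_imp_integrable_real) (use assms continuous_on_subset in blast)

lemma continuous_measurable_lebesgue:
  fixes f :: "real \<Rightarrow> 'a::euclidean_space"
  assumes "continuous_on UNIV f"
  shows "f \<in> borel_measurable lebesgue"
  using borel_measurable_continuous_onI[OF assms] by (intro measurable_completion) simp

lemma Lp_1_iff': "f \<in> Lp 1 \<longleftrightarrow> (\<forall>x. f (x + 2 * pi) = f x) \<and> f \<in> borel_measurable lebesgue \<and>
     integrable circ f"
  unfolding Lp_1_iff by (auto simp: integrable_restrict_space set_integrable_def)

lemma Lp_inf_iff: "f \<in> Lp top \<longleftrightarrow> (\<forall>x. f (x + 2 * pi) = f x) \<and> continuous_on UNIV f"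
  by (simp add: Lp_def infinity_ennreal_def)

lemma Lp_norm_1': "Lp_norm 1 f = (LINT x|circ. \<bar>f x\<bar>)"
  unfolding Lp_norm_1 by (subst integral_restrict_space) (auto simp: set_lebesgue_integral_def)

lemma Lp_norm_inf: "Lp_norm top f = (SUP x\<in>{0..2*pi}. \<bar>f x\<bar>)"
  by (simp add: Lp_norm_def infinity_ennreal_def)

lemma Lp_periodic: "f \<in> Lp p \<Longrightarrow> f (x + 2*pi) = f x"
  by (simp add: Lp_def)

lemma Lp_subset_L1: "p \<in> {1, top} \<Longrightarrow> f \<in> Lp p \<Longrightarrow> f \<in> Lp 1"
  by (auto simp: Lp_1_iff' Lp_inf_iff continuous_circ_integrable continuous_measurable_lebesgue)

lemma periodic_reduce:
  assumes "\<And>x::real. f (x + 2*pi) = f x"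
  obtains y where "y \<in> {0..2*pi}" "f y = f x"
proof
  define m where "m = \<lfloor>x / (2*pi)\<rfloor>"
  show "x - 2*pi* of_int m \<in> {0..2*pi}"
    using floor_divide_lower[of "2*pi" x] floor_divide_upper[of "2*pi" x]
    by (auto simp: m_def algebra_simps)
  show "f (x - 2*pi* of_int m) = f x"
    using periodic_int[of f "x - 2*pi* of_int m" m, OF assms] by simp
qed

lemma Lp_norm_inf_ge:
  assumes "f \<in> Lp top" shows "\<bar>f x\<bar> \<le> Lp_norm top f"
proof -
  from assms have p: "\<And>x. f (x + 2 * pi) = f x" and c: "continuous_on UNIV f" by (auto simp: Lp_inf_iff)
  obtain y where y: "y \<in> {0..2*pi}" "f y = f x" using periodic_reduce[of f x, OF p] by blast
  have "compact ((\<lambda>x. \<bar>f x\<bar>) ` {0..2*pi})"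
    by (intro compact_continuous_image continuous_intros continuous_on_subset[OF c]) auto
  then have "bdd_above ((\<lambda>x. \<bar>f x\<bar>) ` {0..2*pi})" by (simp add: bounded_imp_bdd_above compact_imp_bounded)
  then have "\<bar>f y\<bar> \<le> Lp_norm top f" unfolding Lp_norm_inf using y by (intro cSUP_upper)
  then show ?thesis using y by simp
qed

lemma Lp_norm_inf_le:
  assumes "\<And>x. \<bar>f x\<bar> \<le> B" shows "Lp_norm top f \<le> B"
  unfolding Lp_norm_inf using assms by (intro cSUP_least) auto

lemma Lp_norm_nonneg: "p \<in> {1, top} \<Longrightarrow> f \<in> Lp p \<Longrightarrow> 0 \<le> Lp_norm p f"
  using Lp_norm_inf_ge[of f 0] by (auto simp: Lp_norm_1')

lemma Lp_shift:
  assumes p: "p \<in> {1, top}" and f: "f \<in> Lp p"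
  shows "(\<lambda>x. f (x + a)) \<in> Lp p" "Lp_norm p (\<lambda>x. f (x + a)) = Lp_norm p f"
proof -
  have per: "\<And>x. f (x + 2 * pi) = f x" using f by (auto simp: Lp_def)
  then have per': "\<And>x. f (x + 2 * pi + a) = f (x + a)"
    by (metis add.assoc add.commute)
  have *: "(\<lambda>x. f (x + a)) \<in> Lp p \<and> Lp_norm p (\<lambda>x. f (x + a)) = Lp_norm p f"
  proof (cases "p = 1")
    case True
    from f True have m: "f \<in> borel_measurable lebesgue" and i: "integrable circ f" by (auto simp: Lp_1_iff')
    have "f \<circ> (\<lambda>x. a + 1 * x) \<in> borel_measurable lebesgue"
      using lebesgue_affine_measurable[where c= "\<lambda>x::real. 1" and t=a] m by (intro measurable_comp) auto
    then have m': "(\<lambda>x. f (x + a)) \<in> borel_measurable lebesgue" by (simp add: o_def add.commute)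
    then show ?thesis using True circ_shift(1)[OF per i, of a] per'
        circ_shift(2)[of "\<lambda>x. \<bar>f x\<bar>" a] per i by (auto simp: Lp_1_iff' Lp_norm_1')
  next
    case False
    with p have [simp]: "p = top" by auto
    have c: "continuous_on UNIV f" using f by (simp add: Lp_inf_iff)
    have 1: "(\<lambda>x. f (x + a)) \<in> Lp top"
      unfolding Lp_inf_iff using per' by (auto intro!: continuous_on_compose2[OF c] continuous_intros)
    have "Lp_norm top (\<lambda>x. f (x + a)) \<le> Lp_norm top f"
      by (rule Lp_norm_inf_le) (use f Lp_norm_inf_ge in auto)
    moreover have "Lp_norm top f \<le> Lp_norm top (\<lambda>x. f (x + a))"
      by (rule Lp_norm_inf_le) (use Lp_norm_inf_ge[OF 1, of "_ - a"] in auto)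
    ultimately show ?thesis using 1 by auto
  qed
  show "(\<lambda>x. f (x + a)) \<in> Lp p" "Lp_norm p (\<lambda>x. f (x + a)) = Lp_norm p f" using * by auto
qed

lemma integrable_circ_mult_bounded:
  fixes g :: "real \<Rightarrow> 'a::euclidean_space"
  assumes f: "integrable circ f" and g: "continuous_on UNIV g" and b: "\<And>x. norm (g x) \<le> B"
  shows "integrable circ (\<lambda>x. f x *\<^sub>R g x)"
proof (rule Bochner_Integration.integrable_bound[of circ "\<lambda>x. B * f x"])
  show "integrable circ (\<lambda>x. B * f x)" using f by simp
  show "(\<lambda>x. f x *\<^sub>R g x) \<in> borel_measurable circ"
    using f measurable_circ[OF continuous_measurable_lebesgue[OF g]] by simp
  have "0 \<le> B" using b[of 0] norm_ge_zero order_trans by blast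
  then have "norm (f x *\<^sub>R g x) \<le> norm (B * f x)" for x
    using mult_left_mono[OF b[of x] abs_ge_zero[of "f x"]] by (simp add: abs_mult mult.commute)
  then show "AE x in circ. norm (f x *\<^sub>R g x) \<le> norm (B * f x)" by simp
qed

lemma fourier_coeff_integrable:
  assumes "f \<in> Lp 1"
  shows "integrable circ (\<lambda>x. f x *\<^sub>R cis (- real k * x))"
  by (rule integrable_circ_mult_bounded[where B=1])
     (use assms in \<open>auto simp: Lp_1_iff' intro!: continuous_intros\<close>)

lemma fourier_coeff_eq_integral:
  assumes "f \<in> Lp 1"
  shows "fourier_coeff f k = (LINT x|circ. f x *\<^sub>R cis (- real k * x)) /\<^sub>R pi"
proof -
  have i: "integrable circ f" using assms by (simp add: Lp_1_iff')
  note I = fourier_coeff_integrable[OF assms, of k]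
  have R: "Re (LINT x|circ. f x *\<^sub>R cis (- real k * x)) = (LINT x|circ. f x * cos (real k * x))"
    by (subst integral_Re[OF I, symmetric]) simp
  have Im: "Im (LINT x|circ. f x *\<^sub>R cis (- real k * x)) = - (LINT x|circ. f x * sin (real k * x))"
    by (subst integral_Im[OF I, symmetric]) simp
  show ?thesis
    unfolding fourier_coeff_def fourier_cos_def fourier_sin_def set_lebesgue_integral_def complex_eq_iff
    using R Im by (simp add: integral_restrict_space field_simps)
qed

lemma fourier_coeff_shift:
  assumes "f \<in> Lp 1"
  shows "fourier_coeff (\<lambda>x. f (x + a)) k = cis (real k * a) * fourier_coeff f k"
proof -
  have per: "f (x + 2*pi) *\<^sub>R cis (- real k * (x + 2*pi)) = f x *\<^sub>R cis (- real k * x)" for x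
  proof -
    have "cis (- real k * (x + 2*pi)) = cis (- real k * x) * cis (2 * pi * of_int (- int k))"
      unfolding cis_mult by (simp add: algebra_simps)
    also have "cis (2 * pi * of_int (- int k)) = 1" by (rule cis_multiple_2pi) simp
    finally show ?thesis using Lp_periodic[OF assms] by simp
  qed
  have eq: "f (x + a) *\<^sub>R cis (- real k * x) = cis (real k * a) * (f (x + a) *\<^sub>R cis (- real k * (x + a)))" for x
    unfolding mult_scaleR_right cis_mult by (simp add: algebra_simps)
  note s = circ_shift[OF per fourier_coeff_integrable[OF assms], of a]
  show ?thesis
    unfolding fourier_coeff_eq_integral[OF assms] fourier_coeff_eq_integral[OF Lp_shift(1)[OF insertI1 assms]] eq integral_mult_right_zero s(2)
    by simp
qed

subsection \<open>Series in the function spaces\<close>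

lemma Lp_norm_1_le_inf:
  assumes "f \<in> Lp top"
  shows "Lp_norm 1 f \<le> 2*pi * Lp_norm top f"
proof -
  have i: "integrable circ f" using assms by (auto simp: Lp_inf_iff continuous_circ_integrable)
  interpret finite_measure circ by (rule finite_measure_circ)
  have "Lp_norm 1 f \<le> (LINT x|circ. Lp_norm top f)"
    unfolding Lp_norm_1' by (rule integral_mono) (use i Lp_norm_inf_ge[OF assms] in auto)
  also have "\<dots> = 2*pi * Lp_norm top f" by (simp add: measure_restrict_space)
  finally show ?thesis .
qed

lemma Lp_cmult:
  assumes p: "p \<in> {1, top}" and f: "f \<in> Lp p"
  shows "(\<lambda>x. c * f x) \<in> Lp p" "Lp_norm p (\<lambda>x. c * f x) = \<bar>c\<bar> * Lp_norm p f"
proof -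
  show 1: "(\<lambda>x. c * f x) \<in> Lp p"
    using p f by (auto simp: Lp_1_iff' Lp_inf_iff intro!: continuous_intros)
  show "Lp_norm p (\<lambda>x. c * f x) = \<bar>c\<bar> * Lp_norm p f"
  proof (cases "p = 1")
    case True then show ?thesis by (simp add: Lp_norm_1' abs_mult)
  next
    case False
    with p have [simp]: "p = top" by auto
    have *: "Lp_norm top (\<lambda>x. c * f x) \<le> \<bar>c\<bar> * Lp_norm top f" if "f \<in> Lp top" for c f
      using Lp_norm_inf_ge[OF that] by (intro Lp_norm_inf_le) (auto simp: abs_mult mult_left_mono)
    show ?thesis
    proof (cases "c = 0")
      case True
      then show ?thesis by (simp add: Lp_norm_inf)
    next
      case False
      have "Lp_norm top f = Lp_norm top (\<lambda>x. (1/c) * (c * f x))" using False by simp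
      also have "\<dots> \<le> \<bar>1/c\<bar> * Lp_norm top (\<lambda>x. c * f x)" using 1 by (intro *) auto
      finally have "\<bar>c\<bar> * Lp_norm top f \<le> Lp_norm top (\<lambda>x. c * f x)"
        using False by (simp add: field_simps)
      then show ?thesis using *[of f c] f by simp
    qed
  qed
qed

lemma fourier_coeff_cmult:
  assumes f: "f \<in> Lp 1"
  shows "fourier_coeff (\<lambda>x. c * f x) k = of_real c * fourier_coeff f k"
proof -
  have *: "(c * f x) *\<^sub>R cis (- real k * x) = c *\<^sub>R (f x *\<^sub>R cis (- real k * x))" for x by simp
  show ?thesis unfolding fourier_coeff_eq_integral[OF f] fourier_coeff_eq_integral[OF Lp_cmult(1)[OF insertI1 f]] * integral_scaleR_right
    by (simp add: scaleR_conv_of_real)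
qed

text \<open>Summable norms make the sum of the |f j| integrable, so the series converges absolutely
  almost everywhere. Where it diverges, \<open>suminf\<close> is unspecified, but this concerns a
  null set only. The same domination gives termwise integration against \<open>cis\<close>.\<close>

lemma Lp_series_L1:
  assumes f: "\<And>j. f j \<in> Lp 1" and s: "summable (\<lambda>j. Lp_norm 1 (f j))"
  shows "(\<lambda>x. \<Sum>j::nat. f j x) \<in> Lp 1"
    and "Lp_norm 1 (\<lambda>x. \<Sum>j. f j x) \<le> (\<Sum>j. Lp_norm 1 (f j))"
    and "(\<lambda>j. fourier_coeff (f j) k) sums fourier_coeff (\<lambda>x. \<Sum>j. f j x) k"
proof -
  have i: "integrable circ (f j)" and m: "f j \<in> borel_measurable lebesgue" 
    and per: "f j (x + 2*pi) = f j x" for j x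
    using f[of j] by (auto simp: Lp_1_iff')
  have "(\<integral>\<^sup>+x. (\<Sum>j. ennreal \<bar>f j x\<bar>) \<partial>circ) = (\<Sum>j. \<integral>\<^sup>+x. ennreal \<bar>f j x\<bar> \<partial>circ)"
    by (rule nn_integral_suminf) (use i in auto)
  also have "\<dots> = (\<Sum>j. ennreal (Lp_norm 1 (f j)))"
    unfolding Lp_norm_1' using i by (intro suminf_cong nn_integral_eq_integral) auto
  also have "\<dots> \<noteq> top"
    by (rule ennreal_suminf_neq_top[OF s]) (simp add: Lp_norm_1')
  finally have fin: "(\<integral>\<^sup>+x. (\<Sum>j. ennreal \<bar>f j x\<bar>) \<partial>circ) \<noteq> \<infinity>"
    unfolding infinity_ennreal_def .
  have "(\<lambda>x. \<bar>f j x\<bar>) \<in> borel_measurable circ" for j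
    using borel_measurable_integrable[OF i[of j]] by (rule borel_measurable_abs)
  then have "(\<lambda>x. \<Sum>j. ennreal \<bar>f j x\<bar>) \<in> borel_measurable circ"
    by (intro borel_measurable_suminf_order measurable_compose[OF _ measurable_ennreal])
  from nn_integral_PInf_AE[OF this fin]
  have "AE x in circ. (\<Sum>j. ennreal \<bar>f j x\<bar>) \<noteq> top"
    unfolding infinity_ennreal_def .
  then have ae: "AE x in circ. summable (\<lambda>j. norm (f j x))"
    by eventually_elim (auto intro!: summable_suminf_not_top)
  have s': "summable (\<lambda>j. LINT x|circ. norm (f j x))" using s by (simp add: Lp_norm_1')
  show in1: "(\<lambda>x. \<Sum>j::nat. f j x) \<in> Lp 1"
    unfolding Lp_1_iff' using integrable_suminf[OF i ae s'] m per by auto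
  have ae2: "AE x in circ. summable (\<lambda>j. norm (norm (f j x)))" using ae by simp
  have s2: "summable (\<lambda>j. LINT x|circ. norm (norm (f j x)))" using s' by simp
  have "Lp_norm 1 (\<lambda>x. \<Sum>j. f j x) \<le> (LINT x|circ. (\<Sum>j. norm (f j x)))"
    unfolding Lp_norm_1'
  proof (rule integral_mono_AE)
    show "integrable circ (\<lambda>x. \<bar>\<Sum>j. f j x\<bar>)" using in1 by (simp add: Lp_1_iff')
    show "integrable circ (\<lambda>x. (\<Sum>j. norm (f j x)))"
      by (rule integrable_suminf[OF _ ae2 s2]) (use i in auto)
    show "AE x in circ. \<bar>\<Sum>j. f j x\<bar> \<le> (\<Sum>j. norm (f j x))"
      using ae by eventually_elim (metis summable_norm real_norm_def)
  qed
  also have "\<dots> = (\<Sum>j. Lp_norm 1 (f j))"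
    unfolding Lp_norm_1' using integral_suminf[OF _ ae2 s2] i by simp
  finally show "Lp_norm 1 (\<lambda>x. \<Sum>j. f j x) \<le> (\<Sum>j. Lp_norm 1 (f j))" .
  let ?g = "\<lambda>j x. f j x *\<^sub>R cis (- real k * x)"
  have gi: "integrable circ (?g j)" for j by (rule fourier_coeff_integrable[OF f])
  have ng: "norm (?g j x) = norm (f j x)" for j x by simp
  have "(\<lambda>j. integral\<^sup>L circ (?g j)) sums (\<integral>x. (\<Sum>j. ?g j x) \<partial>circ)"
    by (rule sums_integral[OF gi]) (unfold ng, use ae s' in auto)
  also have "(\<integral>x. (\<Sum>j. ?g j x) \<partial>circ) = (\<integral>x. (\<Sum>j. f j x) *\<^sub>R cis (- real k * x) \<partial>circ)"
  proof (rule integral_cong_AE)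
    show "(\<lambda>x. (\<Sum>j. ?g j x)) \<in> borel_measurable circ"
      using borel_measurable_integrable[OF gi] by (intro borel_measurable_suminf)
    show "(\<lambda>x. (\<Sum>j. f j x) *\<^sub>R cis (- real k * x)) \<in> borel_measurable circ"
      using borel_measurable_integrable[OF fourier_coeff_integrable[OF in1]] .
    show "AE x in circ. (\<Sum>j. ?g j x) = (\<Sum>j. f j x) *\<^sub>R cis (- real k * x)"
      using ae
    proof eventually_elim
      case (elim x)
      then have "summable (\<lambda>j. f j x)" by (rule summable_norm_cancel)
      then show ?case by (rule suminf_scaleR_left[symmetric])
    qed
  qed
  finally show "(\<lambda>j. fourier_coeff (f j) k) sums fourier_coeff (\<lambda>x. \<Sum>j. f j x) k"
    unfolding fourier_coeff_eq_integral[OF f] fourier_coeff_eq_integral[OF in1] by (rule sums_scaleR_right)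
qed

lemma Lp_series:
  assumes p: "p \<in> {1, top}" and f: "\<And>j. f j \<in> Lp p" and s: "summable (\<lambda>j. Lp_norm p (f j))"
  shows "(\<lambda>x. \<Sum>j::nat. f j x) \<in> Lp p" (is ?A)
    and "Lp_norm p (\<lambda>x. \<Sum>j. f j x) \<le> (\<Sum>j. Lp_norm p (f j))" (is ?B)
    and "(\<lambda>j. fourier_coeff (f j) k) sums fourier_coeff (\<lambda>x. \<Sum>j. f j x) k" (is ?C)
proof -
  have "?A \<and> ?B \<and> ?C"
  proof (cases "p = 1")
    case True then show ?thesis using Lp_series_L1[of f] f s by auto
  next
    case False
    with p have [simp]: "p = top" by auto
    have c: "continuous_on UNIV (f j)" and per: "f j (x + 2*pi) = f j x" for j x 
      using f[of j] by (auto simp: Lp_inf_iff)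
    have b: "\<bar>f j x\<bar> \<le> Lp_norm top (f j)" for j x using f[of j] by (intro Lp_norm_inf_ge) simp
    have s': "summable (\<lambda>j. Lp_norm top (f j))" using s by simp
    have f1: "f j \<in> Lp 1" for j using f p Lp_subset_L1 by blast
    \<comment> \<open>Convergence of the coefficients is inherited from p = 1, whose norm is at most
      2 \<pi> times the maximum norm.\<close>
    have "summable (\<lambda>j. Lp_norm 1 (f j))"
    proof (rule summable_comparison_test)
      show "\<exists>N. \<forall>n\<ge>N. norm (Lp_norm 1 (f n)) \<le> 2*pi * Lp_norm top (f n)"
        using f f1 Lp_norm_nonneg[of 1] Lp_norm_1_le_inf by auto
    qed (use s' in \<open>rule summable_mult\<close>)
    then have C: ?C by (rule Lp_series_L1(3)[OF f1])
    have "uniform_limit UNIV (\<lambda>n x. \<Sum>j<n. f j x) (\<lambda>x. \<Sum>j. f j x) sequentially"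
      by (rule Weierstrass_m_test[where M="\<lambda>j. Lp_norm top (f j)"]) (use b s' in auto)
    then have "continuous_on UNIV (\<lambda>x. \<Sum>j. f j x)"
      by (rule uniform_limit_theorem[rotated]) (auto intro!: always_eventually continuous_intros c)
    then have A: ?A using per by (simp add: Lp_inf_iff)
    have "\<bar>\<Sum>j. f j x\<bar> \<le> (\<Sum>j. Lp_norm top (f j))" for x
    proof -
      have "summable (\<lambda>j. \<bar>f j x\<bar>)"
        by (rule summable_comparison_test[OF _ s']) (use b in auto)
      then have "\<bar>\<Sum>j. f j x\<bar> \<le> (\<Sum>j. \<bar>f j x\<bar>)" by (rule summable_rabs)
      also have "\<dots> \<le> (\<Sum>j. Lp_norm top (f j))" by (rule suminf_le) (use b s' \<open>summable (\<lambda>j. \<bar>f j x\<bar>)\<close> in auto)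
      finally show ?thesis .
    qed
    then have ?B by (auto intro: Lp_norm_inf_le)
    then show ?thesis using A C by blast
  qed
  then show ?A ?B ?C by auto
qed

section \<open>Absolute summability of the binomial coefficients\<close>

lemma gbinomial_Suc_eq:
  fixes a :: real
  shows "a gchoose (Suc n) = (a gchoose n) * ((a - of_nat n) / of_nat (Suc n))"
proof -
  have "of_nat (Suc n) * (a gchoose (Suc n)) = (a - of_nat n) * (a gchoose n)"
    using gbinomial_mult_1[of a n] by (simp add: left_diff_distrib del: of_nat_Suc)
  moreover have "(of_nat (Suc n) :: real) \<noteq> 0" by simp
  ultimately show ?thesis
    by (metis mult.commute nonzero_mult_div_cancel_left times_divide_eq_right)
qed

text \<open>The ratio of consecutive terms is (\<gamma> - 1 - n) / (n + 1), whose modulus is at most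
  1 for n >= \<gamma> because \<gamma> > 0.\<close>

lemma gbinomial_bounded:
  fixes \<gamma> :: real
  assumes "\<gamma> > 0"
  shows "\<exists>B. \<forall>n. \<bar>(\<gamma> - 1) gchoose n\<bar> \<le> B"
proof -
  define N where "N = nat \<lceil>\<gamma>\<rceil>"
  have dec: "\<bar>(\<gamma> - 1) gchoose (Suc n)\<bar> \<le> \<bar>(\<gamma> - 1) gchoose n\<bar>" if "n \<ge> N" for n
  proof -
    have "(\<gamma> - 1) gchoose (Suc n) = ((\<gamma> - 1) gchoose n) * ((\<gamma> - 1 - of_nat n) / of_nat (Suc n))"
      by (rule gbinomial_Suc_eq)
    moreover have "\<bar>(\<gamma> - 1 - of_nat n) / of_nat (Suc n)\<bar> \<le> 1"
      using that assms by (simp add: N_def field_simps abs_le_iff)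
    ultimately show ?thesis
      unfolding abs_mult by (metis abs_ge_zero abs_mult mult_left_le)
  qed
  have le: "\<bar>(\<gamma> - 1) gchoose (N + k)\<bar> \<le> \<bar>(\<gamma> - 1) gchoose N\<bar>" for k
  proof (induction k)
    case (Suc k) then show ?case using dec[of "N + k"] by simp
  qed simp
  have "\<bar>(\<gamma> - 1) gchoose n\<bar> \<le> (\<Sum>i\<le>N. \<bar>(\<gamma> - 1) gchoose i\<bar>)" for n
  proof (cases "n \<le> N")
    case True
    show ?thesis by (rule member_le_sum) (use True in auto)
  next
    case False
    have "\<bar>(\<gamma> - 1) gchoose n\<bar> \<le> \<bar>(\<gamma> - 1) gchoose N\<bar>" using le[of "n - N"] False by simp
    also have "\<dots> \<le> (\<Sum>i\<le>N. \<bar>(\<gamma> - 1) gchoose i\<bar>)" by (rule member_le_sum) auto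
    finally show ?thesis .
  qed
  then show ?thesis by blast
qed

text \<open>The signed terms \<open>c n\<close> eventually keep one sign, and their partial sums
  are, up to sign, the binomial coefficients of \<gamma> - 1, which are bounded. Hence the absolute
  partial sums are bounded too.\<close>

lemma summable_abs_gbinomial:
  fixes \<gamma> :: real
  assumes "\<gamma> > 0"
  shows "summable (\<lambda>n. \<bar>\<gamma> gchoose n\<bar>)"
proof -
  define c where "c n = (- 1) ^ n * (\<gamma> gchoose n)" for n
  \<comment> \<open>From here on the factor (n - \<gamma>) / (n + 1) is nonnegative. The
    \<open>Suc\<close> lets the sum over i < N be read off \<open>part\<close>, whose sums include
    their last index.\<close>
  define N where "N = Suc (nat \<lceil>\<gamma>\<rceil>)"
  obtain B where B: "\<bar>(\<gamma> - 1) gchoose n\<bar> \<le> B" for n using gbinomial_bounded[OF assms] by blast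
  have part: "(\<Sum>k\<le>n. c k) = (- 1) ^ n * ((\<gamma> - 1) gchoose n)" for n
    unfolding c_def using gbinomial_sum_lower_neg[of \<gamma> n] by (simp add: mult.commute)
  have step: "c (Suc n) = c n * ((of_nat n - \<gamma>) / of_nat (Suc n))" for n
  proof -
    have "(of_nat n - \<gamma>) / of_nat (Suc n) = - ((\<gamma> - of_nat n) / of_nat (Suc n))"
      by (simp add: minus_divide_left del: of_nat_Suc)
    then show ?thesis unfolding c_def gbinomial_Suc_eq[of \<gamma> n] by simp
  qed
  define s where "s = sgn (c N)"
  have sg: "s * c (N + k) = \<bar>c (N + k)\<bar>" for k
  proof (induction k)
    case 0 then show ?case by (simp add: s_def mult_sgn_abs abs_sgn mult.commute)
  next
    case (Suc k)
    have nn: "0 \<le> (of_nat (N + k) - \<gamma>) / of_nat (Suc (N + k))"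
      unfolding N_def by (intro divide_nonneg_nonneg) linarith+
    have "s * c (N + Suc k) = (s * c (N + k)) * ((of_nat (N + k) - \<gamma>) / of_nat (Suc (N + k)))"
      using step[of "N + k"] by simp
    also have "\<dots> = \<bar>c (N + k)\<bar> * \<bar>(of_nat (N + k) - \<gamma>) / of_nat (Suc (N + k))\<bar>"
      unfolding Suc abs_of_nonneg[OF nn] ..
    also have "\<dots> = \<bar>c (N + Suc k)\<bar>" using step[of "N + k"] by (simp add: abs_mult)
    finally show ?case .
  qed
  have "summable (\<lambda>k. \<bar>c (k + N)\<bar>)"
  proof (rule summableI_nonneg_bounded[where x="2 * B"])
    fix n
    have "(\<Sum>i<n. \<bar>c (i + N)\<bar>) = s * (\<Sum>i<n. c (i + N))"
      using sg by (simp add: sum_distrib_left add.commute)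
    also have "(\<Sum>i<n. c (i + N)) = (\<Sum>i<n + N. c i) - (\<Sum>i<N. c i)"
      using sum.nat_group[of c] sum_diff_nat_ivl[of 0 N "N+n" c] sum.shift_bounds_nat_ivl[of c 0 N n]
      by (simp add: lessThan_atLeast0 add.commute)
    also have "s * \<dots> \<le> \<bar>s\<bar> * \<bar>(\<Sum>i<n + N. c i) - (\<Sum>i<N. c i)\<bar>" by (metis abs_ge_self abs_mult)
    also have "\<dots> \<le> 1 * (\<bar>\<Sum>i<n + N. c i\<bar> + \<bar>\<Sum>i<N. c i\<bar>)"
      by (intro mult_mono) (auto simp: s_def sgn_if)
    also have "\<dots> \<le> 2 * B"
    proof -
      have "\<bar>\<Sum>i<Suc m. c i\<bar> \<le> B" for m
        using B[of m] part[of m] by (simp add: lessThan_Suc_atMost abs_mult power_abs del: sum.lessThan_Suc)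
      from this[of "n + nat \<lceil>\<gamma>\<rceil>"] this[of "nat \<lceil>\<gamma>\<rceil>"] show ?thesis
        unfolding N_def by (simp del: sum.lessThan_Suc)
    qed
    finally show "(\<Sum>i<n. \<bar>c (i + N)\<bar>) \<le> 2 * B" .
  qed simp
  then have "summable (\<lambda>k. \<bar>c k\<bar>)" by (subst (asm) summable_iff_shift)
  then show ?thesis by (simp add: c_def abs_mult power_abs)
qed

subsection \<open>The symbol of the fractional difference\<close>

text \<open>Abel's argument: inside the disc this is the complex binomial theorem. Absolute
  summability makes the sum continuous along the radius up to the circle. The right side is
  continuous there as well: away from z = 1 the number 1 - z avoids the branch cut, and at z = 1 the
  power tends to 0 since \<gamma> > 0.\<close>

lemma binomial_series_circle:
  fixes z :: complex
  assumes \<gamma>: "\<gamma> > 0" and z: "norm z = 1"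
  shows "(\<lambda>n. of_real ((- 1) ^ n * (\<gamma> gchoose n)) * z ^ n) sums ((1 - z) powr of_real \<gamma>)"
proof -
  define a where "a n = complex_of_real ((- 1) ^ n * (\<gamma> gchoose n)) * z ^ n" for n
  have na: "norm (a n) = \<bar>\<gamma> gchoose n\<bar>" for n
    using z by (simp add: a_def norm_mult norm_power abs_mult power_abs)
  have sa: "summable (\<lambda>n. norm (a n))" unfolding na by (rule summable_abs_gbinomial[OF \<gamma>])
  define t where "t m = 1 - 1 / real (m + 2)" for m
  have t: "0 \<le> t m" "t m < 1" for m by (auto simp: t_def)
  have t1: "t \<longlonglongrightarrow> 1" unfolding t_def by real_asymp
  have "uniform_limit {0..1} (\<lambda>n x. \<Sum>i<n. a i * of_real x ^ i) (\<lambda>x. \<Sum>i. a i * of_real x ^ i) sequentially"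
  proof (rule Weierstrass_m_test[OF _ sa])
    fix n and x :: real assume "x \<in> {0..1}"
    then show "norm (a n * of_real x ^ n) \<le> norm (a n)"
      by (simp add: norm_mult norm_power mult_left_le power_le_one)
  qed
  then have "continuous_on {0..1::real} (\<lambda>x. \<Sum>i. a i * of_real x ^ i)"
    by (rule uniform_limit_theorem[rotated]) (auto intro!: always_eventually continuous_intros)
  then have "(\<lambda>m. (\<Sum>i. a i * of_real (t m) ^ i)) \<longlonglongrightarrow> (\<Sum>i. a i * of_real 1 ^ i)"
    by (rule continuous_on_tendsto_compose[OF _ t1]) (use t less_imp_le[OF t(2)] in auto)
  moreover have "(\<Sum>i. a i * of_real (t m) ^ i) = (1 - of_real (t m) * z) powr of_real \<gamma>" for m
  proof -
    have "norm (- (of_real (t m) * z)) < 1" using t[of m] z by (simp add: norm_mult)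
    from gen_binomial_complex[OF this, of "of_real \<gamma>"]
    have "(\<lambda>n. (of_real \<gamma> gchoose n) * (- (of_real (t m) * z)) ^ n) sums (1 - of_real (t m) * z) powr of_real \<gamma>"
      by simp
    moreover have "(of_real \<gamma> gchoose n) * (- (of_real (t m) * z)) ^ n = a n * of_real (t m) ^ n" for n
    proof -
      have "(of_real \<gamma> gchoose n) = (of_real (\<gamma> gchoose n) :: complex)"
        by (simp add: gbinomial_prod_rev)
      moreover have "(- (of_real (t m) * z)) ^ n = (- 1) ^ n * (of_real (t m) ^ n * z ^ n)"
        by (metis mult_minus1 power_mult_distrib)
      ultimately show ?thesis by (simp add: a_def)
    qed
    ultimately show ?thesis by (simp add: sums_iff)
  qed
  moreover have "(\<lambda>m. (1 - of_real (t m) * z) powr of_real \<gamma>) \<longlonglongrightarrow> (1 - z) powr of_real \<gamma>"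
  proof (cases "z = 1")
    case True
    have "(\<lambda>m. 1 - of_real (t m) * z) \<longlonglongrightarrow> 1 - of_real 1 * z" by (intro tendsto_intros t1)
    then have "(\<lambda>m. 1 - of_real (t m) * z) \<longlonglongrightarrow> 0" using True by simp
    from tendsto_powr_complex_0[OF this tendsto_const[of "of_real \<gamma>"]] show ?thesis using True \<gamma> by simp
  next
    case False
    have "Re z < 1"
    proof (rule ccontr)
      assume "\<not> Re z < 1"
      with z abs_Re_le_cmod[of z] have "Re z = 1" by linarith
      with z have "Im z = 0" using cmod_power2[of z] by simp
      with \<open>Re z = 1\<close> have "z = 1" by (simp add: complex_eq_iff)
      with False show False by simp
    qed
    then have *: "1 - z \<notin> \<real>\<^sub>\<le>\<^sub>0" by (auto simp: complex_nonpos_Reals_iff)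
    have "(\<lambda>m. (1 - of_real (t m) * z) powr of_real \<gamma>) \<longlonglongrightarrow> (1 - of_real 1 * z) powr of_real \<gamma>"
      by (intro tendsto_powr_complex tendsto_intros t1) (use * in auto)
    then show ?thesis by simp
  qed
  ultimately have "(\<Sum>i. a i) = (1 - z) powr of_real \<gamma>"
    using LIMSEQ_unique by fastforce
  then show ?thesis using summable_norm_cancel[OF sa] unfolding a_def by (simp add: sums_iff)
qed

definition diff_symbol :: "real \<Rightarrow> real \<Rightarrow> complex" where
  "diff_symbol \<gamma> \<theta> = cis (\<gamma> * \<theta>) * (1 - cis (- \<theta>)) powr of_real \<gamma>"

lemma diff_symbol_sums:
  assumes "\<gamma> > 0"
  shows "(\<lambda>n. of_real ((- 1) ^ n * (\<gamma> gchoose n)) * cis ((\<gamma> - real n) * \<theta>)) sums diff_symbol \<gamma> \<theta>"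
proof -
  have "of_real ((- 1) ^ n * (\<gamma> gchoose n)) * cis ((\<gamma> - real n) * \<theta>) =
    cis (\<gamma> * \<theta>) * (of_real ((- 1) ^ n * (\<gamma> gchoose n)) * cis (- \<theta>) ^ n)" for n
  proof -
    have "cis ((\<gamma> - real n) * \<theta>) = cis (\<gamma> * \<theta>) * cis (- \<theta>) ^ n"
      unfolding Complex.DeMoivre cis_mult by (simp add: algebra_simps)
    then show ?thesis by simp
  qed
  then show ?thesis unfolding diff_symbol_def
    using sums_mult[OF binomial_series_circle[OF assms norm_cis, of "- \<theta>"], of "cis (\<gamma> * \<theta>)"]
    by presburger
qed

text \<open>Lets the difference of order r + \<alpha> + \<epsilon> be read as one of order \<alpha>
  followed by one of order r + \<epsilon>.\<close>

lemma diff_symbol_add: "diff_symbol (a + b) \<theta> = diff_symbol a \<theta> * diff_symbol b \<theta>"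
  unfolding diff_symbol_def by (simp add: powr_add distrib_right flip: cis_mult)

text \<open>Removes the mean value: the coefficient at k = 0, which no dyadic piece contains, is 0
  in every difference. It rests on the convention \<open>0 powr z = 0\<close>.\<close>

lemma diff_symbol_0: "diff_symbol \<gamma> 0 = 0"
  by (simp add: diff_symbol_def)

text \<open>1 - \<open>cis (- \<theta>)\<close> has modulus 2 sin (\<theta>/2) and argument (\<pi> -
  \<theta>)/2. The latter lies in (-\<pi>/2, \<pi>/2), so \<open>?L\<close> is the principal
  logarithm.\<close>

lemma diff_symbol_polar:
  assumes "0 < \<theta>" "\<theta> < 2*pi"
  shows "diff_symbol \<gamma> \<theta> = of_real ((2 * sin (\<theta>/2)) powr \<gamma>) * cis (\<gamma> * (pi + \<theta>) / 2)"
proof -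
  have s: "0 < 2 * sin (\<theta>/2)" using assms by (simp add: sin_gt_zero)
  let ?L = "Complex (ln (2 * sin (\<theta>/2))) ((pi - \<theta>) / 2)"
  have "1 - cos \<theta> = 2 * sin (\<theta>/2) * sin (\<theta>/2)"
    using cos_double_sin[of "\<theta>/2"] by (simp add: power2_eq_square)
  moreover have "sin \<theta> = 2 * sin (\<theta>/2) * cos (\<theta>/2)" using sin_double[of "\<theta>/2"] by simp
  moreover have "cos ((pi - \<theta>) / 2) = sin (\<theta>/2)" "sin ((pi - \<theta>) / 2) = cos (\<theta>/2)"
    by (simp_all add: diff_divide_distrib cos_diff sin_diff)
  ultimately have "1 - cis (- \<theta>) = exp ?L"
    using s by (simp add: complex_eq_iff Re_exp Im_exp)
  moreover have "Ln (exp ?L) = ?L" using assms by (intro Ln_exp) auto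
  ultimately have "(1 - cis (- \<theta>)) powr of_real \<gamma> = exp (of_real \<gamma> * ?L)"
    by (simp add: powr_def)
  also have "\<dots> = of_real ((2 * sin (\<theta>/2)) powr \<gamma>) * cis (\<gamma> * ((pi - \<theta>) / 2))"
    using s by (simp add: exp_eq_polar powr_def)
  finally show ?thesis unfolding diff_symbol_def
    by (simp add: mult.left_commute cis_mult) (simp add: field_simps)
qed

lemma diff_symbol_minus: "diff_symbol \<gamma> (- \<theta>) = cnj (diff_symbol \<gamma> \<theta>)"
proof -
  have "cnj ((1 - cis (- \<theta>)) powr of_real \<gamma>) = cnj (1 - cis (- \<theta>)) powr cnj (of_real \<gamma>)"
    by (rule cnj_powr) simp
  then show ?thesis by (simp add: diff_symbol_def cis_cnj)
qed

text \<open>Translates have equal norms, so the series converges in norm. The operator bound does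
  not depend on h, which is what the pieces with 2^j |h| > 1 rely on.\<close>

lemma frac_diff_Lp:
  assumes p: "p \<in> {1, top}" and f: "f \<in> Lp p" and \<gamma>: "\<gamma> > 0"
  shows "frac_diff \<gamma> h f \<in> Lp p"
    and "Lp_norm p (frac_diff \<gamma> h f) \<le> (\<Sum>n. \<bar>\<gamma> gchoose n\<bar>) * Lp_norm p f"
    and "fourier_coeff (frac_diff \<gamma> h f) k = diff_symbol \<gamma> (real k * h) * fourier_coeff f k"
proof -
  let ?F = "\<lambda>n x. (- 1) ^ n * (\<gamma> gchoose n) * f (x + (\<gamma> - real n) * h)"
  have F: "?F n \<in> Lp p" for n by (rule Lp_cmult(1)[OF p Lp_shift(1)[OF p f]])
  have N: "Lp_norm p (?F n) = \<bar>\<gamma> gchoose n\<bar> * Lp_norm p f" for n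
    unfolding Lp_cmult(2)[OF p Lp_shift(1)[OF p f]] Lp_shift(2)[OF p f] by (simp add: abs_mult power_abs)
  have s: "summable (\<lambda>n. Lp_norm p (?F n))"
    unfolding N by (rule summable_mult2[OF summable_abs_gbinomial[OF \<gamma>]])
  have eq: "frac_diff \<gamma> h f = (\<lambda>x. \<Sum>n. ?F n x)" by (simp add: frac_diff_def fun_eq_iff)
  show "frac_diff \<gamma> h f \<in> Lp p" unfolding eq by (rule Lp_series(1)[OF p F s])
  show "Lp_norm p (frac_diff \<gamma> h f) \<le> (\<Sum>n. \<bar>\<gamma> gchoose n\<bar>) * Lp_norm p f"
    unfolding eq using Lp_series(2)[OF p F s] unfolding N suminf_mult2[OF summable_abs_gbinomial[OF \<gamma>]] .
  have f1: "f \<in> Lp 1" using Lp_subset_L1 p f by blast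
  have fcF: "fourier_coeff (?F n) k = of_real ((- 1) ^ n * (\<gamma> gchoose n)) * cis ((\<gamma> - real n) * (real k * h)) * fourier_coeff f k" for n
    unfolding fourier_coeff_cmult[OF Lp_shift(1)[OF insertI1 f1]] fourier_coeff_shift[OF f1] by (simp add: mult_ac)
  show "fourier_coeff (frac_diff \<gamma> h f) k = diff_symbol \<gamma> (real k * h) * fourier_coeff f k"
    using Lp_series(3)[OF p F s, of k] sums_mult2[OF diff_symbol_sums[OF \<gamma>, of "real k * h"], of "fourier_coeff f k"]
    unfolding eq fcF using sums_unique2 by blast
qed

text \<open>The modulus is a \<open>SUP\<close> of reals and is meaningful only for a bounded set;
  boundedness comes from the operator norm, uniform in h.\<close>

lemma Lp_norm_frac_diff_le_modulus:
  assumes p: "p \<in> {1, top}" and f: "f \<in> Lp p" and \<gamma>: "\<gamma> > 0" and h: "\<bar>h\<bar> \<le> \<delta>"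
  shows "Lp_norm p (frac_diff \<gamma> h f) \<le> modulus p \<gamma> f \<delta>"
  unfolding modulus_def
proof (rule cSUP_upper)
  show "bdd_above ((\<lambda>h. Lp_norm p (frac_diff \<gamma> h f)) ` {h. \<bar>h\<bar> \<le> \<delta>})"
    using frac_diff_Lp(2)[OF p f \<gamma>] by (intro bdd_aboveI2)
qed (use h in simp)

lemma modulus_le:
  assumes "\<And>h. \<bar>h\<bar> \<le> \<delta> \<Longrightarrow> Lp_norm p (frac_diff \<gamma> h f) \<le> B" "0 \<le> \<delta>"
  shows "modulus p \<gamma> f \<delta> \<le> B"
  unfolding modulus_def by (rule cSUP_least) (use assms in \<open>auto intro: exI[of _ 0]\<close>)

lemma modulus_mono:
  assumes p: "p \<in> {1, top}" and f: "f \<in> Lp p" and \<gamma>: "\<gamma> > 0" and "0 \<le> \<delta>" "\<delta> \<le> \<eta>"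
  shows "modulus p \<gamma> f \<delta> \<le> modulus p \<gamma> f \<eta>"
  by (rule modulus_le) (use assms in \<open>auto intro!: Lp_norm_frac_diff_le_modulus\<close>)

lemma modulus_nonneg:
  assumes p: "p \<in> {1, top}" and f: "f \<in> Lp p" and \<gamma>: "\<gamma> > 0" and "0 \<le> \<delta>"
  shows "0 \<le> modulus p \<gamma> f \<delta>"
  using order_trans[OF Lp_norm_nonneg[OF p frac_diff_Lp(1)[OF p f \<gamma>]] 
      Lp_norm_frac_diff_le_modulus[OF p f \<gamma>, of 0]] assms(4) by simp

subsection \<open>Uniqueness of Fourier coefficients\<close>

text \<open>Real trigonometric polynomials. The free phase c covers the sines and keeps the product
  rule to one formula.\<close>

inductive trig :: "(real \<Rightarrow> real) \<Rightarrow> bool" where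
  trig_cos: "trig (\<lambda>x. cos (real k * x + c))"
| trig_add: "trig f \<Longrightarrow> trig g \<Longrightarrow> trig (\<lambda>x. f x + g x)"
| trig_cmul: "trig f \<Longrightarrow> trig (\<lambda>x. c * f x)"

lemma trig_cos_diff: "trig (\<lambda>x. cos ((real k - real l) * x + c))"
proof (cases "l \<le> k")
  case True
  then show ?thesis using trig_cos[of "k - l" c] by (simp add: of_nat_diff)
next
  case False
  have "cos (real (l - k) * x + - c) = cos ((real k - real l) * x + c)" for x
  proof -
    have "real (l - k) * x + - c = - ((real k - real l) * x + c)"
      using False by (simp add: of_nat_diff algebra_simps)
    then show ?thesis by (metis cos_minus)
  qed
  then show ?thesis using trig_cos[of "l - k" "- c"] by simp
qed

lemma trig_mult:
  assumes "trig f" "trig g"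
  shows "trig (\<lambda>x. f x * g x)"
  using assms
proof (induction arbitrary: g rule: trig.induct)
  case (trig_cos k c)
  then show ?case
  proof (induction rule: trig.induct)
    case (trig_cos l d)
    have "cos (real k * x + c) * cos (real l * x + d) =
       (1/2) * cos ((real k - real l) * x + (c - d)) + (1/2) * cos (real (k + l) * x + (c + d))" for x
      unfolding cos_times_cos by (simp add: algebra_simps add_divide_distrib)
    then show ?case by (simp only:) (intro trig.trig_add trig.trig_cmul trig.trig_cos trig_cos_diff)
  next
    case (trig_add f g)
    then show ?case by (simp add: distrib_left trig.trig_add)
  next
    case (trig_cmul f e)
    then show ?case using trig.trig_cmul[of _ e] by (simp add: mult.left_commute)
  qed
next
  case (trig_add f g h)
  then show ?case by (simp add: distrib_right trig.trig_add)
next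
  case (trig_cmul f c g)
  then show ?case using trig.trig_cmul[of _ c] by (simp add: mult.assoc)
qed

lemma trig_const: "trig (\<lambda>x. c)"
  using trig_cmul[OF trig_cos[of 0 0], of c] by simp

lemma trig_real_polynomial_function:
  assumes "real_polynomial_function p"
  shows "trig (\<lambda>x. p (cis x))"
  using assms
proof (induction rule: real_polynomial_function.induct)
  case (linear f)
  interpret bounded_linear f by fact
  have "f (cis x) = f 1 * cos (real 1 * x + 0) + f \<i> * cos (real 1 * x + (- pi/2))" for x
  proof -
    have "cis x = cos x *\<^sub>R 1 + sin x *\<^sub>R \<i>" by (simp add: complex_eq_iff)
    then have "f (cis x) = cos x * f 1 + sin x * f \<i>" by (simp add: add scaleR)
    then show ?thesis by (simp add: cos_add cos_diff)
  qed
  then show ?case by (simp only:) (intro trig.intros)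
qed (auto intro: trig_const trig_add trig_mult)

lemma fourier_coeff_zero_trig:
  assumes f: "f \<in> Lp 1" and z: "\<And>k. fourier_coeff f k = 0" and T: "trig T"
  shows "integrable circ (\<lambda>x. f x * T x) \<and> (LINT x|circ. f x * T x) = 0"
  using T
proof (induction rule: trig.induct)
  case (trig_cos k c)
  have eq: "f x * cos (real k * x + c) = Re (cis (- c) * (f x *\<^sub>R cis (- real k * x)))" for x
    by (simp add: cos_add algebra_simps)
  have i: "integrable circ (\<lambda>x. cis (- c) * (f x *\<^sub>R cis (- real k * x)))"
    by (intro integrable_mult_right fourier_coeff_integrable f)
  have "(LINT x|circ. f x * cos (real k * x + c)) = Re (LINT x|circ. cis (- c) * (f x *\<^sub>R cis (- real k * x)))"
    unfolding eq by (rule integral_Re[OF i])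
  also have "(LINT x|circ. cis (- c) * (f x *\<^sub>R cis (- real k * x))) = cis (- c) * (pi *\<^sub>R fourier_coeff f k)"
    unfolding fourier_coeff_eq_integral[OF f] integral_mult_right_zero by simp
  finally show ?case unfolding z using integrable_Re[OF i] unfolding eq by simp
next
  case (trig_add g h)
  then show ?case by (simp add: distrib_left)
next
  case (trig_cmul g c)
  then show ?case by (simp add: mult.left_commute[of _ c])
qed

text \<open>By Stone-Weierstrass, u is uniformly approximated on the circle by polynomials, which
  restrict to trigonometric polynomials and so are orthogonal to f. The error is at most e times the
  norm of f.\<close>

lemma fourier_coeff_zero_continuous:
  assumes f: "f \<in> Lp 1" and z: "\<And>k. fourier_coeff f k = 0" 
    and u: "continuous_on (sphere 0 1) u" and m: "(\<lambda>x. u (cis x)) \<in> borel_measurable circ"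
    and ub: "\<And>x. \<bar>u (cis x)\<bar> \<le> B"
  shows "(LINT x|circ. f x * u (cis x)) = 0"
proof -
  have i: "integrable circ f" using f by (simp add: Lp_1_iff')
  have iu: "integrable circ (\<lambda>x. f x * u (cis x))"
  proof (rule Bochner_Integration.integrable_bound[of circ "\<lambda>x. B * f x"])
    have "0 \<le> B" using ub[of 0] by linarith
    have "norm (f x * u (cis x)) \<le> norm (B * f x)" for x
      using mult_left_mono[OF ub[of x] abs_ge_zero[of "f x"]] \<open>0 \<le> B\<close> by (simp add: abs_mult mult.commute)
    then show "AE x in circ. norm (f x * u (cis x)) \<le> norm (B * f x)" by simp
  qed (use i m in auto)
  have "\<bar>LINT x|circ. f x * u (cis x)\<bar> \<le> e * Lp_norm 1 f" if "e > 0" for e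
  proof -
    obtain p where p: "real_polynomial_function p" "\<And>z. z \<in> sphere 0 1 \<Longrightarrow> \<bar>u z - p z\<bar> < e"
      using Stone_Weierstrass_real_polynomial_function[OF compact_sphere u \<open>e > 0\<close>] by blast
    note T = fourier_coeff_zero_trig[OF f z trig_real_polynomial_function[OF p(1)]]
    have "\<bar>LINT x|circ. f x * u (cis x)\<bar> = \<bar>LINT x|circ. f x * u (cis x) - f x * p (cis x)\<bar>"
      using iu T by simp
    also have "\<dots> \<le> (LINT x|circ. \<bar>f x * u (cis x) - f x * p (cis x)\<bar>)"
      by (rule integral_abs_bound)
    also have "\<dots> \<le> (LINT x|circ. e * \<bar>f x\<bar>)"
    proof (rule integral_mono)
      fix x
      have "\<bar>u (cis x) - p (cis x)\<bar> \<le> e" using p(2)[of "cis x"] by simp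
      then show "\<bar>f x * u (cis x) - f x * p (cis x)\<bar> \<le> e * \<bar>f x\<bar>"
        unfolding right_diff_distrib[symmetric] abs_mult by (metis abs_ge_zero mult.commute mult_left_mono)
    qed (use iu T i in auto)
    also have "\<dots> = e * Lp_norm 1 f" by (simp add: Lp_norm_1')
    finally show ?thesis .
  qed
  note * = this
  have "(\<lambda>n. (1 / real (Suc n)) * Lp_norm 1 f) \<longlonglongrightarrow> 0 * Lp_norm 1 f"
    by (intro tendsto_intros LIMSEQ_Suc lim_1_over_n)
  then have "\<bar>LINT x|circ. f x * u (cis x)\<bar> \<le> 0 * Lp_norm 1 f"
  proof (rule tendsto_lowerbound)
    show "\<forall>\<^sub>F n in sequentially. \<bar>LINT x|circ. f x * u (cis x)\<bar> \<le> (1 / real (Suc n)) * Lp_norm 1 f"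
      by (intro always_eventually allI *) simp
  qed simp
  then show ?thesis by simp
qed

text \<open>The continuous functions that approximate \<open>sgn \<circ> f\<close> almost everywhere are not periodic; they
  are damped near \<open>1\<close> to become continuous on the unit circle.\<close>

lemma fourier_coeff_zero_imp_norm_zero:
  assumes f: "f \<in> Lp 1" and z: "\<And>k. fourier_coeff f k = 0"
  shows "Lp_norm 1 f = 0"
proof -
  have i: "integrable circ f" and m: "f \<in> borel_measurable circ" using f by (auto simp: Lp_1_iff')
  have "(\<lambda>x. sgn (f x)) \<in> borel_measurable circ" using m by measurable
  then have "(\<lambda>x. sgn (f x)) measurable_on {0..2*pi}" by (subst measurable_on_iff_borel_measurable) auto
  then obtain N g where N: "negligible N" and g: "\<And>n. continuous_on UNIV (g n)"
    and lim: "\<And>x. x \<notin> N \<Longrightarrow> (\<lambda>n. g n x) \<longlonglongrightarrow> (if x \<in> {0..2*pi} then sgn (f x) else 0)"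
    unfolding measurable_on_def by blast
  \<comment> \<open>Clamping to [-1, 1] does not disturb limits equal to a sign, and it makes |f| a
    dominating function.\<close>
  define w where "w n x = max (-1) (min 1 (g n x))" for n :: nat and x
  define u where "u n z = w n (Arg2pi z) * min 1 (real n * norm (z - 1))" for n and z :: complex
  have wb: "\<bar>w n x\<bar> \<le> 1" for n x by (auto simp: w_def)
  have wc: "continuous_on UNIV (w n)" for n unfolding w_def by (intro continuous_intros g)
  have ub1: "\<bar>u n z\<bar> \<le> real n * norm (z - 1)" for n z
  proof -
    have "\<bar>u n z\<bar> \<le> 1 * \<bar>min 1 (real n * norm (z - 1))\<bar>"
      unfolding u_def abs_mult by (rule mult_right_mono) (use wb in auto)
    also have "\<dots> \<le> real n * norm (z - 1)" by simp
    finally show ?thesis .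
  qed
  have ub: "\<bar>u n z\<bar> \<le> 1" for n z
  proof -
    have "\<bar>u n z\<bar> \<le> 1 * 1"
      unfolding u_def abs_mult by (rule mult_mono[OF wb]) auto
    then show ?thesis by simp
  qed
  have uc: "continuous_on (sphere 0 1) (u n)" for n
    unfolding continuous_on_eq_continuous_within
  proof
    fix z :: complex assume z: "z \<in> sphere 0 1"
    show "continuous (at z within sphere 0 1) (u n)"
    proof (cases "z = 1")
      case True
      have "((\<lambda>y. real n * norm (y - 1)) \<longlongrightarrow> real n * norm (z - 1)) (at z within sphere 0 1)"
        by (intro tendsto_intros)
      then have lim0: "((\<lambda>y. real n * norm (y - 1)) \<longlongrightarrow> 0) (at z within sphere 0 1)"
        using True by simp
      have "(u n \<longlongrightarrow> 0) (at z within sphere 0 1)"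
        by (rule Lim_null_comparison[OF always_eventually lim0]) (simp add: ub1)
      moreover have "u n z = 0" using True by (simp add: u_def)
      ultimately show ?thesis by (simp add: continuous_within)
    next
      case False
      have "z \<notin> \<real>\<^sub>\<ge>\<^sub>0"
      proof
        assume "z \<in> \<real>\<^sub>\<ge>\<^sub>0"
        then obtain x where "z = of_real x" "x \<ge> 0" by (auto simp: nonneg_Reals_def)
        with z False show False by simp
      qed
      then have "isCont Arg2pi z" by (rule continuous_at_Arg2pi)
      moreover have "isCont (w n) (Arg2pi z)" using wc[of n] by (simp add: continuous_on_eq_continuous_at)
      ultimately have "isCont (\<lambda>z. w n (Arg2pi z)) z" using isCont_o2 by blast
      then have "isCont (u n) z" unfolding u_def by (intro continuous_intros)
      then show ?thesis by (rule continuous_at_imp_continuous_at_within)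
    qed
  qed
  have ucis: "continuous_on UNIV (\<lambda>x. u n (cis x))" for n
    by (rule continuous_on_compose2[OF uc]) (auto intro!: continuous_intros)
  have um: "(\<lambda>x. u n (cis x)) \<in> borel_measurable circ" for n
    by (rule measurable_circ[OF continuous_measurable_lebesgue[OF ucis]])
  have zero: "(LINT x|circ. f x * u n (cis x)) = 0" for n
    by (rule fourier_coeff_zero_continuous[OF f z uc um ub])
  have lim': "(\<lambda>n. f x * u n (cis x)) \<longlonglongrightarrow> \<bar>f x\<bar>" if x: "x \<in> {0<..<2*pi}" "x \<notin> N" for x
  proof -
    have arg: "Arg2pi (cis x) = x" using x by (intro Arg2pi_unique[of 1]) (auto simp: cis_conv_exp)
    have "cis x \<noteq> 1" 
    proof
      assume "cis x = 1"
      then have "Arg2pi (cis x) = Arg2pi 1" by simp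
      moreover have "Arg2pi 1 = 0" using Arg2pi_of_real[of 1] by simp
      ultimately show False using arg x by simp
    qed
    then have "norm (cis x - 1) > 0" by simp
    \<comment> \<open>Away from 1 the damping factor is eventually equal to 1, so the pointwise
      limit is unaffected.\<close>
    then have "eventually (\<lambda>n. real n * norm (cis x - 1) \<ge> 1) sequentially" by real_asymp
    then have ev: "eventually (\<lambda>n. u n (cis x) = max (-1) (min 1 (g n x))) sequentially"
      by eventually_elim (simp add: u_def w_def arg)
    have "(\<lambda>n. g n x) \<longlonglongrightarrow> sgn (f x)" using lim[of x] x by simp
    then have "(\<lambda>n. max (-1) (min 1 (g n x))) \<longlonglongrightarrow> max (-1) (min 1 (sgn (f x)))"
      by (intro tendsto_intros)
    also have "max (-1) (min 1 (sgn (f x))) = sgn (f x)" by (simp add: sgn_if)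
    finally have "(\<lambda>n. u n (cis x)) \<longlonglongrightarrow> sgn (f x)" using tendsto_cong[OF ev] by simp
    then have "(\<lambda>n. f x * u n (cis x)) \<longlonglongrightarrow> f x * sgn (f x)" by (intro tendsto_intros)
    then show ?thesis by (simp add: abs_sgn)
  qed
  have ae: "AE x in circ. x \<in> {0<..<2*pi} \<and> x \<notin> N"
  proof -
    have "N \<union> {0, 2*pi} \<in> null_sets lebesgue" using N by (auto simp flip: negligible_iff_null_sets)
    then have "AE x in lebesgue. x \<notin> N \<union> {0, 2*pi}" by (rule AE_not_in)
    then have "AE x in lebesgue. x \<in> {0..2*pi} \<longrightarrow> x \<in> {0<..<2*pi} \<and> x \<notin> N" 
      by eventually_elim (use less_eq_real_def in auto)
    then show ?thesis by (subst AE_restrict_space_iff) auto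
  qed
  have "(\<lambda>n. LINT x|circ. f x * u n (cis x)) \<longlonglongrightarrow> (LINT x|circ. \<bar>f x\<bar>)"
  proof (rule integral_dominated_convergence[where w="\<lambda>x. \<bar>f x\<bar>"])
    show "AE x in circ. (\<lambda>n. f x * u n (cis x)) \<longlonglongrightarrow> \<bar>f x\<bar>"
      using ae by eventually_elim (use lim' in auto)
    show "AE x in circ. norm (f x * u n (cis x)) \<le> \<bar>f x\<bar>" for n
      using ub by (auto simp: abs_mult mult_left_le)
  qed (use i m um in auto)
  then show ?thesis unfolding zero Lp_norm_1' using LIMSEQ_unique tendsto_const by blast
qed

text \<open>Equality of norms is the common form of uniqueness for both spaces: for p = 1 the
  functions agree only almost everywhere, while for p = \<infinity> a continuous |f - g| with
  integral 0 vanishes identically.\<close>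

lemma fourier_coeff_eq_imp_Lp_norm_eq:
  assumes p: "p \<in> {1, top}" and f: "f \<in> Lp p" and g: "g \<in> Lp p" and eq: "\<And>k. fourier_coeff f k = fourier_coeff g k"
  shows "Lp_norm p f = Lp_norm p g"
proof -
  have f1: "f \<in> Lp 1" and g1: "g \<in> Lp 1" using f g p Lp_subset_L1 by blast+
  let ?d = "\<lambda>x. f x - g x"
  have d1: "?d \<in> Lp 1" using f1 g1 by (auto simp: Lp_1_iff')
  have "fourier_coeff ?d k = fourier_coeff f k - fourier_coeff g k" for k
    unfolding fourier_coeff_eq_integral[OF d1] fourier_coeff_eq_integral[OF f1] fourier_coeff_eq_integral[OF g1] scaleR_diff_left scaleR_diff_right
      Bochner_Integration.integral_diff[OF fourier_coeff_integrable[OF f1] fourier_coeff_integrable[OF g1]] ..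
  then have n: "Lp_norm 1 ?d = 0" using eq by (intro fourier_coeff_zero_imp_norm_zero d1) simp
  show ?thesis
  proof (cases "p = 1")
    case True
    have i: "integrable circ ?d" using d1 by (simp add: Lp_1_iff')
    then have "AE x in circ. \<bar>?d x\<bar> = 0"
      using n unfolding Lp_norm_1' by (subst (asm) integral_nonneg_eq_0_iff_AE) auto
    then have "AE x in circ. \<bar>f x\<bar> = \<bar>g x\<bar>" by eventually_elim auto
    then show ?thesis unfolding True Lp_norm_1' using f1 g1
      by (intro integral_cong_AE) (auto simp: Lp_1_iff')
  next
    case False
    with p have [simp]: "p = top" by auto
    have c: "continuous_on {0..2*pi} (\<lambda>x. \<bar>?d x\<bar>)"
      using f g by (auto simp: Lp_inf_iff intro!: continuous_intros intro: continuous_on_subset)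
    have "integral {0..2*pi} (\<lambda>x. \<bar>?d x\<bar>) = 0"
      using n unfolding Lp_norm_1'
      by (subst (asm) lebesgue_integral_eq_integral) (use d1 in \<open>auto simp: Lp_1_iff'\<close>)
    then have "\<forall>x\<in>{0..2*pi}. \<bar>?d x\<bar> = 0"
      by (subst (asm) integral_eq_0_iff[OF c]) auto
    then show ?thesis by (simp add: Lp_norm_inf)
  qed
qed

subsection \<open>Fourier multipliers with smooth coefficients\<close>

text \<open>x - x^3/6 >= x/2 as long as x^2 <= 3. The number 8/5 is a convenient rational with
  square below 3 that exceeds \<pi>/2.\<close>

lemma sin_ge_half:
  fixes x :: real
  assumes "0 \<le> x" "x \<le> 8/5"
  shows "x / 2 \<le> sin x"
proof -
  have "\<bar>sin x - (\<Sum>m<3. sin_coeff m * x ^ m)\<bar> \<le> inverse (fact 3) * \<bar>x\<bar> ^ 3"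
    by (rule Maclaurin_sin_bound)
  then have "\<bar>sin x - x\<bar> \<le> x ^ 3 / 6"
    using assms by (simp add: sin_coeff_def numeral_3_eq_3 fact_numeral lessThan_Suc)
  then have "x - x ^ 3 / 6 \<le> sin x" by linarith
  moreover have "x ^ 3 \<le> x * 3"
  proof -
    have "x * x \<le> (8/5) * (8/5)" using assms by (intro mult_mono) auto
    then have "x * (x * x) \<le> x * 3" using assms by (intro mult_left_mono) auto
    then show ?thesis by (simp add: power3_eq_cube mult.assoc)
  qed
  ultimately show ?thesis by linarith
qed

lemma one_minus_cos_ge:
  fixes y :: real
  assumes "\<bar>y\<bar> \<le> pi"
  shows "y\<^sup>2 / 4 \<le> 2 - 2 * cos y"
proof -
  have "\<bar>y\<bar>/2/2 \<le> sin (\<bar>y\<bar>/2)"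
    using assms pi_less_4 pi_approx by (intro sin_ge_half) auto
  then have "(\<bar>y\<bar>/2/2)\<^sup>2 \<le> (sin (\<bar>y\<bar>/2))\<^sup>2" by (intro power_mono) auto
  moreover have "2 - 2 * cos y = 4 * (sin (\<bar>y\<bar>/2))\<^sup>2"
    using cos_double_sin[of "\<bar>y\<bar>/2"] by simp
  ultimately show ?thesis by (simp add: power2_eq_square)
qed

text \<open>\<open>Suc k\<close> skips the constant term. The phase c puts the even kernel, the
  conjugate kernel and all their mixtures under one estimate.\<close>

definition ker :: "(nat \<Rightarrow> real) \<Rightarrow> nat \<Rightarrow> real \<Rightarrow> real \<Rightarrow> real" where
  "ker a n c x = (\<Sum>k<n. a (Suc k) * cos (real (Suc k) * x + c))"

text \<open>Summation by parts. Applied to a cut-off smooth function sampled at step \<open>1 / N\<close>, it gives the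
  decay that makes the \<open>L\<^sub>1\<close> norm of the kernel independent of \<open>N\<close>.\<close>

lemma ker_second_difference:
  "(2 - 2 * cos x) * ker a n c x =
     (\<Sum>k<n. (2 * a (Suc k) - a k - a (k + 2)) * cos (real (Suc k) * x + c))
     + (a (Suc n) * cos (real n * x + c) - a n * cos (real (Suc n) * x + c))
     - (a 1 * cos c - a 0 * cos (x + c))"
proof (induction n)
  case 0 then show ?case by (simp add: ker_def)
next
  case (Suc n)
  have "2 * cos x * cos (real (Suc n) * x + c) = cos (real (Suc (Suc n)) * x + c) + cos (real n * x + c)"
  proof -
    have "real (Suc (Suc n)) * x + c = (real (Suc n) * x + c) + x" "real n * x + c = (real (Suc n) * x + c) - x"
      by (simp_all add: algebra_simps)
    then show ?thesis by (simp only: cos_add cos_diff) simp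
  qed
  then have "(2 - 2 * cos x) * (a (Suc n) * cos (real (Suc n) * x + c)) =
      a (Suc n) * (2 * cos (real (Suc n) * x + c) - cos (real (Suc (Suc n)) * x + c) - cos (real n * x + c))"
    by (simp add: algebra_simps del: of_nat_Suc)
  moreover have "ker a (Suc n) c x = ker a n c x + a (Suc n) * cos (real (Suc n) * x + c)"
    by (simp add: ker_def)
  ultimately show ?case using Suc by (simp add: algebra_simps del: of_nat_Suc)
qed

text \<open>What a twice differentiable bump on [1/2, 2], sampled at k / N, satisfies: second
  differences at step 1 / N have size 1 / N^2. The bound on \<open>a 1\<close> controls the boundary
  term of the summation by parts.\<close>

definition seq_bound :: "real \<Rightarrow> nat \<Rightarrow> (nat \<Rightarrow> real) \<Rightarrow> bool" where
  "seq_bound A N a \<longleftrightarrow> N \<ge> 1 \<and> a 0 = 0 \<and> (\<forall>k\<ge>2*N. a k = 0) \<and> (\<forall>k. \<bar>a k\<bar> \<le> A) \<and>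
     \<bar>a 1\<bar> \<le> A / (real N)\<^sup>2 \<and> (\<forall>k. \<bar>2 * a (Suc k) - a k - a (k + 2)\<bar> \<le> A / (real N)\<^sup>2)"

text \<open>The constant 5 is 2 + 3: the 2N terms give |ker| <= 2NA, and summation by parts gives
  N^2 (2 - 2 cos x) |ker| <= (2N + 1) A <= 3NA.\<close>

definition ker_bound :: "real \<Rightarrow> nat \<Rightarrow> real \<Rightarrow> real" where
  "ker_bound A N x = 5 * real N * A / (1 + (real N)\<^sup>2 * (2 - 2 * cos x))"

lemma ker_bound_denom: "1 \<le> 1 + (real N)\<^sup>2 * (2 - 2 * cos x)"
  using cos_le_one[of x] by simp

lemma ker_le_ker_bound:
  assumes "seq_bound A N a"
  shows "\<bar>ker a (2 * N) c x\<bar> \<le> ker_bound A N x"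
proof -
  have N: "real N \<ge> 1" and a0: "a 0 = 0" and az: "\<And>k. k \<ge> 2*N \<Longrightarrow> a k = 0" and aA: "\<And>k. \<bar>a k\<bar> \<le> A"
    and a1: "\<bar>a 1\<bar> \<le> A / (real N)\<^sup>2" and a2: "\<And>k. \<bar>2 * a (Suc k) - a k - a (k + 2)\<bar> \<le> A / (real N)\<^sup>2"
    using assms by (auto simp: seq_bound_def)
  have A: "0 \<le> A" using aA[of 0] by linarith
  have cs: "\<bar>u * cos v\<bar> \<le> w" if "\<bar>u\<bar> \<le> w" for u v w :: real
  proof -
    have "\<bar>u * cos v\<bar> \<le> \<bar>u\<bar> * 1" unfolding abs_mult by (intro mult_left_mono) auto
    with that show ?thesis by linarith
  qed
  have K1: "\<bar>ker a (2 * N) c x\<bar> \<le> real (2 * N) * A"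
  proof -
    have "\<bar>ker a (2 * N) c x\<bar> \<le> (\<Sum>k<2*N. A)"
      unfolding ker_def by (rule order_trans[OF sum_abs sum_mono]) (intro cs aA)
    then show ?thesis by simp
  qed
  have "(2 - 2 * cos x) * ker a (2 * N) c x =
     (\<Sum>k<2*N. (2 * a (Suc k) - a k - a (k + 2)) * cos (real (Suc k) * x + c)) - a 1 * cos c"
    unfolding ker_second_difference using a0 az by simp
  then have "\<bar>(2 - 2 * cos x) * ker a (2 * N) c x\<bar> \<le> 
     \<bar>\<Sum>k<2*N. (2 * a (Suc k) - a k - a (k + 2)) * cos (real (Suc k) * x + c)\<bar> + \<bar>a 1 * cos c\<bar>"
    by linarith
  also have "\<dots> \<le> (\<Sum>k<2*N. A / (real N)\<^sup>2) + A / (real N)\<^sup>2"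
    by (intro add_mono order_trans[OF sum_abs sum_mono] cs a1 a2)
  also have "\<dots> = (real (2 * N) + 1) * (A / (real N)\<^sup>2)" by (simp add: distrib_right add_divide_distrib)
  also have "\<bar>(2 - 2 * cos x) * ker a (2 * N) c x\<bar> = (2 - 2 * cos x) * \<bar>ker a (2 * N) c x\<bar>"
    using cos_le_one[of x] by (simp only: abs_mult abs_of_nonneg[of "2 - 2 * cos x"])
  finally have "(2 - 2 * cos x) * \<bar>ker a (2 * N) c x\<bar> \<le> (real (2 * N) + 1) * (A / (real N)\<^sup>2)" .
  then have "(real N)\<^sup>2 * ((2 - 2 * cos x) * \<bar>ker a (2 * N) c x\<bar>) \<le> (real N)\<^sup>2 * ((real (2 * N) + 1) * (A / (real N)\<^sup>2))"
    by (intro mult_left_mono) auto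
  also have "\<dots> = (real (2 * N) + 1) * A" using N by simp
  also have "\<dots> \<le> 3 * real N * A" using N A by (intro mult_right_mono) auto
  finally have "\<bar>ker a (2 * N) c x\<bar> * (1 + (real N)\<^sup>2 * (2 - 2 * cos x)) \<le> 5 * real N * A"
    using K1 by (simp add: algebra_simps)
  then show ?thesis unfolding ker_bound_def
    by (subst pos_le_divide_eq[OF less_le_trans[OF zero_less_one ker_bound_denom]])
qed

lemma ker_bound_nonneg: "0 \<le> A \<Longrightarrow> 0 \<le> ker_bound A N x"
  unfolding ker_bound_def using ker_bound_denom[of N x] by (intro divide_nonneg_nonneg) auto

lemma ker_bound_continuous: "continuous_on S (ker_bound A N)"
proof -
  have "1 + (real N)\<^sup>2 * (2 - 2 * cos x) \<noteq> 0" for x using ker_bound_denom[of N x] by linarith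
  then show ?thesis unfolding ker_bound_def by (intro continuous_intros) auto
qed

lemma ker_bound_periodic: "ker_bound A N (x + 2*pi) = ker_bound A N x"
  by (simp add: ker_bound_def)

lemma ker_bound_even: "ker_bound A N (x - y) = ker_bound A N (y - x)"
  using cos_minus[of "x - y"] by (simp add: ker_bound_def)

lemma ker_bound_shift_integral:
  "integrable circ (\<lambda>x. ker_bound A N (x - y))"
  "(LINT x|circ. ker_bound A N (x - y)) = (LINT x|circ. ker_bound A N x)"
  using circ_shift[of "ker_bound A N" "- y", OF ker_bound_periodic continuous_circ_integrable[OF ker_bound_continuous]]
  by auto

text \<open>Shifting by \<pi> puts the peak in the middle of the period, where y = x - \<pi>
  satisfies 2 - 2 cos y >= y^2/4. The majorant 5NA / (1 + (Ny/2)^2) has the antiderivative 10 A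
  arctan (Ny/2), so its integral stays below 10 \<pi> A for every N.\<close>

lemma ker_bound_integral:
  assumes N: "N \<ge> 1" and A: "0 \<le> A"
  shows "(LINT x|circ. ker_bound A N x) \<le> 10 * pi * A"
proof -
  define u where "u x = 5 * real N * A / (1 + (real N * (x - pi) / 2)\<^sup>2)" for x
  have N0: "real N > 0" using N by simp
  have d0: "1 + (real N * (x - pi) / 2)\<^sup>2 > 0" for x by (simp add: add_pos_nonneg)
  have "((\<lambda>x. 10 * A * arctan (real N * (x - pi) / 2)) has_real_derivative u x) (at x within {0..2*pi})" for x
    unfolding u_def using d0[of x] by (auto intro!: derivative_eq_intros simp: field_simps)
  then have "(u has_integral (10 * A * arctan (real N * (2*pi - pi) / 2) - 10 * A * arctan (real N * (0 - pi) / 2))) {0..2*pi}"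
    by (intro fundamental_theorem_of_calculus) (auto simp: has_real_derivative_iff_has_vector_derivative)
  then have I: "integral {0..2*pi} u = 10 * A * arctan (real N * pi / 2) + 10 * A * arctan (real N * pi / 2)"
    by (simp add: integral_unique arctan_minus)
  have "1 + (real N * (x - pi) / 2)\<^sup>2 \<noteq> 0" for x using d0[of x] by linarith
  then have uc: "continuous_on UNIV u" unfolding u_def by (intro continuous_intros) auto
  have "(LINT x|circ. ker_bound A N x) = (LINT x|circ. ker_bound A N (x - pi))"
    by (rule ker_bound_shift_integral(2)[symmetric])
  also have "\<dots> \<le> (LINT x|circ. u x)"
  proof (rule integral_mono[OF ker_bound_shift_integral(1) continuous_circ_integrable[OF uc]])
    fix x assume "x \<in> space circ"
    then have "\<bar>x - pi\<bar> \<le> pi" by (auto simp: space_restrict_space)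
    from one_minus_cos_ge[OF this]
    have "(real N * (x - pi) / 2)\<^sup>2 \<le> (real N)\<^sup>2 * (2 - 2 * cos (x - pi))"
      using mult_left_mono[of "(x - pi)\<^sup>2 / 4" "2 - 2 * cos (x - pi)" "(real N)\<^sup>2"]
      by (simp add: power_mult_distrib power_divide)
    then show "ker_bound A N (x - pi) \<le> u x"
      unfolding ker_bound_def u_def using A d0[of x] by (intro divide_left_mono mult_pos_pos) auto
  qed
  also have "\<dots> = integral {0..2*pi} u"
    by (rule lebesgue_integral_eq_integral[OF continuous_circ_integrable[OF uc]]) auto
  also have "\<dots> = 20 * A * arctan (real N * pi / 2)" unfolding I by simp
  also have "\<dots> \<le> 20 * A * (pi/2)" using A arctan_ubound less_imp_le by (intro mult_left_mono) auto
  finally show ?thesis by (simp add: mult_ac)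
qed

section \<open>Multiplier operators as convolutions with bounded kernels\<close>

text \<open>As \<open>fourier_coeff\<close> is twice the complex coefficient, the real part is
  exactly the k-th real harmonic, here with its phase advanced by c.\<close>

definition fourier_mult :: "(nat \<Rightarrow> real) \<Rightarrow> nat \<Rightarrow> real \<Rightarrow> (real \<Rightarrow> real) \<Rightarrow> real \<Rightarrow> real" where
  "fourier_mult a n c f x = (\<Sum>k<n. a (Suc k) * Re (cis (real (Suc k) * x + c) * fourier_coeff f (Suc k)))"

lemma fourier_mult_eq_convolution:
  assumes f: "f \<in> Lp 1"
  shows "integrable circ (\<lambda>t. f t * ker a n c (x - t))"
    and "fourier_mult a n c f x = (LINT t|circ. f t * ker a n c (x - t)) / pi"
proof -
  define h where "h k t = a (Suc k) *\<^sub>R (cis (real (Suc k) * x + c) * (f t *\<^sub>R cis (- real (Suc k) * t)))" for k t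
  have hi: "integrable circ (h k)" for k
    unfolding h_def by (intro integrable_scaleR_right integrable_mult_right fourier_coeff_integrable f)
  have hI: "(LINT t|circ. h k t) = a (Suc k) *\<^sub>R (cis (real (Suc k) * x + c) * (pi *\<^sub>R fourier_coeff f (Suc k)))" for k
    unfolding h_def integral_scaleR_right integral_mult_right_zero fourier_coeff_eq_integral[OF f] by simp
  have eq: "f t * ker a n c (x - t) = (\<Sum>k<n. Re (h k t))" for t
  proof -
    have "Re (h k t) = f t * (a (Suc k) * cos (real (Suc k) * (x - t) + c))" for k
    proof -
      have "real (Suc k) * (x - t) + c = (real (Suc k) * x + c) - real (Suc k) * t" by (simp add: algebra_simps)
      then show ?thesis by (simp only: cos_diff) (simp add: h_def algebra_simps del: of_nat_Suc)
    qed
    then show ?thesis by (simp add: ker_def sum_distrib_left)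
  qed
  show "integrable circ (\<lambda>t. f t * ker a n c (x - t))"
    unfolding eq by (intro Bochner_Integration.integrable_sum integrable_Re hi)
  have "(LINT t|circ. f t * ker a n c (x - t)) = (\<Sum>k<n. Re (LINT t|circ. h k t))"
    unfolding eq by (subst Bochner_Integration.integral_sum) (auto intro!: integrable_Re hi simp: integral_Re[OF hi])
  also have "\<dots> = pi * fourier_mult a n c f x"
    unfolding hI fourier_mult_def by (simp add: sum_distrib_left algebra_simps del: of_nat_Suc)
  finally show "fourier_mult a n c f x = (LINT t|circ. f t * ker a n c (x - t)) / pi" by simp
qed

lemma fourier_mult_Lp:
  assumes "p \<in> {1, top}"
  shows "fourier_mult a n c f \<in> Lp p"
proof -
  have "fourier_mult a n c f (x + 2*pi) = fourier_mult a n c f x" for x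
  proof -
    have "cis (real (Suc k) * (x + 2*pi) + c) = cis (real (Suc k) * x + c)" for k
    proof -
      have "cis (real (Suc k) * (x + 2*pi) + c) = cis (real (Suc k) * x + c) * cis (2 * pi * real (Suc k))"
        unfolding cis_mult by (simp add: algebra_simps)
      also have "cis (2 * pi * real (Suc k)) = 1" by (rule cis_multiple_2pi) (rule Ints_of_nat)
      finally show ?thesis by simp
    qed
    then show ?thesis by (simp add: fourier_mult_def del: of_nat_Suc)
  qed
  moreover have "continuous_on UNIV (fourier_mult a n c f)"
    unfolding fourier_mult_def by (intro continuous_intros)
  ultimately have "fourier_mult a n c f \<in> Lp top" by (simp add: Lp_inf_iff)
  then show ?thesis using assms Lp_subset_L1[of top] by auto
qed

text \<open>Young's inequality with the majorant \<open>ker_bound\<close> in place of the kernel.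
  Working with nonnegative integrals lets the order of integration be exchanged from measurability
  alone; the translated majorant always has the same integral.\<close>

lemma fourier_mult_norm_L1:
  assumes f: "f \<in> Lp 1" and s: "seq_bound A N a"
  shows "Lp_norm 1 (fourier_mult a (2*N) c f) \<le> 10 * A * Lp_norm 1 f"
proof -
  have i: "integrable circ f" using f by (simp add: Lp_1_iff')
  have A: "0 \<le> A" and N: "N \<ge> 1" using s unfolding seq_bound_def by (auto intro: order_trans[OF abs_ge_zero])
  interpret C: finite_measure circ by (rule finite_measure_circ)
  interpret pair_sigma_finite circ circ by unfold_locales
  have wi: "integrable circ (\<lambda>t. \<bar>f t\<bar> * ker_bound A N (x - t))" for x
  proof -
    have "integrable circ (\<lambda>t. \<bar>f t\<bar> *\<^sub>R ker_bound A N (x - t))"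
    proof (rule integrable_circ_mult_bounded[where B="5 * real N * A"])
      show "continuous_on UNIV (\<lambda>t. ker_bound A N (x - t))"
        by (rule continuous_on_compose2[OF ker_bound_continuous[of UNIV]]) (auto intro!: continuous_intros)
      show "norm (ker_bound A N (x - t)) \<le> 5 * real N * A" for t
        using ker_bound_nonneg[OF A, of N "x - t"] ker_bound_denom[of N "x - t"] A
          divide_left_mono[OF ker_bound_denom[of N "x - t"], of "5 * real N * A"]
          less_le_trans[OF zero_less_one ker_bound_denom[of N "x - t"]]
        by (simp add: ker_bound_def)
    qed (use i in simp)
    then show ?thesis by simp
  qed
  have pt: "\<bar>fourier_mult a (2*N) c f x\<bar> \<le> (LINT t|circ. \<bar>f t\<bar> * ker_bound A N (x - t)) / pi" for x
  proof -
    have "\<bar>LINT t|circ. f t * ker a (2*N) c (x - t)\<bar> \<le> (LINT t|circ. \<bar>f t * ker a (2*N) c (x - t)\<bar>)"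
      by (rule integral_abs_bound)
    also have "\<dots> \<le> (LINT t|circ. \<bar>f t\<bar> * ker_bound A N (x - t))"
    proof (rule integral_mono[OF integrable_abs[OF fourier_mult_eq_convolution(1)[OF f]] wi])
      show "\<bar>f t * ker a (2*N) c (x - t)\<bar> \<le> \<bar>f t\<bar> * ker_bound A N (x - t)" for t
        unfolding abs_mult by (intro mult_left_mono ker_le_ker_bound[OF s]) auto
    qed
    finally show ?thesis
      unfolding fourier_mult_eq_convolution(2)[OF f] by (simp add: divide_right_mono)
  qed
  have meas: "(\<lambda>(x, t). ennreal (\<bar>f t\<bar> * ker_bound A N (x - t))) \<in> borel_measurable (circ \<Otimes>\<^sub>M circ)"
  proof -
    have id: "(\<lambda>x. x) \<in> borel_measurable circ"
      by (rule measurable_circ[OF continuous_measurable_lebesgue]) (rule continuous_on_id)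
    have 1: "fst \<in> borel_measurable (circ \<Otimes>\<^sub>M circ)" "snd \<in> borel_measurable (circ \<Otimes>\<^sub>M circ)"
      by (rule measurable_compose[OF measurable_fst id], rule measurable_compose[OF measurable_snd id])
    have 2: "(\<lambda>z. f (snd z)) \<in> borel_measurable (circ \<Otimes>\<^sub>M circ)"
      by (rule measurable_compose[OF measurable_snd borel_measurable_integrable[OF i]])
    have 3: "(\<lambda>z. ker_bound A N (fst z - snd z)) \<in> borel_measurable (circ \<Otimes>\<^sub>M circ)"
      by (rule measurable_compose[OF borel_measurable_diff[OF 1]])
         (rule borel_measurable_continuous_onI[OF ker_bound_continuous])
    show ?thesis unfolding case_prod_beta
      by (intro measurable_compose[OF _ measurable_ennreal] borel_measurable_times borel_measurable_abs 2 3)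
  qed
  have "ennreal (pi * Lp_norm 1 (fourier_mult a (2*N) c f)) = ennreal pi * (\<integral>\<^sup>+x. ennreal \<bar>fourier_mult a (2*N) c f x\<bar> \<partial>circ)"
  proof -
    have "(\<integral>\<^sup>+x. ennreal \<bar>fourier_mult a (2*N) c f x\<bar> \<partial>circ) = ennreal (Lp_norm 1 (fourier_mult a (2*N) c f))"
      unfolding Lp_norm_1' using fourier_mult_Lp[of 1] by (intro nn_integral_eq_integral) (auto simp: Lp_1_iff')
    then show ?thesis by (simp add: ennreal_mult' )
  qed
  also have "\<dots> = (\<integral>\<^sup>+x. ennreal (pi * \<bar>fourier_mult a (2*N) c f x\<bar>) \<partial>circ)"
    using fourier_mult_Lp[of 1 a "2*N" c f]
    by (subst nn_integral_cmult[symmetric]) (auto simp: ennreal_mult' Lp_1_iff')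
  also have "\<dots> \<le> (\<integral>\<^sup>+x. \<integral>\<^sup>+t. ennreal (\<bar>f t\<bar> * ker_bound A N (x - t)) \<partial>circ \<partial>circ)"
  proof (rule nn_integral_mono)
    fix x
    have "ennreal (pi * \<bar>fourier_mult a (2*N) c f x\<bar>) \<le> ennreal (LINT t|circ. \<bar>f t\<bar> * ker_bound A N (x - t))"
      using pt[of x] by (intro ennreal_leI) (simp add: field_simps)
    also have "\<dots> = (\<integral>\<^sup>+t. ennreal (\<bar>f t\<bar> * ker_bound A N (x - t)) \<partial>circ)"
      by (intro nn_integral_eq_integral[symmetric] wi) (auto simp: ker_bound_nonneg[OF A])
    finally show "ennreal (pi * \<bar>fourier_mult a (2*N) c f x\<bar>) \<le> \<dots>" .
  qed
  also have "\<dots> = (\<integral>\<^sup>+t. \<integral>\<^sup>+x. ennreal (\<bar>f t\<bar> * ker_bound A N (x - t)) \<partial>circ \<partial>circ)"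
    by (rule Fubini'[OF meas, symmetric])
  also have "\<dots> = (\<integral>\<^sup>+t. ennreal ((LINT x|circ. ker_bound A N x) * \<bar>f t\<bar>) \<partial>circ)"
  proof (rule nn_integral_cong)
    fix t
    have "(\<integral>\<^sup>+x. ennreal (\<bar>f t\<bar> * ker_bound A N (x - t)) \<partial>circ) = ennreal (LINT x|circ. \<bar>f t\<bar> * ker_bound A N (x - t))"
      using ker_bound_shift_integral(1)
      by (intro nn_integral_eq_integral) (auto simp: ker_bound_nonneg[OF A])
    then show "(\<integral>\<^sup>+x. ennreal (\<bar>f t\<bar> * ker_bound A N (x - t)) \<partial>circ) = ennreal ((LINT x|circ. ker_bound A N x) * \<bar>f t\<bar>)"
      unfolding integral_mult_right_zero ker_bound_shift_integral(2) by (simp only: mult.commute)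
  qed
  also have "\<dots> = ennreal ((LINT x|circ. ker_bound A N x) * Lp_norm 1 f)"
  proof -
    have "0 \<le> (LINT x|circ. ker_bound A N x)"
      by (rule integral_nonneg_AE) (simp add: ker_bound_nonneg[OF A])
    then show ?thesis using i unfolding Lp_norm_1'
      by (subst nn_integral_eq_integral) auto
  qed
  also have "\<dots> \<le> ennreal (10 * pi * A * Lp_norm 1 f)"
    using ker_bound_integral[OF N A] by (intro ennreal_leI mult_right_mono Lp_norm_nonneg) (auto simp: f)
  finally have "pi * Lp_norm 1 (fourier_mult a (2*N) c f) \<le> 10 * pi * A * Lp_norm 1 f"
    using A Lp_norm_nonneg[of 1, OF _ f] by (subst (asm) ennreal_le_iff) auto
  then show ?thesis by simp
qed

lemma fourier_mult_norm_inf: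
  assumes f: "f \<in> Lp top" and s: "seq_bound A N a"
  shows "Lp_norm top (fourier_mult a (2*N) c f) \<le> 10 * A * Lp_norm top f"
proof (rule Lp_norm_inf_le)
  fix x
  have f1: "f \<in> Lp 1" using f Lp_subset_L1 by blast
  have A: "0 \<le> A" and N: "N \<ge> 1" using s unfolding seq_bound_def by (auto intro: order_trans[OF abs_ge_zero])
  have F: "0 \<le> Lp_norm top f" using f Lp_norm_nonneg by blast
  have "\<bar>LINT t|circ. f t * ker a (2*N) c (x - t)\<bar> \<le> (LINT t|circ. \<bar>f t * ker a (2*N) c (x - t)\<bar>)"
    by (rule integral_abs_bound)
  also have "\<dots> \<le> (LINT t|circ. Lp_norm top f * ker_bound A N (t - x))"
  proof (rule integral_mono)
    fix t
    have "\<bar>f t\<bar> * \<bar>ker a (2*N) c (x - t)\<bar> \<le> Lp_norm top f * ker_bound A N (x - t)"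
      by (intro mult_mono Lp_norm_inf_ge f ker_le_ker_bound[OF s] F) auto
    then show "\<bar>f t * ker a (2*N) c (x - t)\<bar> \<le> Lp_norm top f * ker_bound A N (t - x)"
      by (simp add: abs_mult ker_bound_even[of A N t x])
  qed (use fourier_mult_eq_convolution(1)[OF f1] ker_bound_shift_integral(1) in auto)
  also have "\<dots> = Lp_norm top f * (LINT t|circ. ker_bound A N t)"
    by (simp add: ker_bound_shift_integral(2))
  also have "\<dots> \<le> Lp_norm top f * (10 * pi * A)"
    by (intro mult_left_mono ker_bound_integral N A F)
  finally show "\<bar>fourier_mult a (2*N) c f x\<bar> \<le> 10 * A * Lp_norm top f"
    unfolding fourier_mult_eq_convolution(2)[OF f1] by (simp add: divide_le_eq mult_ac)
qed

lemma fourier_mult_norm: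
  assumes "p \<in> {1, top}" "f \<in> Lp p" "seq_bound A N a"
  shows "Lp_norm p (fourier_mult a (2*N) c f) \<le> 10 * A * Lp_norm p f"
  using assms fourier_mult_norm_L1 fourier_mult_norm_inf by auto

text \<open>For j \<noteq> 0 a translation by \<pi>/j changes the sign of the integrand but not the
  integral.\<close>

lemma circ_integral_cis: "(LINT x|circ. cis (of_int j * x)) = (if j = 0 then of_real (2*pi) else 0)"
proof (cases "j = 0")
  case True
  interpret finite_measure circ by (rule finite_measure_circ)
  show ?thesis using True by (simp add: measure_restrict_space scaleR_conv_of_real)
next
  case False
  have per: "cis (of_int j * (x + 2*pi)) = cis (of_int j * x)" for x
  proof -
    have "cis (of_int j * (x + 2*pi)) = cis (of_int j * x) * cis (2 * pi * of_int j)"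
      unfolding cis_mult by (simp add: algebra_simps)
    also have "cis (2 * pi * of_int j) = 1" by (rule cis_multiple_2pi) (rule Ints_of_int)
    finally show ?thesis by simp
  qed
  have i: "integrable circ (\<lambda>x. cis (of_int j * x))"
    by (intro continuous_circ_integrable continuous_intros)
  have eq: "cis (of_int j * (x + pi / of_int j)) = - cis (of_int j * x)" for x
    using False by (simp add: distrib_left flip: cis_mult)
  have "(LINT x|circ. cis (of_int j * x)) = - (LINT x|circ. cis (of_int j * x))"
    using circ_shift(2)[of "\<lambda>x. cis (of_int j * x)" "pi / of_int j", OF per i] unfolding eq by simp
  then have "(LINT x|circ. cis (of_int j * x)) = 0" by (simp add: complex_eq_iff)
  then show ?thesis using False by simp
qed

text \<open>The real part splits into the frequencies m and -m; the second never meets an index k >=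
  0 because m >= 1.\<close>

lemma fourier_coeff_Re_cis:
  assumes m: "m \<ge> 1"
  shows "(\<lambda>x. Re (v * cis (real m * x))) \<in> Lp 1"
    and "fourier_coeff (\<lambda>x. Re (v * cis (real m * x))) k = (if k = m then v else 0)"
proof -
  let ?g = "\<lambda>x. Re (v * cis (real m * x))"
  have per: "cis (real m * (x + 2*pi)) = cis (real m * x)" for x
  proof -
    have "cis (real m * (x + 2*pi)) = cis (real m * x) * cis (2 * pi * real m)"
      unfolding cis_mult by (simp add: algebra_simps)
    also have "cis (2 * pi * real m) = 1" by (rule cis_multiple_2pi) (rule Ints_of_nat)
    finally show ?thesis by simp
  qed
  have c: "continuous_on UNIV ?g" by (intro continuous_intros)
  then have "?g \<in> Lp top" using per by (simp only: Lp_inf_iff simp_thms)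
  then show g: "?g \<in> Lp 1" using Lp_subset_L1[of top] by blast
  have i: "integrable circ (\<lambda>x. cis (of_int j * x))" for j
    by (intro continuous_circ_integrable continuous_intros)
  have eq: "?g x *\<^sub>R cis (- real k * x) =
     (v / 2) * cis (of_int (int m - int k) * x) + (cnj v / 2) * cis (of_int (- int m - int k) * x)" for x
  proof -
    have "of_real (?g x) = (v * cis (real m * x) + cnj (v * cis (real m * x))) / 2"
      by (subst complex_add_cnj) simp
    also have "\<dots> = (v / 2) * cis (real m * x) + (cnj v / 2) * cis (- (real m * x))"
      by (simp add: cis_cnj add_divide_distrib)
    finally have "?g x *\<^sub>R cis (- real k * x) = (v / 2) * (cis (real m * x) * cis (- real k * x)) 
        + (cnj v / 2) * (cis (- (real m * x)) * cis (- real k * x))"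
      by (simp only: scaleR_conv_of_real distrib_right mult.assoc)
    moreover have "real m * x + - real k * x = of_int (int m - int k) * x"
      "- (real m * x) + - real k * x = of_int (- int m - int k) * x"
      by (simp_all add: algebra_simps)
    ultimately show ?thesis unfolding cis_mult by (simp only:)
  qed
  show "fourier_coeff ?g k = (if k = m then v else 0)"
    unfolding fourier_coeff_eq_integral[OF g] eq
    by (subst Bochner_Integration.integral_add)
       (use m i in \<open>auto simp: circ_integral_cis scaleR_conv_of_real simp del: of_int_diff of_int_minus\<close>)
qed

lemma fourier_coeff_sum:
  assumes "finite S" "\<And>i. i \<in> S \<Longrightarrow> g i \<in> Lp 1"
  shows "(\<lambda>x. \<Sum>i\<in>S. g i x) \<in> Lp 1" "fourier_coeff (\<lambda>x. \<Sum>i\<in>S. g i x) k = (\<Sum>i\<in>S. fourier_coeff (g i) k)"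
proof -
  show L: "(\<lambda>x. \<Sum>i\<in>S. g i x) \<in> Lp 1"
    unfolding Lp_1_iff'
  proof (intro conjI allI)
    show "(\<lambda>x. \<Sum>i\<in>S. g i x) \<in> borel_measurable lebesgue"
      using assms by (intro borel_measurable_sum) (auto simp: Lp_1_iff')
  qed (use assms in \<open>auto simp: Lp_1_iff'\<close>)
  show "fourier_coeff (\<lambda>x. \<Sum>i\<in>S. g i x) k = (\<Sum>i\<in>S. fourier_coeff (g i) k)"
    unfolding fourier_coeff_eq_integral[OF L] scaleR_sum_left
    by (simp only: Bochner_Integration.integral_sum[OF fourier_coeff_integrable[OF assms(2)]] scaleR_sum_right)
       (intro sum.cong refl fourier_coeff_eq_integral[OF assms(2), symmetric])
qed

text \<open>The formula holds at every k, not only at the summed frequencies, because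
  \<open>seq_bound\<close> makes a vanish at 0 and from 2N on.\<close>

lemma fourier_coeff_fourier_mult:
  assumes "seq_bound A N a"
  shows "fourier_coeff (fourier_mult a (2*N) c f) k = of_real (a k) * cis c * fourier_coeff f k"
proof -
  have eq: "fourier_mult a (2*N) c f = (\<lambda>x. \<Sum>j<2*N. Re ((of_real (a (Suc j)) * cis c * fourier_coeff f (Suc j)) * cis (real (Suc j) * x)))"
    unfolding fourier_mult_def by (rule ext, rule sum.cong) (auto simp: algebra_simps simp flip: cis_mult simp del: of_nat_Suc)
  have "fourier_coeff (fourier_mult a (2*N) c f) k = (\<Sum>j<2*N. if k = Suc j then of_real (a (Suc j)) * cis c * fourier_coeff f (Suc j) else 0)"
    unfolding eq
  proof (subst fourier_coeff_sum(2))
    show "(\<lambda>x. Re (of_real (a (Suc j)) * cis c * fourier_coeff f (Suc j) * cis (real (Suc j) * x))) \<in> Lp 1" for j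
      by (rule fourier_coeff_Re_cis(1)) simp
    show "(\<Sum>j<2*N. fourier_coeff (\<lambda>x. Re (of_real (a (Suc j)) * cis c * fourier_coeff f (Suc j) * cis (real (Suc j) * x))) k) =
      (\<Sum>j<2*N. if k = Suc j then of_real (a (Suc j)) * cis c * fourier_coeff f (Suc j) else 0)"
      by (intro sum.cong refl fourier_coeff_Re_cis(2)) simp
  qed simp
  also have "\<dots> = of_real (a k) * cis c * fourier_coeff f k"
  proof (cases "1 \<le> k \<and> k \<le> 2*N")
    case True
    then obtain i where i: "k = Suc i" "i < 2*N" by (cases k) auto
    then show ?thesis by simp
  next
    case False
    then have "a k = 0" using assms by (cases "k = 0") (auto simp: seq_bound_def)
    then show ?thesis using False by (intro trans[OF sum.neutral]) auto
  qed
  finally show ?thesis .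
qed

text \<open>F is compared with a translate by d of the multiplier operator applied to H. The linear
  phase costs nothing, and the constant phase c is absorbed into the kernel, whose bound ignores
  it.\<close>

lemma multiplier_bound:
  assumes p: "p \<in> {1, top}" and F: "F \<in> Lp p" and H: "H \<in> Lp p" and s: "seq_bound A N a"
    and eq: "\<And>k. fourier_coeff F k = of_real (a k) * cis (c + d * real k) * fourier_coeff H k"
  shows "Lp_norm p F \<le> 10 * A * Lp_norm p H"
proof -
  let ?G = "fourier_mult a (2*N) c H"
  have G: "?G \<in> Lp p" by (rule fourier_mult_Lp[OF p])
  have "fourier_coeff F k = fourier_coeff (\<lambda>x. ?G (x + d)) k" for k
    unfolding fourier_coeff_shift[OF fourier_mult_Lp[OF insertI1]] fourier_coeff_fourier_mult[OF s] eq
    by (simp add: mult_ac flip: cis_mult)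
  then have "Lp_norm p F = Lp_norm p (\<lambda>x. ?G (x + d))"
    by (intro fourier_coeff_eq_imp_Lp_norm_eq p F Lp_shift G)
  also have "\<dots> = Lp_norm p ?G" by (rule Lp_shift(2)[OF p G])
  also have "\<dots> \<le> 10 * A * Lp_norm p H" by (rule fourier_mult_norm[OF p H s])
  finally show ?thesis .
qed

subsection \<open>Amplitudes and the dyadic cutoff\<close>

text \<open>One constant for the function and both derivatives keeps the rule for products short.
  The derivatives are two-sided, also at the end points.\<close>

definition C2_bound :: "real \<Rightarrow> (real \<Rightarrow> real) \<Rightarrow> bool" where
  "C2_bound B f \<longleftrightarrow> (\<exists>f' f''. \<forall>x\<in>{1/2..2}. (f has_real_derivative f' x) (at x) \<and>
     (f' has_real_derivative f'' x) (at x) \<and> \<bar>f x\<bar> \<le> B \<and> \<bar>f' x\<bar> \<le> B \<and> \<bar>f'' x\<bar> \<le> B)"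

text \<open>The factor 4 = 1 + 2 + 1 counts the terms of f''g + 2f'g' + fg''.\<close>

lemma C2_bound_mult:
  assumes "C2_bound A f" "C2_bound B g"
  shows "C2_bound (4 * A * B) (\<lambda>x. f x * g x)"
proof -
  obtain f' f'' where f: "\<And>x. x\<in>{1/2..2} \<Longrightarrow> (f has_real_derivative f' x) (at x) \<and>
     (f' has_real_derivative f'' x) (at x) \<and> \<bar>f x\<bar> \<le> A \<and> \<bar>f' x\<bar> \<le> A \<and> \<bar>f'' x\<bar> \<le> A"
    using assms(1) unfolding C2_bound_def by blast
  obtain g' g'' where g: "\<And>x. x\<in>{1/2..2} \<Longrightarrow> (g has_real_derivative g' x) (at x) \<and>
     (g' has_real_derivative g'' x) (at x) \<and> \<bar>g x\<bar> \<le> B \<and> \<bar>g' x\<bar> \<le> B \<and> \<bar>g'' x\<bar> \<le> B"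
    using assms(2) unfolding C2_bound_def by blast
  have A0: "0 \<le> A" using f[of 1] by auto
  show ?thesis unfolding C2_bound_def
  proof (intro exI ballI)
    fix x :: real assume x: "x \<in> {1/2..2}"
    have m: "\<bar>u * v\<bar> \<le> A * B" if "\<bar>u\<bar> \<le> A" "\<bar>v\<bar> \<le> B" for u v
      unfolding abs_mult by (rule mult_mono) (use that A0 in auto)
    have 1: "((\<lambda>x. f x * g x) has_real_derivative (f' x * g x + f x * g' x)) (at x)"
      using f[OF x] g[OF x] by (auto intro!: derivative_eq_intros)
    have 2: "((\<lambda>x. f' x * g x + f x * g' x) has_real_derivative (f'' x * g x + 2 * (f' x * g' x) + f x * g'' x)) (at x)"
      using f[OF x] g[OF x] by (auto intro!: derivative_eq_intros)
    have split: "\<bar>u + v\<bar> \<le> 4 * A * B" "\<bar>u + 2 * w + v\<bar> \<le> 4 * A * B"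
      if "\<bar>u\<bar> \<le> A * B" "\<bar>v\<bar> \<le> A * B" "\<bar>w\<bar> \<le> A * B" for u v w
      using that by linarith+
    have "0 \<le> A * B" using m[of "f x" "g x"] f[OF x] g[OF x] by linarith
    then show "((\<lambda>x. f x * g x) has_real_derivative (f' x * g x + f x * g' x)) (at x) \<and>
      ((\<lambda>x. f' x * g x + f x * g' x) has_real_derivative (f'' x * g x + 2 * (f' x * g' x) + f x * g'' x)) (at x) \<and>
      \<bar>f x * g x\<bar> \<le> 4 * A * B \<and> \<bar>f' x * g x + f x * g' x\<bar> \<le> 4 * A * B \<and>
      \<bar>f'' x * g x + 2 * (f' x * g' x) + f x * g'' x\<bar> \<le> 4 * A * B"
      using 1 2 m[of "f x" "g x"] f[OF x] g[OF x] by (auto intro!: split m)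
  qed
qed

text \<open>B is chosen before g, hence serves a whole family of bases at once; this is the source
  of the uniformity in t. The numerical limits on g are met by every base occurring in
  \<open>amp\<close>.\<close>

lemma C2_bound_powr:
  "\<exists>B>0. \<forall>g g' g''. (\<forall>x\<in>{1/2..2}. (g has_real_derivative g' x) (at x) \<and> (g' has_real_derivative g'' x) (at x) \<and>
      1/4 \<le> g x \<and> g x \<le> 2 \<and> \<bar>g' x\<bar> \<le> 1 \<and> \<bar>g'' x\<bar> \<le> 1) \<longrightarrow> C2_bound B (\<lambda>x. g x powr \<beta>)"
proof -
  \<comment> \<open>4^|\<beta>| dominates s^\<beta> on [1/4, 2]; for negative \<beta> the extreme
    case is s = 1/4.\<close>
  define P where "P = (\<lambda>\<beta>. (4::real) powr \<bar>\<beta>\<bar>)"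
  define B where "B = P \<beta> + \<bar>\<beta>\<bar> * P (\<beta> - 1) + \<bar>\<beta>\<bar> * \<bar>\<beta> - 1\<bar> * P (\<beta> - 2)"
  have P0: "0 < P \<beta>" for \<beta> by (simp add: P_def)
  have P: "s powr \<beta> \<le> P \<beta>" if s: "1/4 \<le> s" "s \<le> 2" for s \<beta>
  proof (cases "0 \<le> \<beta>")
    case True
    then show ?thesis unfolding P_def using s by (simp add: powr_mono2)
  next
    case False
    have "s powr \<beta> = (1/s) powr (- \<beta>)" using s by (simp add: powr_minus powr_divide)
    also have "\<dots> \<le> 4 powr (- \<beta>)" using s False by (intro powr_mono2) (auto simp: field_simps)
    finally show ?thesis using False by (simp add: P_def)
  qed
  have B: "P \<beta> \<le> B" "\<bar>\<beta>\<bar> * P (\<beta> - 1) \<le> B"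
    "\<bar>\<beta>\<bar> * \<bar>\<beta> - 1\<bar> * P (\<beta> - 2) + \<bar>\<beta>\<bar> * P (\<beta> - 1) \<le> B"
    using P0[of \<beta>] P0[of "\<beta> - 1"] P0[of "\<beta> - 2"] unfolding B_def by auto
  show ?thesis
  proof (intro exI[of _ B] conjI allI impI)
    show "B > 0" using B(1) P0[of \<beta>] by linarith
    fix g g' g'' :: "real \<Rightarrow> real"
    assume "\<forall>x\<in>{1/2..2}. (g has_real_derivative g' x) (at x) \<and> (g' has_real_derivative g'' x) (at x) \<and>
      1/4 \<le> g x \<and> g x \<le> 2 \<and> \<bar>g' x\<bar> \<le> 1 \<and> \<bar>g'' x\<bar> \<le> 1"
    then have g: "(g has_real_derivative g' x) (at x)" "(g' has_real_derivative g'' x) (at x)"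
      "1/4 \<le> g x" "g x \<le> 2" "\<bar>g' x\<bar> \<le> 1" "\<bar>g'' x\<bar> \<le> 1" if "x\<in>{1/2..2}" for x
      using that by auto
    show "C2_bound B (\<lambda>x. g x powr \<beta>)" unfolding C2_bound_def
    proof (intro exI ballI)
      fix x :: real assume x: "x \<in> {1/2..2}"
      note gx = g[OF x]
      have pos: "g x > 0" using gx(3) by linarith
      have D: "((\<lambda>x. g x powr \<delta>) has_real_derivative (\<delta> * g x powr (\<delta> - 1) * g' x)) (at x)" for \<delta>
        using DERIV_fun_powr[OF gx(1) pos, of \<delta>] by simp
      have 2: "((\<lambda>x. \<beta> * g x powr (\<beta> - 1) * g' x) has_real_derivative
           (\<beta> * (\<beta> - 1) * g x powr (\<beta> - 2) * (g' x * g' x) + \<beta> * g x powr (\<beta> - 1) * g'' x)) (at x)"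
        by (rule derivative_eq_intros D gx(2) refl)+ (simp add: algebra_simps)
      have b1: "\<bar>\<beta> * g x powr (\<beta> - 1) * w\<bar> \<le> \<bar>\<beta>\<bar> * P (\<beta> - 1)" if "\<bar>w\<bar> \<le> 1" for w
      proof -
        have "\<bar>\<beta> * g x powr (\<beta> - 1) * w\<bar> \<le> \<bar>\<beta>\<bar> * P (\<beta> - 1) * 1"
          unfolding abs_mult by (intro mult_mono) (use that P[OF gx(3,4)] less_imp_le[OF P0] in auto)
        then show ?thesis by simp
      qed
      have b2: "\<bar>\<beta> * (\<beta> - 1) * g x powr (\<beta> - 2) * (g' x * g' x)\<bar> \<le> \<bar>\<beta>\<bar> * \<bar>\<beta> - 1\<bar> * P (\<beta> - 2)"
      proof -
        have "\<bar>\<beta> * (\<beta> - 1) * g x powr (\<beta> - 2) * (g' x * g' x)\<bar> \<le> \<bar>\<beta>\<bar> * \<bar>\<beta> - 1\<bar> * P (\<beta> - 2) * (1 * 1)"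
          unfolding abs_mult by (intro mult_mono) (use gx(5) P[OF gx(3,4)] less_imp_le[OF P0] in auto)
        then show ?thesis by simp
      qed
      show "((\<lambda>x. g x powr \<beta>) has_real_derivative (\<beta> * g x powr (\<beta> - 1) * g' x)) (at x) \<and>
        ((\<lambda>x. \<beta> * g x powr (\<beta> - 1) * g' x) has_real_derivative
           (\<beta> * (\<beta> - 1) * g x powr (\<beta> - 2) * (g' x * g' x) + \<beta> * g x powr (\<beta> - 1) * g'' x)) (at x) \<and>
        \<bar>g x powr \<beta>\<bar> \<le> B \<and> \<bar>\<beta> * g x powr (\<beta> - 1) * g' x\<bar> \<le> B \<and>
        \<bar>\<beta> * (\<beta> - 1) * g x powr (\<beta> - 2) * (g' x * g' x) + \<beta> * g x powr (\<beta> - 1) * g'' x\<bar> \<le> B"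
      proof (intro conjI D 2)
        show "\<bar>g x powr \<beta>\<bar> \<le> B" using B(1) P[OF gx(3,4), of \<beta>] by simp
        show "\<bar>\<beta> * g x powr (\<beta> - 1) * g' x\<bar> \<le> B" using B(2) b1[OF gx(5)] by linarith
        show "\<bar>\<beta> * (\<beta> - 1) * g x powr (\<beta> - 2) * (g' x * g' x) + \<beta> * g x powr (\<beta> - 1) * g'' x\<bar> \<le> B"
          using B(3) b1[OF gx(6)] b2 by linarith
      qed
    qed
  qed
qed

text \<open>The variable \<open>x\<close> stands for \<open>k / 2\<^sup>j\<close> and \<open>t\<close> for \<open>2\<^sup>j \<bar>h\<bar>\<close>, so that \<open>t * x = k \<bar>h\<bar>\<close>. The division by \<open>t\<close>
  keeps the last factor bounded, with its derivatives, as \<open>t\<close> tends to \<open>0\<close>.\<close>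

definition amp :: "real \<Rightarrow> real \<Rightarrow> real \<Rightarrow> real \<Rightarrow> real \<Rightarrow> real" where
  "amp \<rho> \<beta> \<delta> t x = x powr \<rho> * (2 * sin (x/2)) powr \<beta> * (2 * sin (t * x / 2) / t) powr \<delta>"

text \<open>On [1/2, 2] the base 2 sin (t x / 2) / t lies between x/2 and x for all 0 < t <= 1, and
  its derivatives are at most 1. The middle factor of \<open>amp\<close> is the case t = 1 of the
  same base.\<close>

lemma C2_bound_amp:
  "\<exists>B>0. \<forall>t. 0 < t \<longrightarrow> t \<le> 1 \<longrightarrow> C2_bound B (amp \<rho> \<beta> \<delta> t)"
proof -
  let ?g = "\<lambda>t x. 2 * sin (t * x / 2) / (t::real)"
  have gb: "(?g t has_real_derivative cos (t * x / 2)) (at x)"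
    "((\<lambda>x. cos (t * x / 2)) has_real_derivative (- (t / 2) * sin (t * x / 2))) (at x)"
    "1/4 \<le> ?g t x" "?g t x \<le> 2" "\<bar>cos (t * x / 2)\<bar> \<le> 1" "\<bar>- (t / 2) * sin (t * x / 2)\<bar> \<le> 1"
    if t: "0 < t" "t \<le> 1" and x: "x \<in> {1/2..2}" for t x :: real
  proof -
    show "(?g t has_real_derivative cos (t * x / 2)) (at x)"
      "((\<lambda>x. cos (t * x / 2)) has_real_derivative (- (t / 2) * sin (t * x / 2))) (at x)"
      using t by (auto intro!: derivative_eq_intros)
    have "t * x \<le> 1 * 2" using t x by (intro mult_mono) auto
    then have "t * x / 2 / 2 \<le> sin (t * x / 2)" using t x by (intro sin_ge_half) auto
    then have "x / 2 \<le> ?g t x" using t by (simp add: field_simps)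
    then show "1/4 \<le> ?g t x" using x by simp
    have "sin (t * x / 2) \<le> t * x / 2" using t x by (intro sin_x_le_x) auto
    then have "?g t x \<le> x" using t by (simp add: field_simps)
    then show "?g t x \<le> 2" using x by simp
    show "\<bar>cos (t * x / 2)\<bar> \<le> 1" by simp
    have "\<bar>- (t / 2) * sin (t * x / 2)\<bar> \<le> 1 * 1"
      unfolding abs_mult using t by (intro mult_mono) auto
    then show "\<bar>- (t / 2) * sin (t * x / 2)\<bar> \<le> 1" by simp
  qed
  obtain B1 where B1: "B1 > 0" "\<And>g g' g''. (\<And>x. x\<in>{1/2..2} \<Longrightarrow> (g has_real_derivative g' x) (at x) \<and> (g' has_real_derivative g'' x) (at x) \<and>
      1/4 \<le> g x \<and> g x \<le> 2 \<and> \<bar>g' x\<bar> \<le> 1 \<and> \<bar>g'' x\<bar> \<le> 1) \<Longrightarrow> C2_bound B1 (\<lambda>x. g x powr \<rho>)"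
    using C2_bound_powr[of \<rho>] by blast
  obtain B2 where B2: "B2 > 0" "\<And>g g' g''. (\<And>x. x\<in>{1/2..2} \<Longrightarrow> (g has_real_derivative g' x) (at x) \<and> (g' has_real_derivative g'' x) (at x) \<and>
      1/4 \<le> g x \<and> g x \<le> 2 \<and> \<bar>g' x\<bar> \<le> 1 \<and> \<bar>g'' x\<bar> \<le> 1) \<Longrightarrow> C2_bound B2 (\<lambda>x. g x powr \<beta>)"
    using C2_bound_powr[of \<beta>] by blast
  obtain B3 where B3: "B3 > 0" "\<And>g g' g''. (\<And>x. x\<in>{1/2..2} \<Longrightarrow> (g has_real_derivative g' x) (at x) \<and> (g' has_real_derivative g'' x) (at x) \<and>
      1/4 \<le> g x \<and> g x \<le> 2 \<and> \<bar>g' x\<bar> \<le> 1 \<and> \<bar>g'' x\<bar> \<le> 1) \<Longrightarrow> C2_bound B3 (\<lambda>x. g x powr \<delta>)"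
    using C2_bound_powr[of \<delta>] by blast
  have 1: "C2_bound B1 (\<lambda>x. x powr \<rho>)"
    by (rule B1(2)[of "\<lambda>x. x" "\<lambda>x. 1" "\<lambda>x. 0"]) auto
  have 3: "C2_bound B3 (\<lambda>x. ?g t x powr \<delta>)" if "0 < t" "t \<le> 1" for t
    by (rule B3(2)[of "?g t" "\<lambda>x. cos (t * x / 2)" "\<lambda>x. - (t / 2) * sin (t * x / 2)"]) (use gb[OF that] in blast)
  have "C2_bound B2 (\<lambda>x. ?g 1 x powr \<beta>)"
    by (rule B2(2)[of "?g 1" "\<lambda>x. cos (1 * x / 2)" "\<lambda>x. - (1 / 2) * sin (1 * x / 2)"])
       (use gb[OF zero_less_one order_refl] in blast)
  then have 2: "C2_bound B2 (\<lambda>x. (2 * sin (x/2)) powr \<beta>)" by simp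
  show ?thesis unfolding amp_def
    by (rule exI[of _ "4 * (4 * B1 * B2) * B3"])
       (use B1(1) B2(1) B3(1) C2_bound_mult[OF C2_bound_mult[OF 1 2] 3] in auto)
qed

text \<open>This is \<open>cos\<^sup>2 (\<pi> / 2 * log 2 x)\<close>; it vanishes to second order at \<open>1/2\<close> and \<open>2\<close>.\<close>

definition psi :: "real \<Rightarrow> real" where
  "psi x = (1 + cos (pi * ln x / ln 2)) / 2"

definition psi' :: "real \<Rightarrow> real" where
  "psi' x = - (pi / ln 2) * sin (pi * ln x / ln 2) / (2 * x)"

lemma DERIV_psi: "x > 0 \<Longrightarrow> (psi has_real_derivative psi' x) (at x)"
  unfolding psi_def psi'_def by (auto intro!: derivative_eq_intros simp: field_simps)

lemma psi_ends: "psi (1/2) = 0" "psi 2 = 0" "psi' (1/2) = 0" "psi' 2 = 0"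
  by (simp_all add: psi_def psi'_def ln_div)

text \<open>Halving x moves the argument of the cosine by \<pi>, so the two cosines cancel.\<close>

lemma psi_half: "x > 0 \<Longrightarrow> psi x + psi (x / 2) = 1"
  by (simp add: psi_def ln_div diff_divide_distrib right_diff_distrib cos_diff add_divide_distrib)

lemma C2_bound_psi: "\<exists>B>0. C2_bound B psi"
proof -
  define q where "q x = (- (pi / ln 2)\<^sup>2 * cos (pi * ln x / ln 2) + (pi / ln 2) * sin (pi * ln x / ln 2)) / (2 * x\<^sup>2)" for x :: real
  have D2: "(psi' has_real_derivative q x) (at x)" if "x > 0" for x
    unfolding psi'_def q_def using that
    by (auto intro!: derivative_eq_intros simp: field_simps power2_eq_square)
  have c: "continuous_on {1/2..2} psi" "continuous_on {1/2..2} psi'" "continuous_on {1/2..2} q"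
    unfolding psi_def psi'_def q_def by (intro continuous_intros; force)+
  have b: "\<exists>B. \<forall>x\<in>{1/2..2}. \<bar>f x\<bar> \<le> B" if "continuous_on {1/2..2} f" for f :: "real \<Rightarrow> real"
    using compact_imp_bounded[OF compact_continuous_image[OF that compact_Icc]]
    unfolding bounded_iff by auto
  obtain B1 B2 B3 where B: "\<forall>x\<in>{1/2..2}. \<bar>psi x\<bar> \<le> B1" "\<forall>x\<in>{1/2..2}. \<bar>psi' x\<bar> \<le> B2" "\<forall>x\<in>{1/2..2}. \<bar>q x\<bar> \<le> B3"
    using b c by meson
  let ?B = "\<bar>B1\<bar> + \<bar>B2\<bar> + \<bar>B3\<bar> + 1"
  have "C2_bound ?B psi" unfolding C2_bound_def
  proof (intro exI ballI)
    fix x :: real assume x: "x \<in> {1/2..2}"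
    then have "x > 0" by auto
    then show "(psi has_real_derivative psi' x) (at x) \<and> (psi' has_real_derivative q x) (at x) \<and>
       \<bar>psi x\<bar> \<le> ?B \<and> \<bar>psi' x\<bar> \<le> ?B \<and> \<bar>q x\<bar> \<le> ?B"
      using DERIV_psi D2 bspec[OF B(1) x] bspec[OF B(2) x] bspec[OF B(3) x] by auto
  qed
  then show ?thesis by (intro exI[of _ ?B]) auto
qed

text \<open>The second derivative of \<phi> may jump at 1/2 and 2, so no bound through a continuous
  second derivative is available. As q and q' vanish there, \<phi> is still differentiable with a
  Lipschitz derivative, and this suffices.\<close>

lemma cutoff_second_difference:
  fixes q q' q'' :: "real \<Rightarrow> real"
  assumes q: "\<And>x. x\<in>{1/2..2} \<Longrightarrow> (q has_real_derivative q' x) (at x)"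
    and q': "\<And>x. x\<in>{1/2..2} \<Longrightarrow> (q' has_real_derivative q'' x) (at x)"
    and B: "\<And>x. x\<in>{1/2..2} \<Longrightarrow> \<bar>q'' x\<bar> \<le> B"
    and z: "q (1/2) = 0" "q 2 = 0" "q' (1/2) = 0" "q' 2 = 0"
    and h: "h > 0"
  defines "\<phi> \<equiv> \<lambda>x. if x \<in> {1/2..2} then q x else 0"
  shows "\<bar>2 * \<phi> (x + h) - \<phi> x - \<phi> (x + 2 * h)\<bar> \<le> B * h\<^sup>2"
proof -
  define \<phi>' where "\<phi>' x = (if x \<in> {1/2..2} then q' x else 0)" for x
  have cl: "closure ({..<1/2} \<union> {2<..}) = {..1/2} \<union> {2::real..}" by (simp add: closure_Un)
  have D: "(\<phi> has_real_derivative \<phi>' x) (at x)" for x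
  proof -
    have "((\<lambda>x. if x \<in> {1/2..2} then q x else (\<lambda>_. 0) x) has_vector_derivative
       (if x \<in> {1/2..2} then q' x else (\<lambda>_. 0) x)) (at x within UNIV)"
    proof (rule has_vector_derivative_If_within_closures[where T="{..<1/2} \<union> {2<..}"])
      assume x: "x \<in> {1/2..2} \<union> closure {1/2..2} \<inter> closure ({..<1/2} \<union> {2<..})"
      then have "x \<in> {1/2..2}" by auto
      from q[OF this] show "(q has_vector_derivative q' x) (at x within {1/2..2} \<union> closure {1/2..2} \<inter> closure ({..<1/2} \<union> {2<..}))"
        by (simp add: has_real_derivative_iff_has_vector_derivative has_vector_derivative_at_within)
    next
      assume "x \<in> closure {1/2..2}" "x \<in> closure ({..<1/2} \<union> {2<..})"
      then have "x = 1/2 \<or> x = 2" unfolding cl by auto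
      then show "q x = 0" "q' x = 0" using z by metis+
    qed auto
    then show ?thesis unfolding \<phi>_def \<phi>'_def has_real_derivative_iff_has_vector_derivative by simp
  qed
  \<comment> \<open>Projection onto [1/2, 2]. It does not increase distances, and \<phi>' is q'
    after c because q' is 0 at both ends.\<close>
  define c where "c x = max (1/2) (min 2 x)" for x :: real
  have c: "c x \<in> {1/2..2}" "\<phi>' x = q' (c x)" for x
    using z by (auto simp: c_def \<phi>'_def max_def min_def)
  have lip: "\<bar>\<phi>' x - \<phi>' y\<bar> \<le> B * \<bar>x - y\<bar>" for x y
  proof -
    have "norm (q' (c x) - q' (c y)) \<le> B * norm (c x - c y)"
      by (rule field_differentiable_bound[of "{1/2..2}" q' q''])
         (use q' B c in \<open>auto intro: has_field_derivative_at_within\<close>)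
    also have "\<dots> \<le> B * \<bar>x - y\<bar>"
      using order_trans[OF abs_ge_zero B[of 1]] by (intro mult_left_mono) (auto simp: c_def)
    finally show ?thesis using c(2) by simp
  qed
  \<comment> \<open>The second difference is, up to sign, s h - s 0, and the derivative of s is a
    difference of \<phi>' over the distance h: each mean value step yields one factor h.\<close>
  define s where "s u = \<phi> (x + h + u) - \<phi> (x + u)" for u
  have "norm (s h - s 0) \<le> (B * h) * norm (h - 0)"
  proof (rule field_differentiable_bound[of UNIV s "\<lambda>u. \<phi>' (x + h + u) - \<phi>' (x + u)"])
    fix u
    have "((\<lambda>u. \<phi> (x + h + u)) has_real_derivative \<phi>' (x + h + u)) (at u)"
      "((\<lambda>u. \<phi> (x + u)) has_real_derivative \<phi>' (x + u)) (at u)"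
      using D[of "u + (x + h)"] D[of "u + x"] DERIV_shift[of \<phi> _ u "x + h"] DERIV_shift[of \<phi> _ u x]
      by (simp_all add: add.commute add.left_commute add.assoc)
    then show "(s has_real_derivative \<phi>' (x + h + u) - \<phi>' (x + u)) (at u within UNIV)"
      unfolding s_def by (intro derivative_intros)
    show "norm (\<phi>' (x + h + u) - \<phi>' (x + u)) \<le> B * h"
      using lip[of "x + h + u" "x + u"] h by simp
  qed auto
  moreover have "s h - s 0 = - (2 * \<phi> (x + h) - \<phi> x - \<phi> (x + 2 * h))"
    by (simp add: s_def algebra_simps)
  ultimately show ?thesis using h by (simp add: power2_eq_square mult.assoc)
qed

definition phi :: "real \<Rightarrow> real" where
  "phi x = (if x \<in> {1/2..2} then psi x else 0)"

text \<open>The double zeros of \<open>psi\<close> at 1/2 and 2 survive multiplication by b, so the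
  product may be cut off and sampled. The scalar s is kept apart to carry powers of 2^j and
  |h|.\<close>

lemma seq_bound_phi:
  assumes P: "C2_bound P psi" and b: "C2_bound B b" and N: "N \<ge> 1" and s: "0 \<le> s"
  shows "seq_bound (s * (4 * P * B)) N (\<lambda>k. s * (phi (real k / real N) * b (real k / real N)))"
proof -
  define A where "A = 4 * P * B"
  let ?q = "\<lambda>x. psi x * b x"
  obtain q' q'' where q: "\<And>x. x\<in>{1/2..2} \<Longrightarrow> (?q has_real_derivative q' x) (at x)"
    and q': "\<And>x. x\<in>{1/2..2} \<Longrightarrow> (q' has_real_derivative q'' x) (at x)"
    and bd: "\<And>x. x\<in>{1/2..2} \<Longrightarrow> \<bar>?q x\<bar> \<le> A" "\<And>x. x\<in>{1/2..2} \<Longrightarrow> \<bar>q'' x\<bar> \<le> A"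
    using C2_bound_mult[OF P b] unfolding C2_bound_def A_def by blast
  obtain b' where b': "\<And>x. x\<in>{1/2..2} \<Longrightarrow> (b has_real_derivative b' x) (at x)"
    using b unfolding C2_bound_def by blast
  \<comment> \<open>q' is known only through the existential in \<open>C2_bound\<close>; uniqueness
    of derivatives identifies it at the ends.\<close>
  have q'z: "q' x = 0" if x: "x \<in> {1/2, 2}" for x
  proof -
    have x': "x \<in> {1/2..2}" using x by auto
    have "psi x = 0" "psi' x = 0" using x psi_ends by (metis insertE singletonD)+
    then have "(?q has_real_derivative 0) (at x)"
      using DERIV_mult[OF DERIV_psi b'[OF x']] x by auto
    then show ?thesis using q[OF x'] DERIV_unique by blast
  qed
  define f where "f x = phi x * b x" for x
  have f: "f = (\<lambda>x. if x \<in> {1/2..2} then ?q x else 0)" by (auto simp: f_def phi_def)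
  have A0: "0 \<le> A" using bd(1)[of 1] by auto
  have sd: "\<bar>2 * f (x + h) - f x - f (x + 2 * h)\<bar> \<le> A * h\<^sup>2" if "h > 0" for x h
    unfolding f by (rule cutoff_second_difference[OF q q' bd(2)]) (use psi_ends q'z that in auto)
  have f0: "f x = 0" if "x \<le> 1/2 \<or> x \<ge> 2" for x
  proof -
    have "x = 1/2 \<or> x = 2 \<or> x \<notin> {1/2..2}" using that by auto
    then show ?thesis unfolding f_def phi_def using psi_ends by (metis mult_zero_left)
  qed
  have fA: "\<bar>f x\<bar> \<le> A" for x unfolding f using bd(1) A0 by auto
  let ?h = "1 / real N"
  have sd': "\<bar>2 * f (real (Suc k) / real N) - f (real k / real N) - f (real (k + 2) / real N)\<bar> \<le> A / (real N)\<^sup>2" for k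
  proof -
    have e: "real (Suc k) / real N = real k / real N + ?h" "real (k + 2) / real N = real k / real N + 2 * ?h"
      by (simp_all add: add_divide_distrib)
    show ?thesis unfolding e using sd[of ?h "real k / real N"] N by (simp add: power_divide)
  qed
  \<comment> \<open>This is the second difference starting at -1/N, where the first two samples, at
    -1/N and 0, are zero.\<close>
  have f1: "\<bar>f (real 1 / real N)\<bar> \<le> A / (real N)\<^sup>2"
  proof -
    have "- ?h \<le> 0" "0 < ?h" using N by auto
    have "f (- ?h) = 0" by (rule f0) (use \<open>- ?h \<le> 0\<close> in linarith)
    moreover have "f 0 = 0" by (rule f0) simp
    ultimately
    show ?thesis using sd[OF \<open>0 < ?h\<close>, of "- ?h"] by (simp add: power_divide)
  qed
  have sc: "\<bar>s * u\<bar> \<le> s * v" if "\<bar>u\<bar> \<le> v" for u v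
    unfolding abs_mult using s that by (simp add: mult_left_mono)
  show ?thesis unfolding seq_bound_def A_def[symmetric] f_def[symmetric]
  proof (intro conjI allI impI)
    show "s * f (real 0 / real N) = 0" using f0[of 0] by simp
    show "s * f (real k / real N) = 0" if "2 * N \<le> k" for k
    proof -
      have "2 * real N \<le> real k" using that by linarith
      then have "2 \<le> real k / real N" using N by (simp add: le_divide_eq)
      then show ?thesis using f0 by simp
    qed
    show "\<bar>s * f (real k / real N)\<bar> \<le> s * A" for k by (intro sc fA)
    show "\<bar>s * f (real 1 / real N)\<bar> \<le> s * A / (real N)\<^sup>2" using sc[OF f1] by simp
    show "\<bar>2 * (s * f (real (Suc k) / real N)) - s * f (real k / real N) - s * f (real (k + 2) / real N)\<bar> \<le> s * A / (real N)\<^sup>2" for k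
      using sc[OF sd'[of k]] by (simp add: right_diff_distrib mult.left_commute)
  qed (use N in simp)
qed

subsection \<open>Dyadic decomposition\<close>

text \<open>The order of quantifiers matters: C depends only on the three exponents, whereas t, p,
  N, the phases c and d and the scale s come afterwards.\<close>

lemma dyadic_multiplier_bound:
  "\<exists>C>0. \<forall>t p F H N c d s. 0 < t \<longrightarrow> t \<le> 1 \<longrightarrow> p \<in> {1, top} \<longrightarrow> F \<in> Lp p \<longrightarrow> H \<in> Lp p \<longrightarrow> 1 \<le> N \<longrightarrow> 0 \<le> s \<longrightarrow>
     (\<forall>k. fourier_coeff F k = of_real (s * (phi (real k / real N) * amp \<rho> \<beta> \<delta> t (real k / real N))) * cis (c + d * real k) * fourier_coeff H k) \<longrightarrow>
     Lp_norm p F \<le> C * s * Lp_norm p H"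
proof -
  obtain P where P: "P > 0" "C2_bound P psi" using C2_bound_psi by blast
  obtain B where B: "B > 0" "\<And>t. 0 < t \<Longrightarrow> t \<le> 1 \<Longrightarrow> C2_bound B (amp \<rho> \<beta> \<delta> t)"
    using C2_bound_amp by blast
  show ?thesis
  proof (intro exI[of _ "10 * (4 * P * B)"] conjI allI impI)
    show "10 * (4 * P * B) > 0" using P B by simp
    fix t p F H N c d s
    assume a: "0 < t" "t \<le> 1" "p \<in> {1, top}" "F \<in> Lp p" "H \<in> Lp p" "1 \<le> N" "0 \<le> s"
      "\<forall>k. fourier_coeff F k = of_real (s * (phi (real k / real N) * amp \<rho> \<beta> \<delta> t (real k / real N))) * cis (c + d * real k) * fourier_coeff H k"
    have "Lp_norm p F \<le> 10 * (s * (4 * P * B)) * Lp_norm p H"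
      by (rule multiplier_bound[OF a(3-5) seq_bound_phi[OF P(2) B(2)[OF a(1,2)] a(6,7)], of c d]) (use a(8) in blast)
    then show "Lp_norm p F \<le> 10 * (4 * P * B) * s * Lp_norm p H" by (simp add: mult_ac)
  qed
qed

text \<open>With x = k / N in [1/2, 2] the angle k |h| = t x is positive and at most 2 < 2 \<pi>, so
  the polar form applies; negative h is reached by conjugation, whence \<open>sgn h\<close> in the
  phase. Taking out t^\<gamma> leaves the normalised factor of \<open>amp\<close>.\<close>

lemma diff_symbol_scaled:
  assumes h: "h \<noteq> 0" and N: "N \<ge> 1" and t: "t = real N * \<bar>h\<bar>" "t \<le> 1" and x: "real k / real N \<in> {1/2..2}"
  shows "diff_symbol \<gamma> (real k * h) = of_real (t powr \<gamma> * (2 * sin (t * (real k / real N) / 2) / t) powr \<gamma>) *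
    cis (sgn h * \<gamma> * pi / 2 + (\<gamma> * h / 2) * real k)"
proof -
  define \<theta> where "\<theta> = real k * \<bar>h\<bar>"
  have t0: "0 < t" using h N t by simp
  have \<theta>: "t * (real k / real N) = \<theta>" using N by (simp add: t(1) \<theta>_def)
  have "\<theta> \<le> 1 * 2" unfolding \<theta>[symmetric] using x t t0 by (intro mult_mono) auto
  moreover have "0 < \<theta>"
  proof -
    have "1/2 \<le> real k / real N" using x by (simp only: atLeastAtMost_iff)
    then have "0 < real k / real N" by linarith
    then show ?thesis unfolding \<theta>[symmetric] using t0 by (intro mult_pos_pos)
  qed
  ultimately have \<theta>b: "0 < \<theta>" "\<theta> < 2 * pi" using pi_gt3 by auto
  then have s: "0 < sin (\<theta> / 2)" by (intro sin_gt_zero) auto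
  have "(2 * sin (\<theta> / 2)) powr \<gamma> = (t * (2 * sin (\<theta> / 2) / t)) powr \<gamma>" using t0 by simp
  also have "\<dots> = t powr \<gamma> * (2 * sin (\<theta> / 2) / t) powr \<gamma>"
    by (rule powr_mult)
  finally have pw: "(2 * sin (\<theta> / 2)) powr \<gamma> = t powr \<gamma> * (2 * sin (\<theta> / 2) / t) powr \<gamma>" .
  note L = diff_symbol_polar[OF \<theta>b, of \<gamma>]
  show ?thesis
  proof (cases "h > 0")
    case True
    then have "real k * h = \<theta>" by (simp add: \<theta>_def)
    moreover have "\<gamma> * (pi + \<theta>) / 2 = sgn h * \<gamma> * pi / 2 + (\<gamma> * h / 2) * real k"
      using True by (simp add: \<theta>_def field_simps)
    ultimately show ?thesis by (simp only: \<theta> L pw)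
  next
    case False
    then have "real k * h = - \<theta>" and "h < 0" using h by (auto simp: \<theta>_def)
    note \<open>real k * h = - \<theta>\<close>
    moreover have "- (\<gamma> * (pi + \<theta>) / 2) = sgn h * \<gamma> * pi / 2 + (\<gamma> * h / 2) * real k"
      using \<open>h < 0\<close> by (simp add: \<theta>_def field_simps)
    moreover have "diff_symbol \<gamma> (- \<theta>) = of_real ((2 * sin (\<theta> / 2)) powr \<gamma>) * cis (- (\<gamma> * (pi + \<theta>) / 2))"
      unfolding diff_symbol_minus L complex_cnj_mult cis_cnj by simp
    ultimately show ?thesis by (simp only: \<theta> pw)
  qed
qed

text \<open>A harmonic of frequency k >= 1 is determined by its values at x = 0 and x = \<pi>/(2k),
  which give the real and imaginary parts of the coefficient. At k = 0 the convention
  \<open>0 powr r = 0\<close> encodes the vanishing mean.\<close>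

lemma conj_weyl_deriv_iff:
  "conj_weyl_deriv p r f g \<longleftrightarrow> g \<in> Lp p \<and>
     (\<forall>k. fourier_coeff g k = of_real (real k powr r) * cis (pi * (r + 1) / 2) * fourier_coeff f k)"
proof -
  have zero: "fourier_coeff g 0 = 0 \<longleftrightarrow> fourier_cos g 0 = 0"
    by (simp add: fourier_coeff_def complex_eq_iff fourier_sin_def set_lebesgue_integral_def)
  define W where "W k = of_real (real k powr r) * cis (pi * (r + 1) / 2) * fourier_coeff f k" for k
  have eq1: "fourier_cos g k * cos y + fourier_sin g k * sin y = Re (fourier_coeff g k * cis y)" for k y
    by (simp add: fourier_coeff_def)
  have eq2: "real k powr r * (fourier_cos f k * cos (y + pi * (r + 1) / 2) + fourier_sin f k * sin (y + pi * (r + 1) / 2)) =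
      Re (W k * cis y)" for k y
  proof -
    have "Re (W k * cis y) = real k powr r * Re (fourier_coeff f k * cis (y + pi * (r + 1) / 2))"
      unfolding W_def by (simp add: mult_ac flip: cis_mult)
         (simp add: algebra_simps)
    then show ?thesis by (simp add: fourier_coeff_def)
  qed
  have key: "(\<forall>x. Re (Z * cis (real k * x)) = Re (V * cis (real k * x))) \<longleftrightarrow> Z = V" if "k \<ge> 1" for k Z V
  proof
    assume a: "\<forall>x. Re (Z * cis (real k * x)) = Re (V * cis (real k * x))"
    show "Z = V" using a[rule_format, of 0] a[rule_format, of "pi / 2 / real k"] that
      by (simp add: complex_eq_iff)
  qed simp
  have W0: "W 0 = 0" by (simp add: W_def)
  have "(\<forall>k. fourier_coeff g k = W k) \<longleftrightarrow> fourier_coeff g 0 = 0 \<and> (\<forall>k\<ge>1. fourier_coeff g k = W k)"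
    using W0 by (metis One_nat_def Suc_leI neq0_conv)
  then show ?thesis
    unfolding conj_weyl_deriv_def eq1 eq2 zero[symmetric] W_def[symmetric] using key by auto
qed

text \<open>For 2^m <= k < 2^(m+1) only j = m and j = m + 1 contribute, and their sum is
  \<open>psi_half\<close>. At k = 2^m the piece j = m - 1 is met at the end point 2, where
  \<open>psi\<close> is 0.\<close>

lemma phi_partition:
  assumes "k \<ge> 1"
  shows "(\<lambda>j. phi (real k / 2 ^ j)) sums 1"
proof -
  obtain m where m: "2 ^ m \<le> k" "k < 2 ^ (m + 1)" using ex_power_ivl1[of 2 k] assms by auto
  have m': "2 ^ m \<le> real k" "real k < 2 ^ (m + 1)"
    using m by (metis of_nat_le_iff of_nat_numeral of_nat_power, metis of_nat_less_iff of_nat_numeral of_nat_power)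
  have "(\<lambda>j. phi (real k / 2 ^ j)) sums (\<Sum>j\<in>{m, m + 1}. phi (real k / 2 ^ j))"
  proof (rule sums_finite)
    fix j assume j: "j \<notin> {m, m + 1}"
    show "phi (real k / 2 ^ j) = 0"
    proof (cases "j < m")
      case True
      have "(2::real) * 2 ^ j \<le> 2 ^ m" using True power_increasing[of "Suc j" m "2::real"] by simp
      from order_trans[OF this m'(1)] have "2 \<le> real k / 2 ^ j" by (simp add: le_divide_eq)
      then have "real k / 2 ^ j = 2 \<or> real k / 2 ^ j \<notin> {1/2..2}" by auto
      then show ?thesis unfolding phi_def using psi_ends by metis
    next
      case False
      then have "m + 2 \<le> j" using j by auto
      then have "(2::real) ^ (m + 2) \<le> 2 ^ j" by (intro power_increasing) auto
      then have "real k < 2 ^ j / 2" using m'(2) by simp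
      then have "real k / 2 ^ j < 1/2" by (simp add: divide_less_eq)
      then show ?thesis by (simp add: phi_def)
    qed
  qed simp
  also have "(\<Sum>j\<in>{m, m + 1}. phi (real k / 2 ^ j)) = psi (real k / 2 ^ m) + psi (real k / 2 ^ m / 2)"
  proof -
    define x where "x = real k / 2 ^ m"
    have "1 \<le> x" "x < 2" using m' by (auto simp: x_def divide_less_eq le_divide_eq)
    then have "phi x = psi x" "phi (x / 2) = psi (x / 2)" by (auto simp: phi_def)
    moreover have "real k / 2 ^ (m + 1) = x / 2" by (simp add: x_def)
    moreover have "(\<Sum>j\<in>{m, m + 1}. y j) = y m + y (m + 1)" for y :: "nat \<Rightarrow> real" by simp
    ultimately show ?thesis by (simp only: x_def[symmetric])
  qed
  also have "\<dots> = 1" using assms by (intro psi_half) simp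
  finally show ?thesis .
qed

lemma phi_0: "phi 0 = 0"
  by (simp add: phi_def)

lemma phi_nonzeroD: "phi x \<noteq> 0 \<Longrightarrow> x \<in> {1/2..2}"
  by (auto simp: phi_def split: if_splits)

lemma Lp_norm_fourier_coeff_zero:
  assumes p: "p \<in> {1, top}" and F: "F \<in> Lp p" and z: "\<And>k. fourier_coeff F k = 0"
  shows "Lp_norm p F = 0"
proof -
  have 1: "fourier_coeff (\<lambda>x. 0 * F x) k = 0" for k
    using fourier_coeff_cmult[of F 0 k] Lp_subset_L1 p F by auto
  have "Lp_norm p F = Lp_norm p (\<lambda>x. 0 * F x)"
    by (rule fourier_coeff_eq_imp_Lp_norm_eq[OF p F Lp_cmult(1)[OF p F]]) (simp only: 1 z)
  also have "\<dots> = \<bar>0\<bar> * Lp_norm p F" by (rule Lp_cmult(2)[OF p F])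
  finally show ?thesis by simp
qed

text \<open>Multiplier estimates require 2^j |h| > 0; this settles the step h = 0
  separately.\<close>

lemma Lp_norm_frac_diff_0:
  assumes "p \<in> {1, top}" "f \<in> Lp p" "\<gamma> > 0"
  shows "Lp_norm p (frac_diff \<gamma> 0 f) = 0"
  by (rule Lp_norm_fourier_coeff_zero) (use assms in \<open>auto simp: frac_diff_Lp diff_symbol_0\<close>)

text \<open>F need not be the sum of its pieces by construction: the pieces sum absolutely in norm
  to a function with the same coefficients, and uniqueness does the rest.\<close>

lemma Lp_norm_le_series:
  assumes p: "p \<in> {1, top}" and F: "F \<in> Lp p" and E: "\<And>j. E j \<in> Lp p"
    and s: "summable b" and b: "\<And>j. Lp_norm p (E j) \<le> b j"
    and eq: "\<And>k. (\<lambda>j. fourier_coeff (E j) k) sums fourier_coeff F k"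
  shows "Lp_norm p F \<le> (\<Sum>j. b j)"
proof -
  have s': "summable (\<lambda>j. Lp_norm p (E j))"
    by (rule summable_comparison_test[OF _ s]) (use b Lp_norm_nonneg[OF p E] in auto)
  have "fourier_coeff F k = fourier_coeff (\<lambda>x. \<Sum>j. E j x) k" for k
    using sums_unique2[OF eq Lp_series(3)[OF p E s']] .
  then have "Lp_norm p F = Lp_norm p (\<lambda>x. \<Sum>j. E j x)"
    by (intro fourier_coeff_eq_imp_Lp_norm_eq p F Lp_series E s')
  also have "\<dots> \<le> (\<Sum>j. Lp_norm p (E j))" by (rule Lp_series(2)[OF p E s'])
  also have "\<dots> \<le> (\<Sum>j. b j)" by (rule suminf_le[OF b s' s])
  finally show ?thesis .
qed

text \<open>Two geometric series, rising until 2^j u passes 1 and falling afterwards. The bound is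
  independent of u, that is, of the step h.\<close>

lemma dyadic_sum_bound:
  fixes a b u :: real
  assumes a: "a > 0" and b: "b > 0" and u: "u > 0"
  defines "w \<equiv> \<lambda>j. if 2 ^ j * u \<le> 1 then (2 ^ j * u) powr a else (2 ^ j * u) powr (- b)"
  shows "summable w" "(\<Sum>j. w j) \<le> 1 / (1 - 2 powr (- a)) + 1 / (1 - 2 powr (- b))"
proof -
  \<comment> \<open>Sum of the geometric series with ratio 2^-a; the inductions use it through K = 1
    + 2^-a K.\<close>
  define K where "K = (\<lambda>a::real. 1 / (1 - 2 powr (- a)))"
  have lt1: "2 powr (- c) < (1::real)" if "c > 0" for c :: real
    using that powr_less_mono[of "- c" 0 2] by simp
  have K0: "K c > 0" if "c > 0" for c unfolding K_def using lt1[OF that] by simp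
  have Kstep: "K c * v powr (- c) = v powr (- c) + K c * (2 * v) powr (- c)" if "c > 0" "v > 0" for c v
  proof -
    have "(2 * v) powr (- c) = 2 powr (- c) * v powr (- c)" by (rule powr_mult)
    then have "v powr (- c) + K c * (2 * v) powr (- c) = (1 + K c * 2 powr (- c)) * v powr (- c)"
      by (simp add: distrib_right)
    also have "1 + K c * 2 powr (- c) = K c" using that(1) by (simp add: K_def field_simps)
    finally show ?thesis ..
  qed
  \<comment> \<open>The induction closes because the bound remembers the last argument 2^(J-1) u,
    capped at 1 once the terms stop.\<close>
  have w1: "(\<Sum>j<J. if 2 ^ j * u \<le> 1 then (2 ^ j * u) powr a else 0) \<le> K a * (min 1 (2 ^ J * u / 2)) powr a" for J
  proof (induction J)
    case 0 then show ?case using K0[OF a] by simp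
  next
    case (Suc J)
    let ?v = "2 ^ J * u"
    have v: "?v > 0" using u by simp
    have "(min 1 (?v / 2)) powr a \<le> (min 1 ?v) powr a" using v a by (intro powr_mono2) auto
    then have mono: "K a * (min 1 (?v / 2)) powr a \<le> K a * (min 1 ?v) powr a"
      using K0[OF a] by (intro mult_left_mono) auto
    have "?v \<le> 1 \<Longrightarrow> K a * (?v / 2) powr a + ?v powr a = K a * ?v powr a"
    proof -
      have "(?v / 2) powr a = ?v powr a * 2 powr (- a)"
        unfolding powr_divide powr_minus by (simp only: divide_inverse)
      then have "K a * (?v / 2) powr a + ?v powr a = (K a * 2 powr (- a) + 1) * ?v powr a"
        by (simp add: distrib_right)
      also have "K a * 2 powr (- a) + 1 = K a" using a by (simp add: K_def field_simps)
      finally show "K a * (?v / 2) powr a + ?v powr a = K a * ?v powr a" .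
    qed
    note eq = this
    have "(if ?v \<le> 1 then ?v powr a else 0) + K a * (min 1 (?v / 2)) powr a \<le> K a * (min 1 ?v) powr a"
    proof (cases "?v \<le> 1")
      case True
      then have "min 1 (?v / 2) = ?v / 2" "min 1 ?v = ?v" using v by auto
      then show ?thesis using eq[OF True] True by simp
    next
      case False
      then show ?thesis using mono by simp
    qed
    moreover have "2 ^ Suc J * u / 2 = ?v" by simp
    ultimately show ?case using Suc by simp
  qed
  \<comment> \<open>Here the extra term on the left stands for the part of the series still to
    come.\<close>
  have w2: "(\<Sum>j<J. if 2 ^ j * u \<le> 1 then 0 else (2 ^ j * u) powr (- b)) + K b * (max 1 (2 ^ J * u)) powr (- b) \<le> K b" for J
  proof (induction J)
    case 0
    have "(max 1 u) powr (- b) \<le> 1 powr (- b)" using b u by (intro powr_mono2') auto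
    then show ?case using K0[OF b] by (simp add: mult_left_le)
  next
    case (Suc J)
    let ?v = "2 ^ J * u"
    have v: "?v > 0" using u by simp
    have "(if ?v \<le> 1 then 0 else ?v powr (- b)) + K b * (max 1 (2 * ?v)) powr (- b) \<le> K b * (max 1 ?v) powr (- b)"
    proof (cases "?v \<le> 1")
      case True
      have "(max 1 (2 * ?v)) powr (- b) \<le> (max 1 ?v) powr (- b)" using b v by (intro powr_mono2') auto
      then show ?thesis using True K0[OF b] by (simp add: mult_left_mono)
    next
      case False
      then show ?thesis using Kstep[OF b v] by simp
    qed
    then show ?case using Suc by (simp add: mult.assoc)
  qed
  have part: "(\<Sum>j<J. w j) \<le> K a + K b" for J
  proof -
    have "(\<Sum>j<J. w j) = (\<Sum>j<J. if 2 ^ j * u \<le> 1 then (2 ^ j * u) powr a else 0) +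
       (\<Sum>j<J. if 2 ^ j * u \<le> 1 then 0 else (2 ^ j * u) powr (- b))"
      unfolding sum.distrib[symmetric] w_def by (intro sum.cong) auto
    moreover have "K a * (min 1 (2 ^ J * u / 2)) powr a \<le> K a * 1 powr a"
      using a u K0[OF a] by (intro mult_left_mono powr_mono2) auto
    moreover have "0 \<le> K b * (max 1 (2 ^ J * u)) powr (- b)" using K0[OF b] by simp
    ultimately show ?thesis using w1[of J] w2[of J] by simp
  qed
  have w0: "0 \<le> w j" for j by (simp add: w_def)
  show s: "summable w" by (rule summableI_nonneg_bounded[OF w0 part])
  show "(\<Sum>j. w j) \<le> 1 / (1 - 2 powr (- a)) + 1 / (1 - 2 powr (- b))"
    using suminf_le_const[OF s part] by (simp add: K_def)
qed

subsection \<open>Part II: the difference of a function and of its derivative\<close>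

text \<open>The estimate is made for each h separately, before any supremum. On the Fourier side the
  quotient of the two differences is the symbol of order r + \<epsilon> times k^-r and a constant
  phase.\<close>

lemma frac_diff_le_weyl:
  fixes r \<alpha> \<epsilon> :: real
  assumes r: "r > 0" and \<alpha>: "\<alpha> > 0" and \<epsilon>: "\<epsilon> > 0"
  shows "\<exists>C>0. \<forall>p f g h. p \<in> {1, top} \<longrightarrow> f \<in> Lp p \<longrightarrow> conj_weyl_deriv p r f g \<longrightarrow>
     Lp_norm p (frac_diff (r + \<alpha> + \<epsilon>) h f) \<le> C * \<bar>h\<bar> powr r * Lp_norm p (frac_diff \<alpha> h g)"
proof -
  define K where "K = (\<Sum>n. \<bar>(r + \<epsilon>) gchoose n\<bar>)"
  have K: "0 \<le> K" unfolding K_def using r \<epsilon> by (intro suminf_nonneg summable_abs_gbinomial) auto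
  define G where "G = 1 / (1 - 2 powr (- \<epsilon>)) + 1 / (1 - 2 powr (- r))"
  have G: "G > 0"
    unfolding G_def using powr_less_mono[of "- \<epsilon>" 0 2] powr_less_mono[of "- r" 0 2] r \<epsilon> by (intro add_pos_pos) auto
  obtain P where P: "C2_bound P psi" using C2_bound_psi by blast
  have one: "C2_bound 1 (\<lambda>_. 1)" unfolding C2_bound_def by (intro exI[of _ "\<lambda>_. 0"]) auto
  obtain C1 where C1: "C1 > 0" "\<And>t p F H N c d s. \<lbrakk>0 < t; t \<le> 1; p \<in> {1, top}; F \<in> Lp p; H \<in> Lp p; 1 \<le> N; 0 \<le> s;
     \<And>k. fourier_coeff F k = of_real (s * (phi (real k / real N) * amp (- r) 0 (r + \<epsilon>) t (real k / real N))) * cis (c + d * real k) * fourier_coeff H k\<rbrakk> \<Longrightarrow>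
     Lp_norm p F \<le> C1 * s * Lp_norm p H"
    using dyadic_multiplier_bound[of "- r" 0 "r + \<epsilon>"] by blast
  obtain C2 where C2: "C2 > 0" "\<And>t p F H N c d s. \<lbrakk>0 < t; t \<le> 1; p \<in> {1, top}; F \<in> Lp p; H \<in> Lp p; 1 \<le> N; 0 \<le> s;
     \<And>k. fourier_coeff F k = of_real (s * (phi (real k / real N) * amp (- r) 0 0 t (real k / real N))) * cis (c + d * real k) * fourier_coeff H k\<rbrakk> \<Longrightarrow>
     Lp_norm p F \<le> C2 * s * Lp_norm p H"
    using dyadic_multiplier_bound[of "- r" 0 0] by blast
  define M where "M = C1 + C2 * K"
  have M: "0 < M" using C1(1) C2(1) K by (simp add: M_def add_pos_nonneg)
  show ?thesis
  proof (intro exI[of _ "M * G"] conjI allI impI)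
    show "M * G > 0" using M G by simp
    fix p :: ennreal and f g h
    assume p: "p \<in> {1, top}" and f: "f \<in> Lp p" and fg: "conj_weyl_deriv p r f g"
    define \<gamma> where "\<gamma> = r + \<alpha> + \<epsilon>"
    have \<gamma>: "\<gamma> > 0" and r\<epsilon>: "r + \<epsilon> > 0" using r \<alpha> \<epsilon> by (auto simp: \<gamma>_def)
    define \<theta> where "\<theta> = pi * (r + 1) / 2"
    have g: "g \<in> Lp p" and fcg: "\<And>k. fourier_coeff g k = of_real (real k powr r) * cis \<theta> * fourier_coeff f k"
      using fg by (auto simp: conj_weyl_deriv_iff \<theta>_def)
    define D where "D = frac_diff \<alpha> h g"
    have D: "D \<in> Lp p" unfolding D_def by (rule frac_diff_Lp(1)[OF p g \<alpha>])
    have D0: "0 \<le> Lp_norm p D" by (rule Lp_norm_nonneg[OF p D])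
    have fcD: "fourier_coeff D k = diff_symbol \<alpha> (real k * h) * of_real (real k powr r) * cis \<theta> * fourier_coeff f k" for k
      unfolding D_def frac_diff_Lp(3)[OF p g \<alpha>] fcg by simp
    show "Lp_norm p (frac_diff (r + \<alpha> + \<epsilon>) h f) \<le> M * G * \<bar>h\<bar> powr r * Lp_norm p (frac_diff \<alpha> h g)"
    proof (cases "h = 0")
      case True
      then show ?thesis using Lp_norm_frac_diff_0[OF p f \<gamma>] unfolding \<gamma>_def by simp
    next
      case h: False
      define u where "u = \<bar>h\<bar>"
      have u: "u > 0" using h by (simp add: u_def)
      define F where "F = frac_diff \<gamma> h f"
      have F: "F \<in> Lp p" unfolding F_def by (rule frac_diff_Lp(1)[OF p f \<gamma>])
      have fcF: "fourier_coeff F k = diff_symbol (r + \<epsilon>) (real k * h) * diff_symbol \<alpha> (real k * h) * fourier_coeff f k" for k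
      proof -
        have "\<gamma> = (r + \<epsilon>) + \<alpha>" by (simp add: \<gamma>_def)
        then show ?thesis unfolding F_def frac_diff_Lp(3)[OF p f \<gamma>] by (simp only: diff_symbol_add)
      qed
      define w where "w j = (if 2 ^ j * u \<le> 1 then (2 ^ j * u) powr \<epsilon> else (2 ^ j * u) powr (- r))" for j :: nat
      \<comment> \<open>The j-th dyadic piece of F, using the constant amplitude 1.\<close>
      define E where "E j = fourier_mult (\<lambda>k. 1 * (phi (real k / real (2 ^ j)) * 1)) (2 * 2 ^ j) 0 F" for j :: nat
      have E: "E j \<in> Lp p" for j unfolding E_def by (rule fourier_mult_Lp[OF p])
      have fcE: "fourier_coeff (E j) k = of_real (phi (real k / real (2 ^ j))) * fourier_coeff F k" for j k
        unfolding E_def by (subst fourier_coeff_fourier_mult[OF seq_bound_phi[OF P one]]) auto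
      have E_bound: "Lp_norm p (E j) \<le> w j * (M * u powr r * Lp_norm p D)" for j
      proof (cases "2 ^ j * u \<le> 1")
        case True
        define t where "t = real (2 ^ j) * u"
        have t: "0 < t" "t \<le> 1" using True u by (auto simp: t_def)
        \<comment> \<open>Scales taken out of k^-r and of the symbol of order r + \<epsilon>. With t
          = 2^j u they amount to u^r (2^j u)^\<epsilon>.\<close>
        define s where "s = (2 ^ j) powr (- r) * t powr (r + \<epsilon>)"
        have "Lp_norm p (E j) \<le> C1 * s * Lp_norm p D"
        \<comment> \<open>The phases are those of the symbol of order r + \<epsilon>, with the phase
          \<theta> of the derivative taken back.\<close>
        proof (rule C1(2)[OF t p E D, where N="2 ^ j" and s=s and
            c="sgn h * (r + \<epsilon>) * pi / 2 - \<theta>" and d="(r + \<epsilon>) * h / 2"])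
          fix k :: nat
          show "fourier_coeff (E j) k = of_real (s * (phi (real k / real (2 ^ j)) * amp (- r) 0 (r + \<epsilon>) t (real k / real (2 ^ j)))) *
            cis (sgn h * (r + \<epsilon>) * pi / 2 - \<theta> + (r + \<epsilon>) * h / 2 * real k) * fourier_coeff D k"
          proof (cases "phi (real k / real (2 ^ j)) = 0")
            case True then show ?thesis unfolding fcE by simp
          next
            case False
            define x where "x = real k / real (2 ^ j)"
            have x: "x \<in> {1/2..2}" unfolding x_def by (rule phi_nonzeroD[OF False])
            have xpos: "x > 0" using x by auto
            \<comment> \<open>Positivity is needed to drop the factor with exponent 0, since
              \<open>0 powr 0 = 0\<close>.\<close>
            have sx: "sin (x / 2) > 0" using x pi_gt3 by (intro sin_gt_zero) auto
            have k: "real k = 2 ^ j * x" by (simp add: x_def)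
            have kr: "real k powr r = (2 ^ j) powr r * x powr r" unfolding k by (rule powr_mult)
            have am: "amp (- r) 0 (r + \<epsilon>) t x = x powr (- r) * (2 * sin (t * x / 2) / t) powr (r + \<epsilon>)"
              using sx by (simp add: amp_def)
            have L: "diff_symbol (r + \<epsilon>) (real k * h) = of_real (t powr (r + \<epsilon>) * (2 * sin (t * x / 2) / t) powr (r + \<epsilon>)) *
              cis (sgn h * (r + \<epsilon>) * pi / 2 + (r + \<epsilon>) * h / 2 * real k)"
              unfolding x_def by (rule diff_symbol_scaled[OF h _ _ t(2)]) (use x in \<open>auto simp: t_def u_def x_def\<close>)
            have c1: "s * (phi x * amp (- r) 0 (r + \<epsilon>) t x) * real k powr r =
               phi x * (t powr (r + \<epsilon>) * (2 * sin (t * x / 2) / t) powr (r + \<epsilon>))"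
            proof -
              have "(2 ^ j) powr (- r) * (2 ^ j) powr r = (1::real)" "x powr (- r) * x powr r = 1"
                using xpos by (simp_all flip: powr_add)
              then have "(((2 ^ j) powr (- r) * (2 ^ j) powr r) * (x powr (- r) * x powr r)) * phi x *
                 (t powr (r + \<epsilon>) * (2 * sin (t * x / 2) / t) powr (r + \<epsilon>)) =
                 phi x * (t powr (r + \<epsilon>) * (2 * sin (t * x / 2) / t) powr (r + \<epsilon>))" by simp
              then show ?thesis unfolding am kr s_def by (simp only: mult_ac)
            qed
            have c2: "cis (sgn h * (r + \<epsilon>) * pi / 2 - \<theta> + (r + \<epsilon>) * h / 2 * real k) * cis \<theta> =
              cis (sgn h * (r + \<epsilon>) * pi / 2 + (r + \<epsilon>) * h / 2 * real k)"
              unfolding cis_mult by (simp add: algebra_simps)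
            have "of_real (s * (phi x * amp (- r) 0 (r + \<epsilon>) t x)) *
                cis (sgn h * (r + \<epsilon>) * pi / 2 - \<theta> + (r + \<epsilon>) * h / 2 * real k) * fourier_coeff D k =
              of_real (s * (phi x * amp (- r) 0 (r + \<epsilon>) t x) * real k powr r) *
              (cis (sgn h * (r + \<epsilon>) * pi / 2 - \<theta> + (r + \<epsilon>) * h / 2 * real k) * cis \<theta>) *
              (diff_symbol \<alpha> (real k * h) * fourier_coeff f k)"
              unfolding fcD of_real_mult by (simp only: mult_ac)
            also have "\<dots> = of_real (phi x) * fourier_coeff F k"
              unfolding c1 c2 fcF L of_real_mult by (simp only: mult_ac)
            finally show ?thesis unfolding fcE x_def by (rule sym)
          qed
        qed (use t in \<open>auto simp: s_def\<close>)
        also have "s = u powr r * w j"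
        proof -
          have "(2 ^ j) powr (- r) * (2 ^ j) powr r = (1::real)" by (simp flip: powr_add)
          then have "((2 ^ j) powr (- r) * (2 ^ j) powr r) * u powr r * (2 ^ j * u) powr \<epsilon> = u powr r * (2 ^ j * u) powr \<epsilon>"
            by simp
          then show ?thesis using True unfolding s_def t_def w_def powr_add
            by (simp add: powr_mult mult_ac)
        qed
        finally have "Lp_norm p (E j) \<le> C1 * (u powr r * w j) * Lp_norm p D" .
        also have "\<dots> \<le> M * (u powr r * w j) * Lp_norm p D"
          using K C2(1) D0 by (intro mult_right_mono) (auto simp: M_def w_def)
        finally show ?thesis by (simp add: mult_ac)
      next
        case False
        \<comment> \<open>For 2^j u > 1 the symbol of order r + \<epsilon> is not expanded: the
          operator itself is applied to D at the cost K, so that only k^-r remains as a multiplier.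
          Its scale 2^(-jr) equals u^r (2^j u)^-r.\<close>
        define H where "H = frac_diff (r + \<epsilon>) h D"
        have H: "H \<in> Lp p" unfolding H_def by (rule frac_diff_Lp(1)[OF p D r\<epsilon>])
        have HD: "Lp_norm p H \<le> K * Lp_norm p D" unfolding H_def K_def by (rule frac_diff_Lp(2)[OF p D r\<epsilon>])
        have fcH: "fourier_coeff H k = diff_symbol (r + \<epsilon>) (real k * h) * fourier_coeff D k" for k
          unfolding H_def by (rule frac_diff_Lp(3)[OF p D r\<epsilon>])
        define s where "s = (2 ^ j :: real) powr (- r)"
        have "Lp_norm p (E j) \<le> C2 * s * Lp_norm p H"
        proof (rule C2(2)[OF zero_less_one order_refl p E H, where N="2 ^ j" and s=s and c="- \<theta>" and d=0])
          fix k :: nat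
          show "fourier_coeff (E j) k = of_real (s * (phi (real k / real (2 ^ j)) * amp (- r) 0 0 1 (real k / real (2 ^ j)))) *
            cis (- \<theta> + 0 * real k) * fourier_coeff H k"
          proof (cases "phi (real k / real (2 ^ j)) = 0")
            case True then show ?thesis unfolding fcE by simp
          next
            case False
            define x where "x = real k / real (2 ^ j)"
            have x: "x \<in> {1/2..2}" unfolding x_def by (rule phi_nonzeroD[OF False])
            have xpos: "x > 0" using x by auto
            have sx: "sin (x / 2) > 0" using x pi_gt3 by (intro sin_gt_zero) auto
            have k: "real k = 2 ^ j * x" by (simp add: x_def)
            have kr: "real k powr r = (2 ^ j) powr r * x powr r" unfolding k by (rule powr_mult)
            have am: "amp (- r) 0 0 1 x = x powr (- r)"
              using sx by (simp add: amp_def)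
            have c1: "s * (phi x * amp (- r) 0 0 1 x) * real k powr r = phi x"
            proof -
              have "(2 ^ j) powr (- r) * (2 ^ j) powr r = (1::real)" "x powr (- r) * x powr r = 1"
                using xpos by (simp_all flip: powr_add)
              then have "(((2 ^ j) powr (- r) * (2 ^ j) powr r) * (x powr (- r) * x powr r)) * phi x = phi x" by simp
              then show ?thesis unfolding am kr s_def by (simp only: mult_ac)
            qed
            have c2: "cis (- \<theta> + 0 * real k) * cis \<theta> = 1" by (simp add: cis_mult)
            have "of_real (s * (phi x * amp (- r) 0 0 1 x)) * cis (- \<theta> + 0 * real k) * fourier_coeff H k =
              of_real (s * (phi x * amp (- r) 0 0 1 x) * real k powr r) * (cis (- \<theta> + 0 * real k) * cis \<theta>) *
              (diff_symbol (r + \<epsilon>) (real k * h) * diff_symbol \<alpha> (real k * h) * fourier_coeff f k)"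
              unfolding fcH fcD of_real_mult by (simp only: mult_ac)
            also have "\<dots> = of_real (phi x) * fourier_coeff F k"
              unfolding c1 c2 fcF by simp
            finally show ?thesis unfolding fcE x_def by (rule sym)
          qed
        qed (auto simp: s_def)
        also have "\<dots> \<le> C2 * s * (K * Lp_norm p D)"
          using C2(1) HD by (intro mult_left_mono) (auto simp: s_def)
        also have "s = u powr r * w j"
        proof -
          have "u powr r * u powr (- r) = 1" using u by (simp flip: powr_add)
          then have "(u powr r * u powr (- r)) * (2 ^ j) powr (- r) = (2 ^ j) powr (- r)" by simp
          then show ?thesis using False unfolding s_def w_def by (simp add: powr_mult mult_ac)
        qed
        finally have "Lp_norm p (E j) \<le> C2 * K * (u powr r * w j) * Lp_norm p D" by (simp only: mult_ac)
        also have "\<dots> \<le> M * (u powr r * w j) * Lp_norm p D"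
          using C1(1) D0 by (intro mult_right_mono) (auto simp: M_def w_def)
        finally show ?thesis by (simp add: mult_ac)
      qed
      have w: "summable w" "(\<Sum>j. w j) \<le> G"
        using dyadic_sum_bound[OF \<epsilon> r u] unfolding w_def[abs_def] G_def by auto
      have "Lp_norm p F \<le> (\<Sum>j. w j * (M * u powr r * Lp_norm p D))"
      proof (rule Lp_norm_le_series[OF p F E summable_mult2[OF w(1)] E_bound])
        fix k
        show "(\<lambda>j. fourier_coeff (E j) k) sums fourier_coeff F k"
        proof (cases "k = 0")
          case True
          then show ?thesis unfolding fcE fcF by (simp add: phi_0 diff_symbol_0)
        next
          case False
          have "(\<lambda>j. of_real (phi (real k / 2 ^ j)) * fourier_coeff F k) sums (of_real 1 * fourier_coeff F k)"
            by (intro sums_mult2 sums_of_real phi_partition) (use False in simp)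
          then show ?thesis unfolding fcE by simp
        qed
      qed
      also have "\<dots> = (\<Sum>j. w j) * (M * u powr r * Lp_norm p D)" by (rule suminf_mult2[OF w(1), symmetric])
      also have "\<dots> \<le> G * (M * u powr r * Lp_norm p D)"
        using w(2) M D0 by (intro mult_right_mono) auto
      finally show ?thesis unfolding F_def \<gamma>_def u_def D_def by (simp add: mult_ac)
    qed
  qed
qed

lemma modulus_le_weyl:
  fixes r \<alpha> \<epsilon> :: real
  assumes r: "r > 0" and \<alpha>: "\<alpha> > 0" and \<epsilon>: "\<epsilon> > 0"
  shows "\<exists>C>0. \<forall>p f g n. p \<in> {1, top} \<longrightarrow> f \<in> Lp p \<longrightarrow> conj_weyl_deriv p r f g \<longrightarrow> 1 \<le> n \<longrightarrow>
     modulus p (r + \<alpha> + \<epsilon>) f (1 / real n) \<le> C / real n powr r * modulus p \<alpha> g (1 / real n)"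
proof -
  obtain C where C: "C > 0" "\<And>p f g h. \<lbrakk>p \<in> {1, top}; f \<in> Lp p; conj_weyl_deriv p r f g\<rbrakk> \<Longrightarrow>
     Lp_norm p (frac_diff (r + \<alpha> + \<epsilon>) h f) \<le> C * \<bar>h\<bar> powr r * Lp_norm p (frac_diff \<alpha> h g)"
    using frac_diff_le_weyl[OF assms] by blast
  show ?thesis
  proof (intro exI[of _ C] conjI allI impI)
    fix p :: ennreal and f g and n :: nat
    assume p: "p \<in> {1, top}" and f: "f \<in> Lp p" and fg: "conj_weyl_deriv p r f g" and n: "1 \<le> n"
    have g: "g \<in> Lp p" using fg by (simp add: conj_weyl_deriv_iff)
    show "modulus p (r + \<alpha> + \<epsilon>) f (1 / real n) \<le> C / real n powr r * modulus p \<alpha> g (1 / real n)"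
    proof (rule modulus_le)
      fix h :: real assume h: "\<bar>h\<bar> \<le> 1 / real n"
      have "Lp_norm p (frac_diff (r + \<alpha> + \<epsilon>) h f) \<le> C * \<bar>h\<bar> powr r * Lp_norm p (frac_diff \<alpha> h g)"
        by (rule C(2)[OF p f fg])
      also have "\<dots> \<le> C * (1 / real n) powr r * modulus p \<alpha> g (1 / real n)"
        using h r C(1) by (intro mult_mono powr_mono2 Lp_norm_frac_diff_le_modulus p g \<alpha> Lp_norm_nonneg frac_diff_Lp) auto
      also have "(1 / real n) powr r = 1 / real n powr r" by (simp add: powr_divide)
      finally show "Lp_norm p (frac_diff (r + \<alpha> + \<epsilon>) h f) \<le> C / real n powr r * modulus p \<alpha> g (1 / real n)" by simp
    qed simp
  qed (use C in simp)
qed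

subsection \<open>Part I: the derivative\<close>

text \<open>Cauchy condensation with weights: the block from 2^J + 1 to 2^(J+1) has 2^J terms, each
  comparable with its value at the right end. In the constant, 2^a comes from the capped weight, 2^r
  from the power and 2 from the block length.\<close>

lemma dyadic_condensation:
  fixes u :: "nat \<Rightarrow> real"
  assumes r: "r > 0" and a: "a \<ge> 0" and n: "n > 0"
    and u0: "\<And>\<nu>. \<nu> \<ge> 1 \<Longrightarrow> 0 \<le> u \<nu>" and mono: "\<And>\<nu> \<mu>. 1 \<le> \<nu> \<Longrightarrow> \<nu> \<le> \<mu> \<Longrightarrow> u \<mu> \<le> u \<nu>"
  shows "(\<Sum>j\<le>J. min 1 ((2 ^ j / real n) powr a) * (2 ^ j) powr r * u (2 ^ j)) \<le>
    2 powr (a + r + 1) * (\<Sum>\<nu>=1..2 ^ J. real \<nu> powr (r - 1) * min 1 ((real \<nu> / real n) powr a) * u \<nu>)"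
proof (induction J)
  case 0
  have "1 * (min 1 ((1 / real n) powr a) * u 1) \<le> 2 powr (a + r + 1) * (min 1 ((1 / real n) powr a) * u 1)"
    using a r u0[of 1] by (intro mult_right_mono ge_one_powr_ge_zero) auto
  then show ?case by simp
next
  case (Suc J)
  define M :: real where "M = 2 ^ Suc J"
  let ?S = "\<lambda>\<nu>. real \<nu> powr (r - 1) * min 1 ((real \<nu> / real n) powr a) * u \<nu>"
  have M: "M > 0" by (simp add: M_def)
  define c where "c = 2 powr (- a) * (2 powr (- r) * M powr (r - 1)) * min 1 ((M / real n) powr a) * u (2 ^ Suc J)"
  have S: "c \<le> ?S \<nu>" if \<nu>: "\<nu> \<in> {2 ^ J + 1..2 ^ Suc J}" for \<nu>
  proof -
    have "2 ^ J \<le> real \<nu>" using \<nu> by (metis atLeastAtMost_iff add_leD1 of_nat_le_iff of_nat_numeral of_nat_power)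
    moreover have "real \<nu> \<le> 2 ^ Suc J" using \<nu> by (metis atLeastAtMost_iff of_nat_le_iff of_nat_numeral of_nat_power)
    ultimately have b: "M / 2 \<le> real \<nu>" "real \<nu> \<le> M" by (auto simp: M_def)
    have \<nu>0: "real \<nu> > 0" using b M by linarith
    \<comment> \<open>Writing \<nu>^(r-1) as \<nu>^r / \<nu> avoids distinguishing r < 1 from r >=
      1.\<close>
    have "2 powr (- r) * M powr (r - 1) = (M / 2) powr r / M"
      using M by (simp add: powr_divide powr_minus powr_diff field_simps)
    also have "\<dots> \<le> real \<nu> powr r / real \<nu>"
      using b M r \<nu>0 by (intro frac_le powr_mono2) auto
    also have "\<dots> = real \<nu> powr (r - 1)" using \<nu>0 by (simp add: powr_diff)
    finally have 1: "2 powr (- r) * M powr (r - 1) \<le> real \<nu> powr (r - 1)" .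
    have "(M / real n) powr a \<le> (2 * (real \<nu> / real n)) powr a"
      using b M n a by (intro powr_mono2) (auto simp: field_simps)
    also have "\<dots> = 2 powr a * (real \<nu> / real n) powr a" by (rule powr_mult)
    finally have "min 1 ((M / real n) powr a) \<le> 2 powr a * min 1 ((real \<nu> / real n) powr a)"
      using ge_one_powr_ge_zero[of 2 a] a by (simp add: min_def)
    then have "2 powr (- a) * min 1 ((M / real n) powr a) \<le> 2 powr (- a) * (2 powr a * min 1 ((real \<nu> / real n) powr a))"
      by (intro mult_left_mono) auto
    also have "\<dots> = (2 powr (- a) * 2 powr a) * min 1 ((real \<nu> / real n) powr a)" by simp
    also have "2 powr (- a) * 2 powr a = (1::real)" by (simp flip: powr_add)
    finally have 2: "2 powr (- a) * min 1 ((M / real n) powr a) \<le> min 1 ((real \<nu> / real n) powr a)" by simp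
    have 3: "u (2 ^ Suc J) \<le> u \<nu>" using \<nu> by (intro mono) auto
    have "(2 powr (- r) * M powr (r - 1)) * (2 powr (- a) * min 1 ((M / real n) powr a)) * u (2 ^ Suc J) \<le> ?S \<nu>"
      by (intro mult_mono 1 2 3) (auto intro!: u0)
    then show ?thesis by (simp add: c_def mult_ac)
  qed
  have "2 ^ J * c = (\<Sum>\<nu>::nat=2 ^ J + 1..2 ^ Suc J. c)" by simp
  also have "\<dots> \<le> (\<Sum>\<nu>=2 ^ J + 1..2 ^ Suc J. ?S \<nu>)" by (rule sum_mono[OF S])
  finally have "2 powr (a + r + 1) * (2 ^ J * c) \<le> 2 powr (a + r + 1) * (\<Sum>\<nu>=2 ^ J + 1..2 ^ Suc J. ?S \<nu>)"
    by (intro mult_left_mono) auto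
  moreover have "2 powr (a + r + 1) * (2 ^ J * c) = min 1 ((M / real n) powr a) * M powr r * u (2 ^ Suc J)"
  proof -
    have "2 powr (a + r + 1) * 2 powr (- a) * 2 powr (- r) = (2::real)"
      by (simp flip: powr_add)
    moreover have "2 * (2 ^ J * M powr (r - 1)) = M powr r"
    proof -
      have "2 * (2 ^ J * M powr (r - 1)) = M * M powr (r - 1)" by (simp add: M_def)
      also have "\<dots> = M powr r" using M by (simp add: powr_diff)
      finally show ?thesis .
    qed
    moreover have "2 powr (a + r + 1) * (2 ^ J * c) = (2 powr (a + r + 1) * 2 powr (- a) * 2 powr (- r)) *
        (2 ^ J * M powr (r - 1)) * (min 1 ((M / real n) powr a) * u (2 ^ Suc J))"
      unfolding c_def by (simp only: mult_ac)
    ultimately show ?thesis by (simp only: mult_ac)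
  qed
  moreover have "(\<Sum>\<nu>=1..2 ^ Suc J. ?S \<nu>) = (\<Sum>\<nu>=1..2 ^ J. ?S \<nu>) + (\<Sum>\<nu>=2 ^ J + 1..2 ^ Suc J. ?S \<nu>)"
    by (rule sum.ub_add_nat[of 1 "2 ^ J" _ "2 ^ J", simplified mult_2[symmetric] power_Suc[symmetric]]) simp
  ultimately show ?case using Suc unfolding M_def by (simp add: distrib_left)
qed

text \<open>Both sums of the final estimate are kept as one series with weight min (1,
  (\<nu>/n)^\<alpha>), the form that condensation delivers. The bound concerns every g with the
  right coefficients, not just the one constructed.\<close>

lemma weyl_le_modulus:
  fixes r \<alpha> \<epsilon> :: real
  assumes r: "r > 0" and \<alpha>: "\<alpha> > 0" and \<epsilon>: "\<epsilon> > 0"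
  shows "\<exists>C>0. \<forall>p f. p \<in> {1, top} \<longrightarrow> f \<in> Lp p \<longrightarrow>
     summable (\<lambda>k. real (k + 1) powr (r - 1) * modulus p (r + \<alpha> + \<epsilon>) f (1 / real (k + 1))) \<longrightarrow>
     (\<exists>g. conj_weyl_deriv p r f g) \<and>
     (\<forall>g n. conj_weyl_deriv p r f g \<longrightarrow> 1 \<le> n \<longrightarrow> modulus p \<alpha> g (1 / real n) \<le>
        C * (\<Sum>k. real (k + 1) powr (r - 1) * min 1 ((real (k + 1) / real n) powr \<alpha>) *
               modulus p (r + \<alpha> + \<epsilon>) f (1 / real (k + 1))))"
proof -
  define \<gamma> where "\<gamma> = r + \<alpha> + \<epsilon>"
  have \<gamma>: "\<gamma> > 0" using r \<alpha> \<epsilon> by (simp add: \<gamma>_def)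
  define \<theta> where "\<theta> = pi * (r + 1) / 2"
  define K where "K = (\<Sum>n. \<bar>\<alpha> gchoose n\<bar>)"
  have K: "0 \<le> K" unfolding K_def using \<alpha> by (intro suminf_nonneg summable_abs_gbinomial) auto
  obtain P where P: "C2_bound P psi" using C2_bound_psi by blast
  obtain B where B: "C2_bound B (amp r 0 0 1)" using C2_bound_amp[of r 0 0] zero_less_one order_refl by metis
  obtain C1 where C1: "C1 > 0" "\<And>t p F H N c d s. \<lbrakk>0 < t; t \<le> 1; p \<in> {1, top}; F \<in> Lp p; H \<in> Lp p; 1 \<le> N; 0 \<le> s;
     \<And>k. fourier_coeff F k = of_real (s * (phi (real k / real N) * amp r (- \<gamma>) \<alpha> t (real k / real N))) * cis (c + d * real k) * fourier_coeff H k\<rbrakk> \<Longrightarrow>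
     Lp_norm p F \<le> C1 * s * Lp_norm p H"
    using dyadic_multiplier_bound[of r "- \<gamma>" \<alpha>] by blast
  obtain C2 where C2: "C2 > 0" "\<And>t p F H N c d s. \<lbrakk>0 < t; t \<le> 1; p \<in> {1, top}; F \<in> Lp p; H \<in> Lp p; 1 \<le> N; 0 \<le> s;
     \<And>k. fourier_coeff F k = of_real (s * (phi (real k / real N) * amp r (- \<gamma>) 0 t (real k / real N))) * cis (c + d * real k) * fourier_coeff H k\<rbrakk> \<Longrightarrow>
     Lp_norm p F \<le> C2 * s * Lp_norm p H"
    using dyadic_multiplier_bound[of r "- \<gamma>" 0] by blast
  define M where "M = C1 + K * C2"
  have M: "0 < M" using C1(1) C2(1) K by (simp add: M_def add_pos_nonneg)
  show ?thesis
  proof (rule exI[of _ "M * 2 powr (\<alpha> + r + 1)"], intro conjI[rotated] allI impI)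
    show "M * 2 powr (\<alpha> + r + 1) > 0" using M by simp
    fix p :: ennreal and f
    assume p: "p \<in> {1, top}" and f: "f \<in> Lp p"
      and sm: "summable (\<lambda>k. real (k + 1) powr (r - 1) * modulus p (r + \<alpha> + \<epsilon>) f (1 / real (k + 1)))"
    define u where "u \<nu> = modulus p \<gamma> f (1 / real \<nu>)" for \<nu> :: nat
    have sm: "summable (\<lambda>k. real (k + 1) powr (r - 1) * u (k + 1))" using sm by (simp add: u_def \<gamma>_def)
    have u0: "0 \<le> u \<nu>" for \<nu> unfolding u_def by (rule modulus_nonneg[OF p f \<gamma>]) simp
    have umono: "u \<mu> \<le> u \<nu>" if "1 \<le> \<nu>" "\<nu> \<le> \<mu>" for \<nu> \<mu>
      unfolding u_def by (rule modulus_mono[OF p f \<gamma>]) (use that in \<open>auto simp: frac_le\<close>)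
    \<comment> \<open>Two exponents are used: a = \<alpha> for the estimate and a = 0, where the
      weight is 1, for existence.\<close>
    define S where "S n a \<nu> = real \<nu> powr (r - 1) * min 1 ((real \<nu> / real n) powr a) * u \<nu>" for n :: nat and a :: real and \<nu> :: nat
    have S0: "0 \<le> S n a \<nu>" for n a \<nu> using u0 by (simp add: S_def)
    have Ssum: "summable (\<lambda>k. S n a (k + 1))" for n a
    proof (rule summable_comparison_test[OF _ sm], intro exI allI impI)
      fix k
      have "S n a (k + 1) \<le> real (k + 1) powr (r - 1) * 1 * u (k + 1)"
        unfolding S_def by (intro mult_mono) (auto simp: u0)
      then show "norm (S n a (k + 1)) \<le> real (k + 1) powr (r - 1) * u (k + 1)" using S0 by simp
    qed
    define w where "w n a j = min 1 ((2 ^ j / real n) powr a) * (2 ^ j) powr r * u (2 ^ j)" for n :: nat and a :: real and j :: nat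
    have w0: "0 \<le> w n a j" for n a j using u0 by (simp add: w_def)
    have wpart: "(\<Sum>j<J. w n a j) \<le> 2 powr (a + r + 1) * (\<Sum>k. S n a (k + 1))" if "1 \<le> n" "0 \<le> a" for n a J
    proof -
      have "(\<Sum>j<J. w n a j) \<le> (\<Sum>j\<le>J. w n a j)" by (rule sum_mono2) (auto simp: w0)
      also have "\<dots> \<le> 2 powr (a + r + 1) * (\<Sum>\<nu>=1..2 ^ J. S n a \<nu>)"
        unfolding w_def S_def by (rule dyadic_condensation) (use r that u0 umono in auto)
      also have "(\<Sum>\<nu>=1..2 ^ J. S n a \<nu>) = (\<Sum>k<2 ^ J. S n a (k + 1))"
        by (rule sum.reindex_bij_witness[of _ Suc "\<lambda>\<nu>. \<nu> - 1"]) auto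
      also have "\<dots> \<le> (\<Sum>k. S n a (k + 1))" by (rule sum_le_suminf[OF Ssum]) (auto simp: S0)
      finally show ?thesis by simp
    qed
    have w: "summable (w n a)" "(\<Sum>j. w n a j) \<le> 2 powr (a + r + 1) * (\<Sum>k. S n a (k + 1))" if "1 \<le> n" "0 \<le> a" for n a
    proof -
      show "summable (w n a)" by (rule summableI_nonneg_bounded[OF w0 wpart[OF that]])
      then show "(\<Sum>j. w n a j) \<le> 2 powr (a + r + 1) * (\<Sum>k. S n a (k + 1))"
        by (rule suminf_le_const[OF _ wpart[OF that]])
    qed
    \<comment> \<open>The j-th piece of the prospective derivative: a trigonometric polynomial
      computed from f, hence available before any derivative exists.\<close>
    define D where "D j = fourier_mult (\<lambda>k. (2 ^ j) powr r * (phi (real k / real (2 ^ j)) * amp r 0 0 1 (real k / real (2 ^ j)))) (2 * 2 ^ j) \<theta> f" for j :: nat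
    have D: "D j \<in> Lp p" for j unfolding D_def by (rule fourier_mult_Lp[OF p])
    have fcD: "fourier_coeff (D j) k = of_real (phi (real k / real (2 ^ j)) * real k powr r) * cis \<theta> * fourier_coeff f k" for j k
    proof -
      have "(2 ^ j) powr r * (phi x * amp r 0 0 1 x) = phi x * (2 ^ j * x) powr r" for x :: real
      proof (cases "phi x = 0")
        case False
        then have "sin (x / 2) > 0" using phi_nonzeroD[OF False] pi_gt3 by (intro sin_gt_zero) auto
        then show ?thesis by (simp add: amp_def powr_mult)
      qed simp
      then have "(2 ^ j) powr r * (phi (real k / real (2 ^ j)) * amp r 0 0 1 (real k / real (2 ^ j))) =
          phi (real k / real (2 ^ j)) * (2 ^ j * (real k / real (2 ^ j))) powr r" .
      also have "2 ^ j * (real k / real (2 ^ j)) = real k" by simp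
      finally have eq: "(2 ^ j) powr r * (phi (real k / real (2 ^ j)) * amp r 0 0 1 (real k / real (2 ^ j))) =
          phi (real k / real (2 ^ j)) * real k powr r" .
      have sb: "seq_bound ((2 ^ j) powr r * (4 * P * B)) (2 ^ j)
          (\<lambda>k. (2 ^ j) powr r * (phi (real k / real (2 ^ j)) * amp r 0 0 1 (real k / real (2 ^ j))))"
        by (rule seq_bound_phi[OF P B]) auto
      show ?thesis unfolding D_def fourier_coeff_fourier_mult[OF sb] eq ..
    qed
    \<comment> \<open>The step 2^-j is matched to the piece: its angles k / 2^j lie in [1/2, 2],
      where the symbol of order \<gamma> has no zero and can be divided out.\<close>
    define H where "H j = frac_diff \<gamma> (1 / 2 ^ j) f" for j :: nat
    have H: "H j \<in> Lp p" for j unfolding H_def by (rule frac_diff_Lp(1)[OF p f \<gamma>])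
    have Hu: "Lp_norm p (H j) \<le> u (2 ^ j)" for j
      unfolding H_def u_def by (rule Lp_norm_frac_diff_le_modulus[OF p f \<gamma>]) simp
    have fcH: "fourier_coeff (H j) k = of_real ((2 * sin (x / 2)) powr \<gamma>) * cis (\<gamma> * pi / 2 + \<gamma> / 2 ^ j / 2 * real k) * fourier_coeff f k"
      if "x = real k / real (2 ^ j)" "x \<in> {1/2..2}" for j k x
      unfolding H_def frac_diff_Lp(3)[OF p f \<gamma>]
      by (subst diff_symbol_scaled[of "1 / 2 ^ j" "2 ^ j" 1]) (use that in \<open>auto simp: mult.commute\<close>)
    have D_bound: "Lp_norm p (D j) \<le> C2 * (2 ^ j) powr r * u (2 ^ j)" for j
    proof -
      have "Lp_norm p (D j) \<le> C2 * (2 ^ j) powr r * Lp_norm p (H j)"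
      \<comment> \<open>The phases undo those of the symbol of order \<gamma> at step 2^-j and
        insert the phase \<theta> of the derivative.\<close>
      proof (rule C2(2)[OF zero_less_one order_refl p D H, where N="2 ^ j" and
          c="\<theta> - \<gamma> * pi / 2" and d="- (\<gamma> / 2 ^ j / 2)"])
        fix k :: nat
        define x where "x = real k / real (2 ^ j)"
        have k: "real k = 2 ^ j * x" by (simp add: x_def)
        show "fourier_coeff (D j) k = of_real ((2 ^ j) powr r * (phi (real k / real (2 ^ j)) * amp r (- \<gamma>) 0 1 (real k / real (2 ^ j)))) *
          cis (\<theta> - \<gamma> * pi / 2 + - (\<gamma> / 2 ^ j / 2) * real k) * fourier_coeff (H j) k"
        proof (cases "phi x = 0")
          case True then show ?thesis unfolding fcD x_def by simp
        next
          case False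
          then have x: "x \<in> {1/2..2}" using phi_nonzeroD by blast
          have sx: "sin (x / 2) > 0" using x pi_gt3 by (intro sin_gt_zero) auto
          have am: "amp r (- \<gamma>) 0 1 x * (2 * sin (x / 2)) powr \<gamma> = x powr r"
            using sx by (simp add: amp_def mult.assoc flip: powr_add)
          have c1: "(2 ^ j) powr r * (phi x * amp r (- \<gamma>) 0 1 x) * (2 * sin (x / 2)) powr \<gamma> = phi x * real k powr r"
          proof -
            have "(2 ^ j) powr r * (phi x * amp r (- \<gamma>) 0 1 x) * (2 * sin (x / 2)) powr \<gamma> =
              phi x * ((2 ^ j) powr r * (amp r (- \<gamma>) 0 1 x * (2 * sin (x / 2)) powr \<gamma>))" by (simp only: mult_ac)
            then show ?thesis unfolding am k powr_mult[of "2 ^ j" x r] .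
          qed
          have c2: "cis (\<theta> - \<gamma> * pi / 2 + - (\<gamma> / 2 ^ j / 2) * real k) * cis (\<gamma> * pi / 2 + \<gamma> / 2 ^ j / 2 * real k) = cis \<theta>"
            unfolding cis_mult by (simp add: algebra_simps)
          have "of_real ((2 ^ j) powr r * (phi x * amp r (- \<gamma>) 0 1 x)) *
              cis (\<theta> - \<gamma> * pi / 2 + - (\<gamma> / 2 ^ j / 2) * real k) * fourier_coeff (H j) k =
            of_real ((2 ^ j) powr r * (phi x * amp r (- \<gamma>) 0 1 x) * (2 * sin (x / 2)) powr \<gamma>) *
            (cis (\<theta> - \<gamma> * pi / 2 + - (\<gamma> / 2 ^ j / 2) * real k) * cis (\<gamma> * pi / 2 + \<gamma> / 2 ^ j / 2 * real k)) * fourier_coeff f k"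
            unfolding fcH[OF x_def x] of_real_mult by (simp only: mult_ac)
          also have "\<dots> = fourier_coeff (D j) k" unfolding c1 c2 fcD x_def[symmetric] ..
          finally show ?thesis unfolding x_def by (rule sym)
        qed
      qed auto
      also have "\<dots> \<le> C2 * (2 ^ j) powr r * u (2 ^ j)"
        using C2(1) Hu by (intro mult_left_mono) auto
      finally show ?thesis .
    qed
    \<comment> \<open>With t = 2^j |h|, the amplitude of order \<alpha> gives the gain t^\<alpha>
      when t <= 1; when t > 1 the operator bound K supplies the 1 in the minimum.\<close>
    have D_diff_bound: "Lp_norm p (frac_diff \<alpha> h (D j)) \<le> M * w n \<alpha> j" if n: "1 \<le> n" and h: "h \<noteq> 0" "\<bar>h\<bar> \<le> 1 / real n" for h n j
    proof -
      define t where "t = real (2 ^ j) * \<bar>h\<bar>"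
      have t0: "0 < t" using h by (simp add: t_def)
      have tn: "t \<le> 2 ^ j / real n" using mult_left_mono[OF h(2), of "2 ^ j"] by (simp add: t_def)
      have est: "Lp_norm p (frac_diff \<alpha> h (D j)) \<le> M * (min 1 (t powr \<alpha>) * (2 ^ j) powr r * u (2 ^ j))"
      proof (cases "t \<le> 1")
        case t1: True
        have X: "frac_diff \<alpha> h (D j) \<in> Lp p" by (rule frac_diff_Lp(1)[OF p D \<alpha>])
        have fcX: "fourier_coeff (frac_diff \<alpha> h (D j)) k = diff_symbol \<alpha> (real k * h) * fourier_coeff (D j) k" for k
          by (rule frac_diff_Lp(3)[OF p D \<alpha>])
        have "Lp_norm p (frac_diff \<alpha> h (D j)) \<le> C1 * ((2 ^ j) powr r * t powr \<alpha>) * Lp_norm p (H j)"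
        proof (rule C1(2)[OF t0 t1 p X H, where N="2 ^ j" and
            c="\<theta> - \<gamma> * pi / 2 + sgn h * \<alpha> * pi / 2" and d="\<alpha> * h / 2 - \<gamma> / 2 ^ j / 2"])
          fix k :: nat
          define x where "x = real k / real (2 ^ j)"
          have k: "real k = 2 ^ j * x" by (simp add: x_def)
          let ?c = "cis (\<theta> - \<gamma> * pi / 2 + sgn h * \<alpha> * pi / 2 + (\<alpha> * h / 2 - \<gamma> / 2 ^ j / 2) * real k)"
          let ?d = "cis (\<gamma> * pi / 2 + \<gamma> / 2 ^ j / 2 * real k)"
          show "fourier_coeff (frac_diff \<alpha> h (D j)) k = of_real ((2 ^ j) powr r * t powr \<alpha> * (phi (real k / real (2 ^ j)) * amp r (- \<gamma>) \<alpha> t (real k / real (2 ^ j)))) *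
            ?c * fourier_coeff (H j) k"
          proof (cases "phi x = 0")
            case True then show ?thesis unfolding fcX fcD x_def by simp
          next
            case False
            then have x: "x \<in> {1/2..2}" using phi_nonzeroD by blast
            have sx: "sin (x / 2) > 0" using x pi_gt3 by (intro sin_gt_zero) auto
            have am: "amp r (- \<gamma>) \<alpha> t x * (2 * sin (x / 2)) powr \<gamma> = x powr r * (2 * sin (t * x / 2) / t) powr \<alpha>"
            proof -
              have "(2 * sin (x / 2)) powr (- \<gamma>) * (2 * sin (x / 2)) powr \<gamma> = 1"
                using sx by (simp flip: powr_add)
              then have "x powr r * (2 * sin (t * x / 2) / t) powr \<alpha> *
                ((2 * sin (x / 2)) powr (- \<gamma>) * (2 * sin (x / 2)) powr \<gamma>) =
                x powr r * (2 * sin (t * x / 2) / t) powr \<alpha>" by simp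
              then show ?thesis unfolding amp_def by (simp only: mult_ac)
            qed
            have L: "diff_symbol \<alpha> (real k * h) = of_real (t powr \<alpha> * (2 * sin (t * x / 2) / t) powr \<alpha>) *
                cis (sgn h * \<alpha> * pi / 2 + \<alpha> * h / 2 * real k)"
              unfolding x_def by (rule diff_symbol_scaled[OF h(1) _ _ t1]) (use x in \<open>auto simp: t_def x_def\<close>)
            have c1: "(2 ^ j) powr r * t powr \<alpha> * (phi x * amp r (- \<gamma>) \<alpha> t x) * (2 * sin (x / 2)) powr \<gamma> =
                (t powr \<alpha> * (2 * sin (t * x / 2) / t) powr \<alpha>) * (phi x * real k powr r)"
            proof -
              have "(2 ^ j) powr r * t powr \<alpha> * (phi x * amp r (- \<gamma>) \<alpha> t x) * (2 * sin (x / 2)) powr \<gamma> =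
                (2 ^ j) powr r * t powr \<alpha> * (phi x * (amp r (- \<gamma>) \<alpha> t x * (2 * sin (x / 2)) powr \<gamma>))"
                by (simp only: mult_ac)
              then show ?thesis unfolding am k powr_mult[of "2 ^ j" x r] by (simp only: mult_ac)
            qed
            have c2: "?c * ?d = cis (sgn h * \<alpha> * pi / 2 + \<alpha> * h / 2 * real k) * cis \<theta>"
              unfolding cis_mult by (simp add: algebra_simps)
            have "of_real ((2 ^ j) powr r * t powr \<alpha> * (phi x * amp r (- \<gamma>) \<alpha> t x)) * ?c * fourier_coeff (H j) k =
              of_real ((2 ^ j) powr r * t powr \<alpha> * (phi x * amp r (- \<gamma>) \<alpha> t x) * (2 * sin (x / 2)) powr \<gamma>) *
              (?c * ?d) * fourier_coeff f k"
              unfolding fcH[OF x_def x] of_real_mult by (simp only: mult_ac)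
            also have "\<dots> = fourier_coeff (frac_diff \<alpha> h (D j)) k"
              unfolding c1 c2 fcX fcD L x_def[symmetric] of_real_mult by (simp only: mult_ac)
            finally show ?thesis unfolding x_def by (rule sym)
          qed
        qed auto
        also have "\<dots> \<le> C1 * ((2 ^ j) powr r * t powr \<alpha>) * u (2 ^ j)"
          using C1(1) Hu by (intro mult_left_mono) auto
        also have "\<dots> \<le> M * ((2 ^ j) powr r * t powr \<alpha>) * u (2 ^ j)"
          using C2(1) K u0 by (intro mult_right_mono) (auto simp: M_def)
        also have "t powr \<alpha> = min 1 (t powr \<alpha>)"
          using t0 t1 \<alpha> powr_mono2[of \<alpha> t 1] by simp
        finally show ?thesis by (simp add: mult_ac)
      next
        case False
        have "Lp_norm p (frac_diff \<alpha> h (D j)) \<le> K * Lp_norm p (D j)"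
          unfolding K_def by (rule frac_diff_Lp(2)[OF p D \<alpha>])
        also have "\<dots> \<le> K * (C2 * (2 ^ j) powr r * u (2 ^ j))" by (rule mult_left_mono[OF D_bound K])
        also have "\<dots> = (K * C2) * ((2 ^ j) powr r * u (2 ^ j))" by simp
        also have "\<dots> \<le> M * ((2 ^ j) powr r * u (2 ^ j))"
          using C1(1) u0 by (intro mult_right_mono) (auto simp: M_def)
        finally have "Lp_norm p (frac_diff \<alpha> h (D j)) \<le> M * ((2 ^ j) powr r * u (2 ^ j))" .
        moreover have "min 1 (t powr \<alpha>) = 1"
          using False \<alpha> ge_one_powr_ge_zero[of t \<alpha>] by simp
        ultimately show ?thesis by simp
      qed
      also have "\<dots> \<le> M * w n \<alpha> j"
      proof -
        have "t powr \<alpha> \<le> (2 ^ j / real n) powr \<alpha>" using t0 tn \<alpha> by (intro powr_mono2) auto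
        then show ?thesis unfolding w_def using M u0 by (intro mult_left_mono mult_right_mono min.mono) auto
      qed
      finally show ?thesis .
    qed
    show "\<exists>g. conj_weyl_deriv p r f g"
    proof -
      \<comment> \<open>With weight 1 the condensed terms are exactly the bounds for the pieces, so
        the hypothesis of convergence yields their summability.\<close>
      have w1: "w 1 0 j = (2 ^ j) powr r * u (2 ^ j)" for j by (simp add: w_def)
      have "summable (\<lambda>j. C2 * w 1 0 j)" by (intro summable_mult w) auto
      then have s: "summable (\<lambda>j. Lp_norm p (D j))"
        by (rule summable_comparison_test[rotated])
           (use D_bound Lp_norm_nonneg[OF p D] in \<open>auto simp: w1[simplified] mult.assoc\<close>)
      have "fourier_coeff (\<lambda>x. \<Sum>j. D j x) k = of_real (real k powr r) * cis \<theta> * fourier_coeff f k" for k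
      proof -
        have "(\<lambda>j. fourier_coeff (D j) k) sums (of_real (real k powr r) * cis \<theta> * fourier_coeff f k)"
        proof (cases "k = 0")
          case True then show ?thesis unfolding fcD by simp
        next
          case False
          have "(\<lambda>j. of_real (phi (real k / 2 ^ j)) * (of_real (real k powr r) * cis \<theta> * fourier_coeff f k)) sums
            (of_real 1 * (of_real (real k powr r) * cis \<theta> * fourier_coeff f k))"
            by (intro sums_mult2 sums_of_real phi_partition) (use False in simp)
          then show ?thesis unfolding fcD by (simp add: mult.assoc)
        qed
        then show ?thesis using sums_unique2 Lp_series(3)[OF p D s] by blast
      qed
      then have "conj_weyl_deriv p r f (\<lambda>x. \<Sum>j. D j x)"
        unfolding conj_weyl_deriv_iff using Lp_series(1)[OF p D s] by (simp add: \<theta>_def)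
      then show ?thesis by blast
    qed
    fix g and n :: nat
    assume fg: "conj_weyl_deriv p r f g" and n: "1 \<le> n"
    have g: "g \<in> Lp p" and fcg: "\<And>k. fourier_coeff g k = of_real (real k powr r) * cis \<theta> * fourier_coeff f k"
      using fg by (auto simp: conj_weyl_deriv_iff \<theta>_def)
    have wn: "summable (w n \<alpha>)" "(\<Sum>j. w n \<alpha> j) \<le> 2 powr (\<alpha> + r + 1) * (\<Sum>k. S n \<alpha> (k + 1))"
      using w[OF n, of \<alpha>] \<alpha> by auto
    have "modulus p \<alpha> g (1 / real n) \<le> M * (\<Sum>j. w n \<alpha> j)"
    proof (rule modulus_le)
      fix h :: real assume h: "\<bar>h\<bar> \<le> 1 / real n"
      show "Lp_norm p (frac_diff \<alpha> h g) \<le> M * (\<Sum>j. w n \<alpha> j)"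
      proof (cases "h = 0")
        case True
        then show ?thesis using Lp_norm_frac_diff_0[OF p g \<alpha>] M suminf_nonneg[OF wn(1) w0] by simp
      next
        case False
        have "Lp_norm p (frac_diff \<alpha> h g) \<le> (\<Sum>j. M * w n \<alpha> j)"
        proof (rule Lp_norm_le_series[OF p frac_diff_Lp(1)[OF p g \<alpha>] frac_diff_Lp(1)[OF p D \<alpha>] summable_mult[OF wn(1)] D_diff_bound[OF n False h]])
          fix k
          \<comment> \<open>On coefficients, the differences of the \<open>D j\<close> are the
            dyadic pieces of the difference of an arbitrary admissible g.\<close>
          have e: "fourier_coeff (frac_diff \<alpha> h (D j)) k = of_real (phi (real k / 2 ^ j)) * fourier_coeff (frac_diff \<alpha> h g) k" for j
            unfolding frac_diff_Lp(3)[OF p D \<alpha>] frac_diff_Lp(3)[OF p g \<alpha>] fcD fcg by simp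
          show "(\<lambda>j. fourier_coeff (frac_diff \<alpha> h (D j)) k) sums fourier_coeff (frac_diff \<alpha> h g) k"
          proof (cases "k = 0")
            case True
            then show ?thesis unfolding e by (simp add: phi_0 frac_diff_Lp(3)[OF p g \<alpha>] diff_symbol_0)
          next
            case False
            have "(\<lambda>j. of_real (phi (real k / 2 ^ j)) * fourier_coeff (frac_diff \<alpha> h g) k) sums (of_real 1 * fourier_coeff (frac_diff \<alpha> h g) k)"
              by (intro sums_mult2 sums_of_real phi_partition) (use False in simp)
            then show ?thesis unfolding e by simp
          qed
        qed
        also have "\<dots> = M * (\<Sum>j. w n \<alpha> j)" by (rule suminf_mult[OF wn(1)])
        finally show ?thesis .
      qed
    qed simp
    also have "\<dots> \<le> M * (2 powr (\<alpha> + r + 1) * (\<Sum>k. S n \<alpha> (k + 1)))"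
      using wn(2) M by (intro mult_left_mono) auto
    finally show "modulus p \<alpha> g (1 / real n) \<le> M * 2 powr (\<alpha> + r + 1) *
      (\<Sum>k. real (k + 1) powr (r - 1) * min 1 ((real (k + 1) / real n) powr \<alpha>) * modulus p (r + \<alpha> + \<epsilon>) f (1 / real (k + 1)))"
      by (simp add: S_def u_def \<gamma>_def mult.assoc)
  qed
qed


text \<open>The minimum is (\<nu>/n)^\<alpha> for \<nu> <= n and 1 beyond, which separates the head
  with factor n^-\<alpha> from the tail.\<close>

lemma weighted_series_split:
  fixes r \<alpha> :: real and u :: "nat \<Rightarrow> real"
  assumes \<alpha>: "\<alpha> > 0" and n: "1 \<le> n" and u0: "\<And>k. 0 \<le> u k"
    and sm: "summable (\<lambda>k. real (k + 1) powr (r - 1) * u (k + 1))"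
  shows "(\<Sum>k. real (k + 1) powr (r - 1) * min 1 ((real (k + 1) / real n) powr \<alpha>) * u (k + 1)) =
    real n powr (- \<alpha>) * (\<Sum>\<nu>=1..n. real \<nu> powr (r + \<alpha> - 1) * u \<nu>) +
    (\<Sum>k. real (n + 1 + k) powr (r - 1) * u (n + 1 + k))"
proof -
  define q where "q k = real (k + 1) powr (r - 1) * min 1 ((real (k + 1) / real n) powr \<alpha>) * u (k + 1)" for k
  have q0: "0 \<le> q k" for k using u0 by (simp add: q_def)
  have "summable q"
  proof (rule summable_comparison_test[OF _ sm], intro exI allI impI)
    fix k
    have "q k \<le> real (k + 1) powr (r - 1) * 1 * u (k + 1)"
      unfolding q_def by (intro mult_mono) (auto simp: u0)
    then show "norm (q k) \<le> real (k + 1) powr (r - 1) * u (k + 1)" using q0 by simp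
  qed
  then have "(\<Sum>k. q k) = (\<Sum>k. q (k + n)) + (\<Sum>k<n. q k)" by (rule suminf_split_initial_segment)
  also have "(\<Sum>k. q (k + n)) = (\<Sum>k. real (n + 1 + k) powr (r - 1) * u (n + 1 + k))"
  proof (rule suminf_cong)
    fix k
    have "1 \<le> (real (k + n + 1) / real n) powr \<alpha>"
      using n \<alpha> by (intro ge_one_powr_ge_zero) (auto simp: le_divide_eq)
    moreover have "k + n + 1 = n + 1 + k" by simp
    ultimately show "q (k + n) = real (n + 1 + k) powr (r - 1) * u (n + 1 + k)"
      unfolding q_def by (simp only: min.absorb1 mult_1_right)
  qed
  also have "(\<Sum>k<n. q k) = (\<Sum>\<nu>=1..n. real n powr (- \<alpha>) * (real \<nu> powr (r + \<alpha> - 1) * u \<nu>))"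
  proof (rule sum.reindex_bij_witness[of _ "\<lambda>\<nu>. \<nu> - 1" Suc])
    fix k assume "k \<in> {..<n}"
    then have k: "real (Suc k) / real n \<le> 1" "0 < real n" by auto
    have "(real (Suc k) / real n) powr \<alpha> \<le> 1 powr \<alpha>" using k \<alpha> by (intro powr_mono2) auto
    then have "min 1 ((real (Suc k) / real n) powr \<alpha>) = (real (Suc k) / real n) powr \<alpha>" by simp
    also have "\<dots> = real n powr (- \<alpha>) * real (Suc k) powr \<alpha>"
      unfolding powr_divide powr_minus by (simp add: divide_inverse)
    finally have m: "min 1 ((real (Suc k) / real n) powr \<alpha>) = real n powr (- \<alpha>) * real (Suc k) powr \<alpha>" .
    have "real (Suc k) powr (r + \<alpha> - 1) = real (Suc k) powr (r - 1) * real (Suc k) powr \<alpha>"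
      unfolding powr_add[symmetric] by (simp add: algebra_simps)
    then show "real n powr (- \<alpha>) * (real (Suc k) powr (r + \<alpha> - 1) * u (Suc k)) = q k"
      unfolding q_def by (simp add: m del: of_nat_Suc)
  qed auto
  finally show ?thesis unfolding q_def sum_distrib_left by simp
qed

theorem corollary4:
  fixes r \<alpha> \<epsilon> :: real
  assumes "r > 0" and "\<alpha> > 0" and "\<epsilon> > 0"
  shows "\<exists>C>0. \<forall>p::ennreal. p = 1 \<or> p = \<infinity> \<longrightarrow> (\<forall>f\<in>Lp p.
    (summable (\<lambda>k. real (k + 1) powr (r - 1) * modulus p (r + \<alpha> + \<epsilon>) f (1 / real (k + 1))) \<longrightarrow>
       (\<exists>g. conj_weyl_deriv p r f g) \<and>
       (\<forall>g. conj_weyl_deriv p r f g \<longrightarrow> (\<forall>n::nat. n \<ge> 1 \<longrightarrow>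
          modulus p \<alpha> g (1 / real n) \<le>
            C * (real n powr (- \<alpha>) *
                   (\<Sum>\<nu>=1..n. real \<nu> powr (r + \<alpha> - 1) * modulus p (r + \<alpha> + \<epsilon>) f (1 / real \<nu>)) +
                 (\<Sum>k. real (n + 1 + k) powr (r - 1) *
                   modulus p (r + \<alpha> + \<epsilon>) f (1 / real (n + 1 + k))))))) \<and>
    (\<forall>g. conj_weyl_deriv p r f g \<longrightarrow> (\<forall>n::nat. n \<ge> 1 \<longrightarrow>
       modulus p (r + \<alpha> + \<epsilon>) f (1 / real n) \<le> C / real n powr r * modulus p \<alpha> g (1 / real n))))"
proof -
  define \<gamma> where "\<gamma> = r + \<alpha> + \<epsilon>"
  have \<gamma>: "\<gamma> > 0" using assms by (simp add: \<gamma>_def)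
  obtain C1 where C1: "C1 > 0"
    "\<And>p f. \<lbrakk>p \<in> {1, top}; f \<in> Lp p; summable (\<lambda>k. real (k + 1) powr (r - 1) * modulus p \<gamma> f (1 / real (k + 1)))\<rbrakk> \<Longrightarrow>
     (\<exists>g. conj_weyl_deriv p r f g) \<and>
     (\<forall>g n. conj_weyl_deriv p r f g \<longrightarrow> 1 \<le> n \<longrightarrow> modulus p \<alpha> g (1 / real n) \<le>
        C1 * (\<Sum>k. real (k + 1) powr (r - 1) * min 1 ((real (k + 1) / real n) powr \<alpha>) * modulus p \<gamma> f (1 / real (k + 1))))"
    using weyl_le_modulus[OF assms] unfolding \<gamma>_def by blast
  obtain C2 where C2: "C2 > 0"
    "\<And>p f g n. \<lbrakk>p \<in> {1, top}; f \<in> Lp p; conj_weyl_deriv p r f g; 1 \<le> n\<rbrakk> \<Longrightarrow>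
     modulus p \<gamma> f (1 / real n) \<le> C2 / real n powr r * modulus p \<alpha> g (1 / real n)"
    using modulus_le_weyl[OF assms] unfolding \<gamma>_def by blast
  show ?thesis unfolding \<gamma>_def[symmetric]
  \<comment> \<open>One constant serves both parts: the expressions it multiplies are nonnegative,
    so each of C1 and C2 may be enlarged to the sum.\<close>
  proof (intro exI[of _ "C1 + C2"] conjI allI impI ballI)
    show "C1 + C2 > 0" using C1(1) C2(1) by simp
    fix p :: ennreal and f
    assume "p = 1 \<or> p = \<infinity>" and f: "f \<in> Lp p"
    then have p: "p \<in> {1, top}" by (auto simp: infinity_ennreal_def)
    have u0: "0 \<le> modulus p \<gamma> f (1 / real k)" for k by (rule modulus_nonneg[OF p f \<gamma>]) simp
    { fix g and n :: nat
      assume fg: "conj_weyl_deriv p r f g" and n: "1 \<le> n"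
      have g: "g \<in> Lp p" using fg by (simp add: conj_weyl_deriv_iff)
      have "modulus p \<gamma> f (1 / real n) \<le> C2 / real n powr r * modulus p \<alpha> g (1 / real n)"
        by (rule C2(2)[OF p f fg n])
      also have "\<dots> \<le> (C1 + C2) / real n powr r * modulus p \<alpha> g (1 / real n)"
        using C1(1) modulus_nonneg[OF p g assms(2)]
        by (intro mult_right_mono divide_right_mono) auto
      finally show "modulus p \<gamma> f (1 / real n) \<le> (C1 + C2) / real n powr r * modulus p \<alpha> g (1 / real n)" . }
    assume sm: "summable (\<lambda>k. real (k + 1) powr (r - 1) * modulus p \<gamma> f (1 / real (k + 1)))"
    show "\<exists>g. conj_weyl_deriv p r f g" using C1(2)[OF p f sm] by blast
    fix g and n :: nat
    assume fg: "conj_weyl_deriv p r f g" and n: "1 \<le> n"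
    let ?T = "\<Sum>k. real (k + 1) powr (r - 1) * min 1 ((real (k + 1) / real n) powr \<alpha>) * modulus p \<gamma> f (1 / real (k + 1))"
    let ?R = "real n powr (- \<alpha>) * (\<Sum>\<nu>=1..n. real \<nu> powr (r + \<alpha> - 1) * modulus p \<gamma> f (1 / real \<nu>)) +
      (\<Sum>k. real (n + 1 + k) powr (r - 1) * modulus p \<gamma> f (1 / real (n + 1 + k)))"
    have TR: "?T = ?R"
      by (rule weighted_series_split[OF assms(2) n, of "\<lambda>k. modulus p \<gamma> f (1 / real k)", OF u0 sm])
    have sm': "summable (\<lambda>k. real (n + 1 + k) powr (r - 1) * modulus p \<gamma> f (1 / real (n + 1 + k)))"
      using sm summable_iff_shift[of "\<lambda>k. real (k + 1) powr (r - 1) * modulus p \<gamma> f (1 / real (k + 1))" n]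
      by (simp add: add_ac)
    have "0 \<le> ?R"
      by (intro add_nonneg_nonneg mult_nonneg_nonneg sum_nonneg suminf_nonneg[OF sm'] u0) auto
    then have "C1 * ?R \<le> (C1 + C2) * ?R" using C2(1) by (intro mult_right_mono) auto
    moreover have "modulus p \<alpha> g (1 / real n) \<le> C1 * ?T" using C1(2)[OF p f sm] fg n by blast
    ultimately show "modulus p \<alpha> g (1 / real n) \<le> (C1 + C2) * ?R" unfolding TR by linarith
  qed
qed

end
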